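(* Let $n\geq 4$ and let $(M^n,g)$ be an $n$-dimensional compact Riemannian manifold with harmonic Weyl curvature, positive scalar curvature, and such that $\sigma_2(A_g)$ is a positive constant. If $$|W|^2+\frac{2n^2(n-4)}{(n-2)^3}|\mathring{Ric}|^{2}<\frac{16n}{(n-2)^3}\sigma_2(A_g)$$ on $M^n$, then $(M^n,g)$ is an Einstein manifold.
   Context: $Ric$ is the Ricci tensor, $R$ the scalar curvature, $\mathring{Ric}=Ric-\frac{R}{n}g$ the trace-free Ricci tensor, and $W$ the Weyl curvature tensor (of type $(0,4)$). Norms are full tensor norms: in a local orthonormal frame $|W|^2=\sum_{i,j,k,l}W_{ijkl}^2$ and $|\mathring{Ric}|^2=\sum_{i,j}\mathring{R}_{ij}^2$. $(M^n,g)$ has harmonic Weyl curvature if the divergence of its Weyl tensor vanishes, $\delta W=0$, i.e. $\sum_l W_{ijkl,l}=0$. The Schouten tensor is normalized as $A_g=Ric-\frac{R}{2(n-1)}g$, and $\sigma_2(A_g)$ is the second elementary symmetric function of its eigenvalues with respect to $g$, so $$2\sigma_2(A_g)=(\mathrm{tr}A_g)^2-|A_g|^2=\frac{(n-2)^2}{4n(n-1)}R^2-|\mathring{Ric}|^2.$$ *)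

theory Defs
  imports "HOL-Analysis.Analysis"
begin

section \<open>Smooth maps between Euclidean spaces\<close>

definition partial_deriv :: "'n \<Rightarrow> (real^'n \<Rightarrow> 'b::real_normed_vector) \<Rightarrow> real^'n \<Rightarrow> 'b" where
  "partial_deriv i f x = frechet_derivative f (at x) (axis i 1)"

text \<open>Only used for open \<open>S\<close>.\<close>

fun Ck_on :: "nat \<Rightarrow> (real^'n) set \<Rightarrow> (real^'n \<Rightarrow> 'b::real_normed_vector) \<Rightarrow> bool" where
  "Ck_on 0 S f \<longleftrightarrow> continuous_on S f"
| "Ck_on (Suc k) S f \<longleftrightarrow> f differentiable_on S \<and> (\<forall>i. Ck_on k S (partial_deriv i f))"

definition smooth_on :: "(real^'n) set \<Rightarrow> (real^'n \<Rightarrow> 'b::real_normed_vector) \<Rightarrow> bool" where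
  "smooth_on S f \<longleftrightarrow> (\<forall>k. Ck_on k S f)"

section \<open>Smooth manifolds and Riemannian metrics\<close>

text \<open>A chart is a coordinate map together with its domain; the values of the map outside the
  domain are irrelevant. The dimension of the manifold is the cardinality of \<open>'n\<close>.\<close>

type_synonym ('a, 'n) chart = "'a set \<times> ('a \<Rightarrow> real^'n)"

definition coords :: "('a, 'n) chart \<Rightarrow> (real^'n) set" where
  "coords C = snd C ` fst C"

definition overlap :: "('a, 'n) chart \<Rightarrow> ('a, 'n) chart \<Rightarrow> (real^'n) set" where
  "overlap C D = snd C ` (fst C \<inter> fst D)"

definition transition :: "('a, 'n) chart \<Rightarrow> ('a, 'n) chart \<Rightarrow> real^'n \<Rightarrow> real^'n" where
  "transition C D = snd D \<circ> inv_into (fst C) (snd C)"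

text \<open>The atlas is not required to be maximal. Connectedness is not required either.\<close>

definition smooth_manifold :: "'a topology \<Rightarrow> ('a, 'n::finite) chart set \<Rightarrow> bool" where
  "smooth_manifold X \<A> \<longleftrightarrow>
     Hausdorff_space X \<and> second_countable X \<and>
     (\<Union>C\<in>\<A>. fst C) = topspace X \<and>
     (\<forall>C\<in>\<A>. openin X (fst C) \<and> open (coords C) \<and>
        homeomorphic_map (subtopology X (fst C)) (top_of_set (coords C)) (snd C)) \<and>
     (\<forall>C\<in>\<A>. \<forall>D\<in>\<A>. smooth_on (overlap C D) (transition C D))"

text \<open>A metric is given by its components in every chart of the atlas, as functions of the
  coordinates; on overlaps they are related by the transformation law of covariant 2-tensors.\<close>

type_synonym ('a, 'n) metric = "('a, 'n) chart \<Rightarrow> real^'n \<Rightarrow> real^'n^'n"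

definition riemannian_metric :: "('a, 'n::finite) chart set \<Rightarrow> ('a, 'n) metric \<Rightarrow> bool" where
  "riemannian_metric \<A> g \<longleftrightarrow>
     (\<forall>C\<in>\<A>. smooth_on (coords C) (g C) \<and>
        (\<forall>x\<in>coords C. transpose (g C x) = g C x \<and> (\<forall>v. v \<noteq> 0 \<longrightarrow> v \<bullet> (g C x *v v) > 0))) \<and>
     (\<forall>C\<in>\<A>. \<forall>D\<in>\<A>. \<forall>x\<in>overlap C D.
        (let J = jacobian (transition C D) (at x)
         in g C x = transpose J ** g D (transition C D x) ** J))"

definition riemannian_manifold ::
  "'a topology \<Rightarrow> ('a, 'n::finite) chart set \<Rightarrow> ('a, 'n) metric \<Rightarrow> bool" where
  "riemannian_manifold X \<A> g \<longleftrightarrow> smooth_manifold X \<A> \<and> riemannian_metric \<A> g"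

section \<open>Algebra with respect to an inner product\<close>

text \<open>Here \<open>G\<close> is the Gram matrix of an inner product in an arbitrary basis. The norms are full
  contractions, i.e. the sums of the squares of all components in any \<open>G\<close>-orthonormal basis.\<close>

type_synonym 'n tensor4 = "'n \<Rightarrow> 'n \<Rightarrow> 'n \<Rightarrow> 'n \<Rightarrow> real"

abbreviation ginv :: "real^'n^'n \<Rightarrow> 'n \<Rightarrow> 'n \<Rightarrow> real" where
  "ginv G i j \<equiv> matrix_inv G $ i $ j"

definition trace2 :: "real^'n^'n \<Rightarrow> real^'n^'n \<Rightarrow> real" where
  "trace2 G S = (\<Sum>i\<in>UNIV. \<Sum>j\<in>UNIV. ginv G i j * S $ i $ j)"

definition normsq2 :: "real^'n^'n \<Rightarrow> real^'n^'n \<Rightarrow> real" where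
  "normsq2 G S = (\<Sum>i\<in>UNIV. \<Sum>a\<in>UNIV. \<Sum>j\<in>UNIV. \<Sum>b\<in>UNIV.
     ginv G i a * ginv G j b * S $ i $ j * S $ a $ b)"

definition normsq4 :: "real^'n^'n \<Rightarrow> 'n tensor4 \<Rightarrow> real" where
  "normsq4 G T = (\<Sum>i\<in>UNIV. \<Sum>a\<in>UNIV. \<Sum>j\<in>UNIV. \<Sum>b\<in>UNIV.
     \<Sum>k\<in>UNIV. \<Sum>c\<in>UNIV. \<Sum>l\<in>UNIV. \<Sum>d\<in>UNIV.
     ginv G i a * ginv G j b * ginv G k c * ginv G l d * T i j k l * T a b c d)"

definition orthonormal_frame :: "real^'n^'n \<Rightarrow> ('n \<Rightarrow> real^'n) \<Rightarrow> bool" where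
  "orthonormal_frame G e \<longleftrightarrow> (\<forall>a b. e a \<bullet> (G *v e b) = (if a = b then 1 else 0))"

text \<open>The family \<open>\<mu>\<close> lists, with multiplicities, the eigenvalues of the symmetric bilinear form
  \<open>S\<close> with respect to the inner product \<open>G\<close>. Such a family exists by the spectral theorem and is
  unique up to a permutation, so the choice in \<open>sigma2\<close> below is immaterial.\<close>

definition eigenvalues_wrt :: "real^'n^'n \<Rightarrow> real^'n^'n \<Rightarrow> ('n \<Rightarrow> real) \<Rightarrow> bool" where
  "eigenvalues_wrt G S \<mu> \<longleftrightarrow>
     (\<exists>e. orthonormal_frame G e \<and> (\<forall>a. S *v e a = \<mu> a *\<^sub>R (G *v e a)))"

definition sigma2 :: "real^'n^'n \<Rightarrow> real^'n^'n \<Rightarrow> real" where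
  "sigma2 G S = (let \<mu> = (SOME \<mu>. eigenvalues_wrt G S \<mu>)
                 in \<Sum>T | card T = 2. \<Prod>a\<in>T. \<mu> a)"

section \<open>Curvature in local coordinates\<close>

text \<open>Here \<open>G\<close> stands for the components of a metric in one chart. The functions below depend
  only on the germ of \<open>G\<close> at \<open>x\<close>.\<close>

text \<open>\<open>christoffel G x k i j\<close> is \<open>\<Gamma>\<close> with upper index \<open>k\<close> and lower indices \<open>i\<close>, \<open>j\<close>.\<close>

definition christoffel ::
  "(real^'n \<Rightarrow> real^'n^'n) \<Rightarrow> real^'n \<Rightarrow> 'n \<Rightarrow> 'n \<Rightarrow> 'n \<Rightarrow> real" where
  "christoffel G x k i j = 1/2 * (\<Sum>l\<in>UNIV. ginv (G x) k l *
     (partial_deriv i (\<lambda>y. G y $ j $ l) x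
      + partial_deriv j (\<lambda>y. G y $ i $ l) x
      - partial_deriv l (\<lambda>y. G y $ i $ j) x))"

text \<open>\<open>curv_op G x i j k m\<close> is the \<open>m\<close>-th component of
  \<open>\<nabla>\<^sub>i \<nabla>\<^sub>j \<partial>\<^sub>k - \<nabla>\<^sub>j \<nabla>\<^sub>i \<partial>\<^sub>k\<close>, and
  \<open>riemann G x i j k l\<close> is the inner product of \<open>\<partial>\<^sub>k\<close> with
  \<open>\<nabla>\<^sub>i \<nabla>\<^sub>j \<partial>\<^sub>l - \<nabla>\<^sub>j \<nabla>\<^sub>i \<partial>\<^sub>l\<close>. With this sign the
  unit sphere has \<open>R\<^sub>i\<^sub>j\<^sub>k\<^sub>l = g\<^sub>i\<^sub>k g\<^sub>j\<^sub>l - g\<^sub>i\<^sub>l g\<^sub>j\<^sub>k\<close> and positive Ricci curvature.\<close>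

definition curv_op :: "(real^'n \<Rightarrow> real^'n^'n) \<Rightarrow> real^'n \<Rightarrow> 'n tensor4" where
  "curv_op G x i j k m =
     partial_deriv i (\<lambda>y. christoffel G y m j k) x
     - partial_deriv j (\<lambda>y. christoffel G y m i k) x
     + (\<Sum>p\<in>UNIV. christoffel G x m i p * christoffel G x p j k
                 - christoffel G x m j p * christoffel G x p i k)"

definition riemann :: "(real^'n \<Rightarrow> real^'n^'n) \<Rightarrow> real^'n \<Rightarrow> 'n tensor4" where
  "riemann G x i j k l = (\<Sum>m\<in>UNIV. G x $ k $ m * curv_op G x i j l m)"

definition ricci :: "(real^'n \<Rightarrow> real^'n^'n) \<Rightarrow> real^'n \<Rightarrow> real^'n^'n" where
  "ricci G x = (\<chi> j l. \<Sum>i\<in>UNIV. \<Sum>k\<in>UNIV. ginv (G x) i k * riemann G x i j k l)"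

definition scalar_curv :: "(real^'n \<Rightarrow> real^'n^'n) \<Rightarrow> real^'n \<Rightarrow> real" where
  "scalar_curv G x = trace2 (G x) (ricci G x)"

definition tracefree_ricci :: "(real^'n \<Rightarrow> real^'n^'n) \<Rightarrow> real^'n \<Rightarrow> real^'n^'n" where
  "tracefree_ricci G x = ricci G x - (scalar_curv G x / real CARD('n)) *\<^sub>R G x"

definition schouten :: "(real^'n \<Rightarrow> real^'n^'n) \<Rightarrow> real^'n \<Rightarrow> real^'n^'n" where
  "schouten G x = ricci G x - (scalar_curv G x / (2 * (real CARD('n) - 1))) *\<^sub>R G x"

definition weyl :: "(real^'n \<Rightarrow> real^'n^'n) \<Rightarrow> real^'n \<Rightarrow> 'n tensor4" where
  "weyl G x i j k l = (let n = real CARD('n); g = G x; Ric = ricci G x in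
     riemann G x i j k l
     - (g$i$k * Ric$j$l - g$i$l * Ric$j$k - g$j$k * Ric$i$l + g$j$l * Ric$i$k) / (n - 2)
     + scalar_curv G x * (g$i$k * g$j$l - g$i$l * g$j$k) / ((n - 1) * (n - 2)))"

text \<open>\<open>cov_deriv4 G T x m i j k l\<close> is \<open>T\<^sub>i\<^sub>j\<^sub>k\<^sub>l\<^sub>,\<^sub>m\<close>.\<close>

definition cov_deriv4 ::
  "(real^'n \<Rightarrow> real^'n^'n) \<Rightarrow> (real^'n \<Rightarrow> 'n tensor4) \<Rightarrow> real^'n \<Rightarrow> 'n \<Rightarrow> 'n tensor4" where
  "cov_deriv4 G T x m i j k l = partial_deriv m (\<lambda>y. T y i j k l) x
     - (\<Sum>p\<in>UNIV. christoffel G x p m i * T x p j k l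
                 + christoffel G x p m j * T x i p k l
                 + christoffel G x p m k * T x i j p l
                 + christoffel G x p m l * T x i j k p)"

definition div_weyl :: "(real^'n \<Rightarrow> real^'n^'n) \<Rightarrow> real^'n \<Rightarrow> 'n \<Rightarrow> 'n \<Rightarrow> 'n \<Rightarrow> real" where
  "div_weyl G x i j k =
     (\<Sum>l\<in>UNIV. \<Sum>m\<in>UNIV. ginv (G x) l m * cov_deriv4 G (weyl G) x m i j k l)"

section \<open>Global conditions\<close>

definition harmonic_weyl :: "('a, 'n::finite) chart set \<Rightarrow> ('a, 'n) metric \<Rightarrow> bool" where
  "harmonic_weyl \<A> g \<longleftrightarrow> (\<forall>C\<in>\<A>. \<forall>x\<in>coords C. \<forall>i j k. div_weyl (g C) x i j k = 0)"

definition einstein :: "('a, 'n::finite) chart set \<Rightarrow> ('a, 'n) metric \<Rightarrow> bool" where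
  "einstein \<A> g \<longleftrightarrow> (\<exists>c::real. \<forall>C\<in>\<A>. \<forall>x\<in>coords C. ricci (g C) x = c *\<^sub>R g C x)"

end

theory Submission
  imports Defs
begin

text \<open>
  Since \<open>n \<ge> 4\<close>, \<open>\<delta> W = 0\<close> means that the Schouten tensor \<open>A\<close> is Codazzi. Let \<open>u = tr A\<close>, a positive
  multiple of \<open>R\<close>, and let \<open>p\<close> be a maximum of \<open>u\<close>. As \<open>u\<^sup>2 - |A|\<^sup>2 = 2 \<sigma>\<^sub>2\<close> is a positive constant, the form
  \<open>u g - A\<close> is positive, so its contraction with the Hessian of \<open>u\<close> is nonpositive at \<open>p\<close>. The
  Codazzi equation and the constancy of \<open>\<sigma>\<^sub>2\<close> turn this contraction (where \<open>du = 0\<close>) into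
  \<open>|\<nabla>A|\<^sup>2 + \<Sum> (\<mu>\<^sub>i\<^sup>2 - \<mu>\<^sub>i \<mu>\<^sub>k) K\<^sub>i\<^sub>k\<close> with \<open>\<mu>\<close> the eigenvalues of \<open>A\<close> and \<open>K\<close> the sectional curvatures,
  and the pinching hypothesis makes the curvature sum positive unless the trace-free Ricci tensor \<open>E\<close> is zero
  at \<open>p\<close>. Finally \<open>2 \<sigma>\<^sub>2 = (n - 2)\<^sup>2 / (4 n (n - 1)) R\<^sup>2 - |E|\<^sup>2\<close>, so \<open>E = 0\<close> where \<open>R\<close> is maximal forces
  \<open>|E|\<^sup>2 \<le> 0\<close> everywhere.
\<close>

text \<open>The form u g - A is the derivative of sigma_2 at A, which is why constancy of sigma_2
  controls its contraction with the Hessian of u. Covariant Hessians are avoided: the contraction is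
  computed with plain second partial derivatives in coordinates at p where g is the identity, its
  Christoffel symbols vanish and A is diagonal, so that curvature enters only through first
  derivatives of the Christoffel symbols. The price is naturality of Ricci, Weyl and the Codazzi
  equation under coordinate changes; it comes from a gauge law for the Christoffel symbols read as a
  matrix-valued connection form. For the pinching put e_i = \<mu>_i - tr A / n. The Weyl part of K
  is paired with an expression quadratic in e, the remainder produces the sum of the e_i^3, and each
  of the two norms that arise contains the sum of the e_i^4. The quartic sums cancel when one
  Cauchy-Schwarz inequality treats both parts together with relative weight n/(n-2). This is the
  weight that |E|^2 carries once sigma_2 is eliminated from the hypothesis: |W|^2 + 2n/(n-2) |E|^2 <
  2 R^2 / ((n-1)(n-2)).\<close>

abbreviation (input) sum_univ :: "('a::finite \<Rightarrow> 'b::comm_monoid_add) \<Rightarrow> 'b" (binder "\<Sigma>" 10) where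
  "sum_univ f \<equiv> sum f UNIV"

notation (input) partial_deriv ("\<partial>")

section \<open>Calculus of smooth maps\<close>

lemma partial_deriv_eq:
  "(f has_derivative f') (at x) \<Longrightarrow> \<partial> i f x = f' (axis i 1)"
  unfolding partial_deriv_def using frechet_derivative_at by metis

lemma has_derivative_partial_deriv:
  fixes f :: "real^'n \<Rightarrow> 'b::real_normed_vector"
  assumes "f differentiable (at x)"
  shows "(f has_derivative (\<lambda>v. \<Sigma> i. v $ i *\<^sub>R \<partial> i f x)) (at x)"
proof -
  have d: "(f has_derivative frechet_derivative f (at x)) (at x)"
    using assms frechet_derivative_works by blast
  have l: "linear (frechet_derivative f (at x))"
    using d has_derivative_linear by blast
  have "frechet_derivative f (at x) v = (\<Sigma> i. v $ i *\<^sub>R \<partial> i f x)" for v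
  proof -
    have "frechet_derivative f (at x) v = frechet_derivative f (at x) (\<Sigma> i. v $ i *\<^sub>R axis i 1)"
      using basis_expansion[of v] by (simp add: scalar_mult_eq_scaleR)
    then show ?thesis
      by (simp add: linear_sum[OF l] linear_cmul[OF l] partial_deriv_def)
  qed
  then show ?thesis using d by (metis (no_types, lifting) ext)
qed

text \<open>This is how an identity valid on an open set gets differentiated.
  \<open>frechet_derivative\<close> is a choice from the set of derivatives at x, and that set is
  the same for both functions.\<close>

lemma partial_deriv_cong:
  assumes "open S" "x \<in> S" "\<And>y. y \<in> S \<Longrightarrow> f y = g y"
  shows "\<partial> i f x = \<partial> i g x"
proof -
  have "(f has_derivative d) (at x) = (g has_derivative d) (at x)" for d
    using assms has_derivative_transform_within_open by (metis (no_types, lifting))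
  then show ?thesis by (simp add: partial_deriv_def frechet_derivative_def)
qed

lemma partial_deriv_const [simp]: "\<partial> i (\<lambda>y. c) x = 0"
  by (rule partial_deriv_eq[OF has_derivative_const])

lemma partial_deriv_add:
  "\<lbrakk>f differentiable (at x); g differentiable (at x)\<rbrakk> \<Longrightarrow>
    \<partial> i (\<lambda>y. f y + g y) x = \<partial> i f x + \<partial> i g x"
  unfolding frechet_derivative_works
  by (subst partial_deriv_eq[OF has_derivative_add]) (auto simp: partial_deriv_def)

lemma partial_deriv_diff:
  "\<lbrakk>f differentiable (at x); g differentiable (at x)\<rbrakk> \<Longrightarrow>
    \<partial> i (\<lambda>y. f y - g y) x = \<partial> i f x - \<partial> i g x"
  unfolding frechet_derivative_works
  by (subst partial_deriv_eq[OF has_derivative_diff]) (auto simp: partial_deriv_def)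

lemma partial_deriv_sum:
  assumes "\<And>a. a \<in> A \<Longrightarrow> f a differentiable (at x)"
  shows "\<partial> i (\<lambda>y. \<Sum>a\<in>A. f a y) x = (\<Sum>a\<in>A. \<partial> i (f a) x)"
  using partial_deriv_eq[OF has_derivative_sum[of A f "\<lambda>a. frechet_derivative (f a) (at x)"]]
    assms frechet_derivative_works by (metis (no_types, lifting) partial_deriv_def sum.cong)

lemma partial_deriv_linear:
  assumes "bounded_linear h" "f differentiable (at x)"
  shows "\<partial> i (\<lambda>y. h (f y)) x = h (\<partial> i f x)"
  using partial_deriv_eq[OF bounded_linear.has_derivative[OF assms(1)]] assms(2)
  by (simp add: partial_deriv_def frechet_derivative_works)

lemma partial_deriv_minus:
  "f differentiable (at x) \<Longrightarrow> \<partial> i (\<lambda>y. - f y) x = - \<partial> i f x"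
  by (rule partial_deriv_linear[OF bounded_linear_minus[OF bounded_linear_ident]])

lemma partial_deriv_bilinear:
  assumes "bounded_bilinear p" "f differentiable (at x)" "g differentiable (at x)"
  shows "\<partial> i (\<lambda>y. p (f y) (g y)) x = p (f x) (\<partial> i g x) + p (\<partial> i f x) (g x)"
  using partial_deriv_eq[OF bounded_bilinear.FDERIV[OF assms(1)]] assms(2,3)
  by (simp add: partial_deriv_def frechet_derivative_works)

lemma differentiable_bilinear:
  assumes "bounded_bilinear p" "f differentiable (at x)" "g differentiable (at x)"
  shows "(\<lambda>y. p (f y) (g y)) differentiable (at x)"
  using bounded_bilinear.FDERIV[OF assms(1)] assms(2,3) unfolding differentiable_def by blast

lemma differentiable_linear:
  assumes "bounded_linear h" "f differentiable (at x)"
  shows "(\<lambda>y. h (f y)) differentiable (at x)"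
  using bounded_linear.has_derivative[OF assms(1)] assms(2) unfolding differentiable_def by blast

text \<open>The calculus rules identify a partial derivative with a formula only at points of
  \<open>S\<close>, not as functions; this lemma carries regularity across such agreement. The
  functions are generalized because the induction passes to their partial derivatives.\<close>

lemma Ck_on_cong:
  fixes f g :: "real^'n \<Rightarrow> 'b::real_normed_vector"
  assumes "open S" "\<And>y. y \<in> S \<Longrightarrow> f y = g y"
  shows "Ck_on k S f \<Longrightarrow> Ck_on k S g"
  using assms
proof (induction k arbitrary: f g)
  case 0
  then show ?case using continuous_on_cong by (metis Ck_on.simps(1))
next
  case (Suc k)
  have "g differentiable_on S"
    unfolding differentiable_on_eq_differentiable_at[OF Suc.prems(2)] differentiable_def
  proof
    fix x assume x: "x \<in> S"
    have "f differentiable (at x)"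
      using Suc.prems(1,2) x by (simp add: differentiable_on_eq_differentiable_at)
    then show "\<exists>D. (g has_derivative D) (at x)"
      using has_derivative_transform_within_open[of f _ x UNIV S g] Suc.prems(2,3) x
      unfolding differentiable_def by blast
  qed
  moreover have "Ck_on k S (\<partial> i g)" for i
    by (rule Suc.IH[of "\<partial> i f"])
      (use Suc.prems partial_deriv_cong[of S _ f g] in auto)
  ultimately show ?case by simp
qed

lemma Ck_on_SucD: "Ck_on (Suc k) S f \<Longrightarrow> Ck_on k S f"
proof (induction k arbitrary: f)
  case 0 then show ?case by (auto intro: differentiable_imp_continuous_on)
next
  case (Suc k) then show ?case by (metis Ck_on.simps(2))
qed

lemma Ck_on_subset:
  "Ck_on k S f \<Longrightarrow> T \<subseteq> S \<Longrightarrow> Ck_on k T f"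
  by (induction k arbitrary: f) (auto intro: continuous_on_subset differentiable_on_subset)

lemma Ck_on_differentiable_at:
  "Ck_on (Suc k) S f \<Longrightarrow> open S \<Longrightarrow> x \<in> S \<Longrightarrow> f differentiable (at x)"
  by (auto simp: differentiable_on_eq_differentiable_at)

lemma Ck_on_const:
  fixes c :: "'b::real_normed_vector" and S :: "(real^'n) set"
  shows "Ck_on k S (\<lambda>y. c)"
proof (induction k arbitrary: c)
  case (Suc k)
  have "\<partial> i (\<lambda>y. c) = (\<lambda>y. 0)" for i :: 'n by auto
  then show ?case using Suc by (auto simp: differentiable_on_def)
qed simp

lemma Ck_on_add:
  assumes "open S"
  shows "Ck_on k S f \<Longrightarrow> Ck_on k S g \<Longrightarrow> Ck_on k S (\<lambda>y. f y + g y)"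
proof (induction k arbitrary: f g)
  case 0 then show ?case by (auto intro: continuous_on_add)
next
  case (Suc k)
  have "Ck_on k S (\<partial> i (\<lambda>y. f y + g y))" for i
    by (rule Ck_on_cong[OF assms _ Suc.IH[of "\<partial> i f" "\<partial> i g"]])
      (use Suc.prems assms in \<open>auto simp: partial_deriv_add differentiable_on_eq_differentiable_at\<close>)
  then show ?case using Suc.prems by (auto simp: differentiable_on_add)
qed

lemma Ck_on_linear:
  assumes "open S" "bounded_linear h"
  shows "Ck_on k S f \<Longrightarrow> Ck_on k S (\<lambda>y. h (f y))"
proof (induction k arbitrary: f)
  case 0 then show ?case using assms(2) by (auto intro: bounded_linear.continuous_on)
next
  case (Suc k)
  have "Ck_on k S (\<partial> i (\<lambda>y. h (f y)))" for i
    by (rule Ck_on_cong[OF assms(1) _ Suc.IH[of "\<partial> i f"]])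
      (use Suc.prems assms in \<open>auto simp: partial_deriv_linear differentiable_on_eq_differentiable_at\<close>)
  then show ?case using Suc.prems assms
    by (auto simp: differentiable_on_eq_differentiable_at differentiable_linear)
qed

lemma Ck_on_bilinear:
  assumes "open S" "bounded_bilinear p"
  shows "Ck_on k S f \<Longrightarrow> Ck_on k S g \<Longrightarrow> Ck_on k S (\<lambda>y. p (f y) (g y))"
proof (induction k arbitrary: f g)
  case 0 then show ?case using assms(2) by (auto intro: bounded_bilinear.continuous_on)
next
  case (Suc k)
  have "Ck_on k S (\<partial> i (\<lambda>y. p (f y) (g y)))" for i
    by (rule Ck_on_cong[OF assms(1) _ Ck_on_add[OF assms(1)
       Suc.IH[of f "\<partial> i g"] Suc.IH[of "\<partial> i f" g]]])
      (use Suc.prems assms Ck_on_SucD[OF Suc.prems(1)] Ck_on_SucD[OF Suc.prems(2)]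
        in \<open>auto simp: partial_deriv_bilinear differentiable_on_eq_differentiable_at\<close>)
  then show ?case using Suc.prems assms
    by (auto simp: differentiable_on_eq_differentiable_at differentiable_bilinear)
qed

lemma Ck_on_sum:
  assumes "open S" "\<And>a. a \<in> A \<Longrightarrow> Ck_on k S (f a)"
  shows "Ck_on k S (\<lambda>y. \<Sum>a\<in>A. f a y)"
  using assms(2) by (induction A rule: infinite_finite_induct) (auto intro: Ck_on_const Ck_on_add[OF assms(1)])

text \<open>The derivative of 1/f contains 1/f again, but only one order less of regularity is asked
  of it, which the induction hypothesis supplies.\<close>

lemma Ck_on_inverse:
  fixes f :: "real^'n \<Rightarrow> real"
  assumes "open S" "\<And>y. y \<in> S \<Longrightarrow> f y \<noteq> 0"
  shows "Ck_on k S f \<Longrightarrow> Ck_on k S (\<lambda>y. inverse (f y))"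
proof (induction k)
  case 0 then show ?case using assms(2) by (auto intro: continuous_on_inverse)
next
  case (Suc k)
  have IH: "Ck_on k S (\<lambda>y. inverse (f y))" using Suc Ck_on_SucD by blast
  note mult = Ck_on_bilinear[OF assms(1) bounded_bilinear_mult]
  have d: "((\<lambda>y. inverse (f y)) has_derivative
      (\<lambda>h. - (inverse (f x) * frechet_derivative f (at x) h * inverse (f x)))) (at x)" if "x \<in> S" for x
    by (rule Deriv.has_derivative_inverse)
      (use Suc.prems that assms in \<open>auto simp: differentiable_on_eq_differentiable_at simp flip: frechet_derivative_works\<close>)
  have "Ck_on k S (\<partial> i (\<lambda>y. inverse (f y)))" for i
  proof (rule Ck_on_cong[OF assms(1)])
    show "- (inverse (f y) * \<partial> i f y * inverse (f y)) = \<partial> i (\<lambda>y. inverse (f y)) y"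
      if "y \<in> S" for y
      using partial_deriv_eq[OF d[OF that]] by (simp add: partial_deriv_def)
    show "Ck_on k S (\<lambda>y. - (inverse (f y) * \<partial> i f y * inverse (f y)))"
      by (intro Ck_on_linear[OF assms(1) bounded_linear_minus[OF bounded_linear_ident]] mult IH)
        (use Suc.prems in auto)
  qed
  then show ?case using d assms(1)
    by (auto simp: differentiable_on_eq_differentiable_at differentiable_def)
qed

lemma has_derivative_compose_partial:
  assumes "f differentiable (at (F x))" "F differentiable (at x)"
  shows "((\<lambda>y. f (F y)) has_derivative (\<lambda>h. \<Sigma> a. frechet_derivative F (at x) h $ a *\<^sub>R \<partial> a f (F x))) (at x)"
proof -
  have "(F has_derivative frechet_derivative F (at x)) (at x)"
    using assms(2) by (simp add: frechet_derivative_works)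
  from diff_chain_at[OF this has_derivative_partial_deriv[OF assms(1)]] show ?thesis
    by (simp add: o_def)
qed

lemma partial_deriv_compose:
  assumes "f differentiable (at (F x))" "F differentiable (at x)"
  shows "\<partial> i (\<lambda>y. f (F y)) x = (\<Sigma> a. \<partial> i F x $ a *\<^sub>R \<partial> a f (F x))"
  using partial_deriv_eq[OF has_derivative_compose_partial[OF assms]] by (simp add: partial_deriv_def)

text \<open>By the chain rule a partial derivative of the composite is a sum of products of partial
  derivatives of \<open>F\<close> with composites of partial derivatives of \<open>f\<close>. The
  induction therefore varies \<open>f\<close> and keeps \<open>F\<close>.\<close>

lemma Ck_on_compose:
  assumes "open S" "open T" "F ` S \<subseteq> T"
  shows "Ck_on k T f \<Longrightarrow> Ck_on k S F \<Longrightarrow> Ck_on k S (\<lambda>y. f (F y))"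
proof (induction k arbitrary: f)
  case 0 then show ?case using assms by (auto intro: continuous_on_compose2)
next
  case (Suc k)
  have fd: "f differentiable (at (F y))" "F differentiable (at y)" if "y \<in> S" for y
    using that assms Ck_on_differentiable_at[OF Suc.prems(1) assms(2)]
      Ck_on_differentiable_at[OF Suc.prems(2) assms(1)] by auto
  have "Ck_on k S (\<partial> i (\<lambda>y. f (F y)))" for i
  proof (rule Ck_on_cong[OF assms(1)])
    show "(\<Sigma> a. \<partial> i F y $ a *\<^sub>R \<partial> a f (F y)) = \<partial> i (\<lambda>y. f (F y)) y"
      if "y \<in> S" for y
      by (rule partial_deriv_compose[OF fd[OF that], symmetric])
    show "Ck_on k S (\<lambda>y. \<Sigma> a. \<partial> i F y $ a *\<^sub>R \<partial> a f (F y))"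
      by (intro Ck_on_sum assms Ck_on_bilinear[OF assms(1) bounded_bilinear_scaleR]
           Ck_on_linear[OF assms(1) bounded_linear_vec_nth] Suc.IH)
        (use Suc.prems Ck_on_SucD[OF Suc.prems(2)] in auto)
  qed
  moreover have "(\<lambda>y. f (F y)) differentiable_on S"
    using has_derivative_compose_partial[OF fd] assms(1)
    unfolding differentiable_on_eq_differentiable_at[OF assms(1)] differentiable_def by blast
  ultimately show ?case by simp
qed

section \<open>Closure properties of smooth maps\<close>

lemma smooth_on_differentiable: "smooth_on S f \<Longrightarrow> open S \<Longrightarrow> x \<in> S \<Longrightarrow> f differentiable (at x)"
  using Ck_on_differentiable_at smooth_on_def by blast

lemma smooth_on_partial_deriv: "smooth_on S f \<Longrightarrow> smooth_on S (\<partial> i f)"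
  unfolding smooth_on_def by (metis Ck_on.simps(2))

lemma smooth_on_continuous: "smooth_on S f \<Longrightarrow> continuous_on S f"
  unfolding smooth_on_def by (metis Ck_on.simps(1))

lemma smooth_on_cong: "smooth_on S f \<Longrightarrow> open S \<Longrightarrow> (\<And>y. y \<in> S \<Longrightarrow> f y = g y) \<Longrightarrow> smooth_on S g"
  unfolding smooth_on_def using Ck_on_cong by blast

lemma smooth_on_subset: "smooth_on S f \<Longrightarrow> T \<subseteq> S \<Longrightarrow> smooth_on T f"
  unfolding smooth_on_def using Ck_on_subset by blast

lemma smooth_on_const: "smooth_on S (\<lambda>y. c)"
  by (simp add: smooth_on_def Ck_on_const)

lemma smooth_on_linear: "open S \<Longrightarrow> bounded_linear h \<Longrightarrow> smooth_on S f \<Longrightarrow> smooth_on S (\<lambda>y. h (f y))"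
  by (simp add: smooth_on_def Ck_on_linear)

lemma smooth_on_bilinear:
  "open S \<Longrightarrow> bounded_bilinear p \<Longrightarrow> smooth_on S f \<Longrightarrow> smooth_on S g \<Longrightarrow> smooth_on S (\<lambda>y. p (f y) (g y))"
  by (simp add: smooth_on_def Ck_on_bilinear)

lemma smooth_on_id:
  fixes S :: "(real^'b) set"
  shows "smooth_on S (\<lambda>y. y)"
proof -
  have "Ck_on k S (\<lambda>y. y)" for k
  proof (cases k)
    case (Suc m)
    have "\<partial> i (\<lambda>y. y) = (\<lambda>y. axis i 1)" for i :: 'b
      by (intro ext partial_deriv_eq) auto
    moreover have "Ck_on m S (\<lambda>y. axis i 1 :: real^'b)" for i by (rule Ck_on_const)
    ultimately show ?thesis using Suc by (auto simp: differentiable_on_def)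
  qed simp
  then show ?thesis by (simp add: smooth_on_def)
qed

lemma bounded_bilinear_matrix_mult: "bounded_bilinear ((**) :: real^'n^'m \<Rightarrow> real^'k^'n \<Rightarrow> real^'k^'m)"
  unfolding bilinear_conv_bounded_bilinear[symmetric] bilinear_def
  by (auto simp: linear_iff matrix_add_ldistrib matrix_matrix_mult_def vec_eq_iff
      scaleR_sum_right algebra_simps sum.distrib sum_distrib_left)

lemma bounded_linear_transpose: "bounded_linear (transpose :: real^'n^'m \<Rightarrow> real^'m^'n)"
  unfolding linear_conv_bounded_linear[symmetric]
  by (auto simp: linear_iff transpose_def vec_eq_iff)

lemma smooth_on_add: "open S \<Longrightarrow> smooth_on S f \<Longrightarrow> smooth_on S g \<Longrightarrow> smooth_on S (\<lambda>y. f y + g y)"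
  by (simp add: smooth_on_def Ck_on_add)

lemma smooth_on_minus: "open S \<Longrightarrow> smooth_on S f \<Longrightarrow> smooth_on S (\<lambda>y. - f y)"
  by (intro smooth_on_linear[OF _ bounded_linear_minus[OF bounded_linear_ident]])

lemma smooth_on_diff: "open S \<Longrightarrow> smooth_on S f \<Longrightarrow> smooth_on S g \<Longrightarrow> smooth_on S (\<lambda>y. f y - g y)"
  using smooth_on_add[of S f "\<lambda>y. - g y"] smooth_on_minus[of S g] by simp

lemma smooth_on_sum: "open S \<Longrightarrow> (\<And>a. a \<in> A \<Longrightarrow> smooth_on S (f a)) \<Longrightarrow> smooth_on S (\<lambda>y. \<Sum>a\<in>A. f a y)"
  by (simp add: smooth_on_def Ck_on_sum)

lemma smooth_on_scaleR: "open S \<Longrightarrow> smooth_on S f \<Longrightarrow> smooth_on S g \<Longrightarrow> smooth_on S (\<lambda>y. f y *\<^sub>R g y)"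
  by (rule smooth_on_bilinear[OF _ bounded_bilinear_scaleR])

lemma smooth_on_mult:
  fixes f g :: "real^'n \<Rightarrow> real"
  shows "open S \<Longrightarrow> smooth_on S f \<Longrightarrow> smooth_on S g \<Longrightarrow> smooth_on S (\<lambda>y. f y * g y)"
  by (rule smooth_on_bilinear[OF _ bounded_bilinear_mult])

lemma smooth_on_matrix_mult:
  fixes f :: "real^'n \<Rightarrow> real^'k^'m"
  shows "open S \<Longrightarrow> smooth_on S f \<Longrightarrow> smooth_on S g \<Longrightarrow> smooth_on S (\<lambda>y. f y ** g y)"
  by (rule smooth_on_bilinear[OF _ bounded_bilinear_matrix_mult])

lemma smooth_on_transpose:
  fixes f :: "real^'n \<Rightarrow> real^'k^'m"
  shows "open S \<Longrightarrow> smooth_on S f \<Longrightarrow> smooth_on S (\<lambda>y. transpose (f y))"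
  by (rule smooth_on_linear[OF _ bounded_linear_transpose])

lemma smooth_on_nth:
  fixes f :: "real^'n \<Rightarrow> 'b::real_normed_vector^'m"
  shows "open S \<Longrightarrow> smooth_on S f \<Longrightarrow> smooth_on S (\<lambda>y. f y $ i)"
  by (rule smooth_on_linear[OF _ bounded_linear_vec_nth])

lemma smooth_on_prod:
  fixes f :: "'a \<Rightarrow> real^'n \<Rightarrow> real"
  shows "open S \<Longrightarrow> (\<And>a. a \<in> A \<Longrightarrow> smooth_on S (f a)) \<Longrightarrow> smooth_on S (\<lambda>y. \<Prod>a\<in>A. f a y)"
  by (induction A rule: infinite_finite_induct) (auto intro: smooth_on_const smooth_on_mult)

lemma smooth_on_inverse:
  fixes f :: "real^'n \<Rightarrow> real"
  shows "open S \<Longrightarrow> (\<And>y. y \<in> S \<Longrightarrow> f y \<noteq> 0) \<Longrightarrow> smooth_on S f \<Longrightarrow> smooth_on S (\<lambda>y. inverse (f y))"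
  by (simp add: smooth_on_def Ck_on_inverse)

lemma smooth_on_compose:
  shows "open S \<Longrightarrow> open T \<Longrightarrow> F ` S \<subseteq> T \<Longrightarrow> smooth_on T f \<Longrightarrow> smooth_on S F \<Longrightarrow> smooth_on S (\<lambda>y. f (F y))"
  unfolding smooth_on_def using Ck_on_compose by blast

lemma smooth_on_vec_lambda:
  fixes f :: "'m::finite \<Rightarrow> real^'n \<Rightarrow> 'b::euclidean_space"
  assumes "open S" "\<And>i. smooth_on S (f i)"
  shows "smooth_on S (\<lambda>y. \<chi> i. f i y)"
proof -
  have l: "bounded_linear (\<lambda>c. axis i c :: 'b^'m)" for i
    unfolding linear_conv_bounded_linear[symmetric] by (auto simp: linear_iff axis_def vec_eq_iff)
  have "smooth_on S (\<lambda>y. \<Sigma> i. axis i (f i y))"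
    by (intro smooth_on_sum assms smooth_on_linear[OF _ l])
  moreover have "(\<Sigma> i. axis i (c i)) = (\<chi> i. c i)" for c :: "'m \<Rightarrow> 'b"
    by (simp add: vec_eq_iff axis_def)
  ultimately show ?thesis by simp
qed

lemma smooth_on_det:
  fixes f :: "real^'n \<Rightarrow> real^'m^'m"
  assumes "open S" "smooth_on S f"
  shows "smooth_on S (\<lambda>y. det (f y))"
  unfolding det_def
  by (intro smooth_on_sum smooth_on_mult smooth_on_const smooth_on_prod assms
      smooth_on_nth[OF assms(1) smooth_on_nth])

section \<open>Inverse matrices and their smooth dependence on parameters\<close>

lemma matrix_inv:
  fixes A :: "real^'n^'n"
  assumes "det A \<noteq> 0"
  shows "A ** matrix_inv A = mat 1" "matrix_inv A ** A = mat 1"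
  using someI_ex[of "\<lambda>B. A ** B = mat 1 \<and> B ** A = mat 1"] assms
  unfolding matrix_inv_def invertible_det_nz[symmetric] invertible_def by auto

lemma matrix_inv_unique:
  fixes A B :: "real^'n^'n"
  assumes "A ** B = mat 1"
  shows "matrix_inv A = B"
proof -
  have "det A \<noteq> 0" using assms det_I[where 'n='n] det_mul[of A B] by auto
  then have "matrix_inv A ** (A ** B) = B"
    by (simp only: matrix_mul_assoc) (auto simp: matrix_inv)
  then show ?thesis by (simp add: assms)
qed

text \<open>Cramer's rule exhibits each entry of the inverse as a polynomial in the entries divided
  by the determinant, so smoothness of inversion reduces to sums, products and reciprocals.\<close>

lemma matrix_inv_cramer:
  fixes A :: "real^'n^'n"
  assumes "det A \<noteq> 0"
  shows "matrix_inv A = (\<chi> k j. det (\<chi> i l. if l = k then (if i = j then 1 else 0) else A $ i $ l) * inverse (det A))"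
proof -
  have "(\<Sigma> l. A $ i $ l * matrix_inv A $ l $ j) = (if i = j then 1 else 0)" for i j
    using matrix_inv(1)[OF assms] by (simp add: vec_eq_iff matrix_matrix_mult_def mat_def)
  then have "A *v column j (matrix_inv A) = (\<chi> i. if i = j then 1 else 0)" for j
    by (simp add: vec_eq_iff matrix_vector_mult_def column_def)
  from iffD1[OF cramer[OF assms] this] show ?thesis
    by (simp add: vec_eq_iff column_def divide_inverse cong: if_cong)
qed

lemma smooth_on_matrix_inv:
  fixes f :: "real^'n \<Rightarrow> real^'m^'m"
  assumes "open S" "smooth_on S f" "\<And>y. y \<in> S \<Longrightarrow> det (f y) \<noteq> 0"
  shows "smooth_on S (\<lambda>y. matrix_inv (f y))"
proof -
  have "smooth_on S (\<lambda>y. if b then c else f y $ i $ l)" for b c i l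
    by (cases b) (auto intro: smooth_on_const smooth_on_nth[OF assms(1) smooth_on_nth] assms)
  then have "smooth_on S (\<lambda>y. (\<chi> k j. det (\<chi> i l. if l = k then (if i = j then 1 else 0) else f y $ i $ l) * inverse (det (f y))) :: real^'m^'m)"
    by (intro smooth_on_vec_lambda assms smooth_on_mult smooth_on_inverse smooth_on_det) auto
  then show ?thesis
    by (rule smooth_on_cong) (simp_all add: assms matrix_inv_cramer)
qed

section \<open>Second derivatives\<close>

lemma has_real_derivative_line:
  fixes f :: "real^'n \<Rightarrow> real"
  assumes "f differentiable (at (p + t *\<^sub>R axis i 1))"
  shows "((\<lambda>t. f (p + t *\<^sub>R axis i 1)) has_real_derivative \<partial> i f (p + t *\<^sub>R axis i 1)) (at t)"
proof -
  have 1: "((\<lambda>t. p + t *\<^sub>R axis i 1) has_derivative (\<lambda>h. h *\<^sub>R axis i 1)) (at t)"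
    by (auto intro!: derivative_eq_intros)
  have 2: "(f has_derivative frechet_derivative f (at (p + t *\<^sub>R axis i 1))) (at (p + t *\<^sub>R axis i 1))"
    using assms by (simp add: frechet_derivative_works)
  have "frechet_derivative f (at (p + t *\<^sub>R axis i 1)) (h *\<^sub>R axis i 1) =
     h * \<partial> i f (p + t *\<^sub>R axis i 1)" for h
    using linear_cmul[OF has_derivative_linear[OF 2]] by (simp add: partial_deriv_def)
  then show ?thesis
    using diff_chain_at[OF 1 2] by (simp add: has_field_derivative_def o_def mult_commute_abs)
qed

text \<open>The second difference is symmetric in i and j, while the mean value theorem, applied
  first along i and then along j, expresses it by one order of differentiation. Using both orders
  yields the symmetry of second derivatives.\<close>

lemma second_difference_mvt:
  fixes f :: "real^'n \<Rightarrow> real"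
  assumes S: "open S" and f: "smooth_on S f" and h: "h > 0"
    and box: "\<And>s t. \<lbrakk>0 \<le> s; s \<le> h; 0 \<le> t; t \<le> h\<rbrakk> \<Longrightarrow> x + s *\<^sub>R axis i 1 + t *\<^sub>R axis j 1 \<in> S"
  obtains s t where "0 < s" "s < h" "0 < t" "t < h"
    "f (x + h *\<^sub>R axis i 1 + h *\<^sub>R axis j 1) - f (x + h *\<^sub>R axis i 1) - f (x + h *\<^sub>R axis j 1) + f x
     = h\<^sup>2 * \<partial> j (\<partial> i f) (x + s *\<^sub>R axis i 1 + t *\<^sub>R axis j 1)"
proof -
  define u where "u s = f ((x + h *\<^sub>R axis j 1) + s *\<^sub>R axis i 1) - f (x + s *\<^sub>R axis i 1)" for s
  note d = smooth_on_differentiable[OF f S] smooth_on_differentiable[OF smooth_on_partial_deriv[OF f] S]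
  have in1: "(x + h *\<^sub>R axis j 1) + s *\<^sub>R axis i 1 \<in> S" if "0 \<le> s" "s \<le> h" for s
    using box[of s h] that h by (simp add: algebra_simps)
  have in2: "x + s *\<^sub>R axis i 1 \<in> S" if "0 \<le> s" "s \<le> h" for s
    using box[of s 0] that h by simp
  have "(u has_real_derivative \<partial> i f ((x + h *\<^sub>R axis j 1) + s *\<^sub>R axis i 1)
      - \<partial> i f (x + s *\<^sub>R axis i 1)) (at s)" if "0 \<le> s" "s \<le> h" for s
    unfolding u_def by (intro DERIV_diff has_real_derivative_line d in1 in2 that)
  from MVT2[OF h this] obtain s where s: "0 < s" "s < h"
    and us: "u h - u 0 = (h - 0) * (\<partial> i f ((x + h *\<^sub>R axis j 1) + s *\<^sub>R axis i 1)
      - \<partial> i f (x + s *\<^sub>R axis i 1))" by blast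
  have "((\<lambda>t. \<partial> i f ((x + s *\<^sub>R axis i 1) + t *\<^sub>R axis j 1)) has_real_derivative
      \<partial> j (\<partial> i f) ((x + s *\<^sub>R axis i 1) + t *\<^sub>R axis j 1)) (at t)"
    if "0 \<le> t" "t \<le> h" for t
    by (intro has_real_derivative_line d box) (use s that in auto)
  from MVT2[OF h this] obtain t where t: "0 < t" "t < h"
    and ut: "\<partial> i f ((x + s *\<^sub>R axis i 1) + h *\<^sub>R axis j 1) - \<partial> i f ((x + s *\<^sub>R axis i 1) + 0 *\<^sub>R axis j 1)
      = (h - 0) * \<partial> j (\<partial> i f) ((x + s *\<^sub>R axis i 1) + t *\<^sub>R axis j 1)" by blast
  show ?thesis
    by (rule that[OF s t]) (use us ut in \<open>simp add: u_def algebra_simps power2_eq_square\<close>)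
qed

lemma partial_deriv_commute_real:
  fixes f :: "real^'n \<Rightarrow> real"
  assumes S: "open S" and f: "smooth_on S f" and x: "x \<in> S"
  shows "\<partial> i (\<partial> j f) x = \<partial> j (\<partial> i f) x"
proof -
  let ?D = "\<lambda>i j. \<partial> i (\<partial> j f)" and ?p = "\<lambda>i j s t. x + s *\<^sub>R axis i (1::real) + t *\<^sub>R axis j 1"
  have *: "\<bar>?D i j x - ?D j i x\<bar> \<le> e" if e: "e > 0" for e
  proof -
    have "\<exists>d>0. \<forall>y. dist y x < d \<longrightarrow> dist (?D i j y) (?D i j x) < e/2" for i j
    proof -
      have "isCont (?D i j) x"
        using smooth_on_continuous[OF smooth_on_partial_deriv[OF smooth_on_partial_deriv[OF f]]] x
        by (simp add: continuous_on_eq_continuous_at[OF S])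
      then show ?thesis using half_gt_zero[OF e] unfolding continuous_at_eps_delta by blast
    qed
    note cont = this
    obtain d1 where d1: "d1 > 0" "\<And>y. dist y x < d1 \<Longrightarrow> dist (?D i j y) (?D i j x) < e/2"
      using cont[of i j] by blast
    obtain d2 where d2: "d2 > 0" "\<And>y. dist y x < d2 \<Longrightarrow> dist (?D j i y) (?D j i x) < e/2"
      using cont[of j i] by blast
    obtain d3 where d3: "d3 > 0" "ball x d3 \<subseteq> S" using S x open_contains_ball by blast
    \<comment> \<open>The factor 3 leaves room for both displacements: their sum has norm at most
      2h, which is strictly below each of the three radii.\<close>
    define h where "h = Min {d1,d2,d3} / 3"
    have h: "h > 0" "3 * h \<le> d1" "3 * h \<le> d2" "3 * h \<le> d3" using d1 d2 d3 by (auto simp: h_def)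
    have near: "dist (?p i j s t) x < 3 * h"
      if "0 \<le> s" "s \<le> h" "0 \<le> t" "t \<le> h" for s t and i j :: 'n
    proof -
      have "norm (s *\<^sub>R axis i 1 + t *\<^sub>R axis j (1::real)) \<le> s + t"
        using norm_triangle_ineq[of "s *\<^sub>R axis i (1::real)" "t *\<^sub>R axis j 1"] that by simp
      then show ?thesis using that h by (simp add: dist_norm add.assoc)
    qed
    have inS: "?p i j s t \<in> S"
      if "0 \<le> s" "s \<le> h" "0 \<le> t" "t \<le> h" for s t and i j :: 'n
    proof -
      have "?p i j s t \<in> ball x d3"
        using near[OF that, of i j] h(4) by (simp add: dist_commute)
      then show ?thesis using d3(2) by blast
    qed
    obtain s t where st: "0 < s" "s < h" "0 < t" "t < h"
      "f (x + h *\<^sub>R axis i 1 + h *\<^sub>R axis j 1) - f (x + h *\<^sub>R axis i 1) - f (x + h *\<^sub>R axis j 1) + f x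
       = h\<^sup>2 * ?D j i (?p i j s t)"
      by (rule second_difference_mvt[OF S f h(1), of x i j]) (use inS in auto)
    obtain s' t' where st': "0 < s'" "s' < h" "0 < t'" "t' < h"
      "f (x + h *\<^sub>R axis j 1 + h *\<^sub>R axis i 1) - f (x + h *\<^sub>R axis j 1) - f (x + h *\<^sub>R axis i 1) + f x
       = h\<^sup>2 * ?D i j (?p j i s' t')"
      by (rule second_difference_mvt[OF S f h(1), of x j i]) (use inS in auto)
    have "h\<^sup>2 * ?D j i (?p i j s t) = h\<^sup>2 * ?D i j (?p j i s' t')"
      using st(5) st'(5) by (simp add: algebra_simps)
    then have eq: "?D j i (?p i j s t) = ?D i j (?p j i s' t')"
      using h by simp
    have "\<bar>?D j i (?p i j s t) - ?D j i x\<bar> < e/2"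
      unfolding dist_real_def[symmetric] by (rule d2(2)) (use near[of s t i j] st h in simp)
    moreover have "\<bar>?D i j (?p j i s' t') - ?D i j x\<bar> < e/2"
      unfolding dist_real_def[symmetric] by (rule d1(2)) (use near[of s' t' j i] st' h in simp)
    ultimately show ?thesis unfolding eq by linarith
  qed
  have "\<bar>?D i j x - ?D j i x\<bar> \<le> 0"
    by (rule field_le_epsilon, unfold add_0_left, erule *)
  then show ?thesis by simp
qed

lemma partial_deriv_commute:
  fixes f :: "real^'n \<Rightarrow> 'b::euclidean_space"
  assumes S: "open S" and f: "smooth_on S f" and x: "x \<in> S"
  shows "\<partial> i (\<partial> j f) x = \<partial> j (\<partial> i f) x"
proof (rule euclidean_eqI)
  fix b :: 'b assume "b \<in> Basis"
  have l: "bounded_linear (\<lambda>v::'b. v \<bullet> b)" by (rule bounded_linear_inner_left)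
  have "\<partial> i (\<partial> j f) x \<bullet> b = \<partial> i (\<partial> j (\<lambda>y. f y \<bullet> b)) x" for i j
  proof -
    have "\<partial> i (\<partial> j f) x \<bullet> b = \<partial> i (\<lambda>y. \<partial> j f y \<bullet> b) x"
      by (rule partial_deriv_linear[OF l, symmetric])
        (rule smooth_on_differentiable[OF smooth_on_partial_deriv[OF f] S x])
    also have "\<dots> = \<partial> i (\<partial> j (\<lambda>y. f y \<bullet> b)) x"
      by (rule partial_deriv_cong[OF S x], rule partial_deriv_linear[OF l, symmetric])
        (rule smooth_on_differentiable[OF f S])
    finally show ?thesis .
  qed
  then show "\<partial> i (\<partial> j f) x \<bullet> b = \<partial> j (\<partial> i f) x \<bullet> b"
    using partial_deriv_commute_real[OF S smooth_on_linear[OF S l f] x] by simp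
qed

lemma interior_max_derivatives:
  fixes f :: "real^'n \<Rightarrow> real"
  assumes S: "open S" and f: "smooth_on S f" and x: "x \<in> S" and max: "\<And>y. y \<in> S \<Longrightarrow> f y \<le> f x"
  shows "\<partial> k f x = 0" "\<partial> k (\<partial> k f) x \<le> 0"
proof -
  define \<phi> where "\<phi> t = f (x + t *\<^sub>R axis k 1)" for t
  define \<phi>1 where "\<phi>1 t = \<partial> k f (x + t *\<^sub>R axis k 1)" for t
  obtain d where d: "d > 0" "ball x d \<subseteq> S" using S x open_contains_ball by blast
  have inS: "x + t *\<^sub>R axis k 1 \<in> S" if "\<bar>t\<bar> < d" for t
    using d that by (auto simp: dist_norm subset_eq)
  have D: "(\<phi> has_real_derivative \<phi>1 t) (at t)" if "\<bar>t\<bar> < d" for t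
    unfolding \<phi>_def \<phi>1_def
    by (intro has_real_derivative_line smooth_on_differentiable[OF f S] inS that)
  have D1: "(\<phi>1 has_real_derivative \<partial> k (\<partial> k f) (x + 0 *\<^sub>R axis k 1)) (at 0)"
    unfolding \<phi>1_def
    by (intro has_real_derivative_line smooth_on_differentiable[OF smooth_on_partial_deriv[OF f] S] inS) (use d in auto)
  have mx: "\<phi> t \<le> \<phi> 0" if "\<bar>t\<bar> < d" for t
    using max[OF inS[OF that]] by (simp add: \<phi>_def)
  have z: "\<phi>1 0 = 0"
    by (rule DERIV_local_max[OF D, of 0 d]) (use d mx in auto)
  then show "\<partial> k f x = 0" by (simp add: \<phi>1_def)
  show "\<partial> k (\<partial> k f) x \<le> 0"
  proof (rule ccontr)
    \<comment> \<open>A positive second derivative makes \<phi>1, which vanishes at 0, positive just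
      to the right of 0; by the mean value theorem \<phi> would then exceed its maximum.\<close>
    assume "\<not> ?thesis"
    then obtain e where e: "e > 0" "\<And>h. 0 < h \<Longrightarrow> h < e \<Longrightarrow> \<phi>1 0 < \<phi>1 (0 + h)"
      using DERIV_pos_inc_right[OF D1] by auto
    define t where "t = min d e / 2"
    have t: "0 < t" "t < d" "t < e" using d e by (auto simp: t_def)
    obtain s where s: "0 < s" "s < t" "\<phi> t - \<phi> 0 = (t - 0) * \<phi>1 s"
      using MVT2[OF t(1), of \<phi> \<phi>1] D t by fastforce
    have "\<phi>1 s > 0" using e(2)[of s] s t z by simp
    then have "\<phi> t > \<phi> 0" using s t by (smt (verit) mult_pos_pos)
    then show False using mx[of t] t by auto
  qed
qed

section \<open>The Levi-Civita connection and curvature as matrices\<close>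

lemmas mat_bilin =
  bounded_bilinear.add_left[OF bounded_bilinear_matrix_mult]
  bounded_bilinear.add_right[OF bounded_bilinear_matrix_mult]
  bounded_bilinear.diff_left[OF bounded_bilinear_matrix_mult]
  bounded_bilinear.diff_right[OF bounded_bilinear_matrix_mult]
  bounded_bilinear.minus_left[OF bounded_bilinear_matrix_mult]
  bounded_bilinear.minus_right[OF bounded_bilinear_matrix_mult]
  bounded_bilinear.sum_left[OF bounded_bilinear_matrix_mult]
  bounded_bilinear.sum_right[OF bounded_bilinear_matrix_mult]
  bounded_bilinear.scaleR_left[OF bounded_bilinear_matrix_mult]
  bounded_bilinear.scaleR_right[OF bounded_bilinear_matrix_mult]

lemmas transpose_lin =
  linear_add[OF bounded_linear.linear[OF bounded_linear_transpose]]
  linear_diff[OF bounded_linear.linear[OF bounded_linear_transpose]]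
  linear_neg[OF bounded_linear.linear[OF bounded_linear_transpose]]
  linear_sum[OF bounded_linear.linear[OF bounded_linear_transpose]]
  linear_cmul[OF bounded_linear.linear[OF bounded_linear_transpose]]

lemma partial_deriv_nth:
  fixes f :: "real^'n \<Rightarrow> 'b::real_normed_vector^'m"
  assumes "f differentiable (at x)"
  shows "\<partial> i (\<lambda>y. f y $ j) x = \<partial> i f x $ j"
  by (rule partial_deriv_linear[OF bounded_linear_vec_nth assms])

lemma differentiable_nth:
  fixes f :: "real^'n \<Rightarrow> 'b::real_normed_vector^'m"
  assumes "f differentiable (at x)"
  shows "(\<lambda>y. f y $ j) differentiable (at x)"
  by (rule differentiable_linear[OF bounded_linear_vec_nth assms])

lemma partial_deriv_nth_nth:
  fixes f :: "real^'n \<Rightarrow> real^'k^'m"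
  assumes "f differentiable (at x)"
  shows "\<partial> i (\<lambda>y. f y $ j $ l) x = \<partial> i f x $ j $ l"
  using partial_deriv_nth[OF differentiable_nth[OF assms]] partial_deriv_nth[OF assms] by simp

lemma partial_deriv_matrix_mult:
  fixes A :: "real^'n \<Rightarrow> real^'k^'m"
  assumes "A differentiable (at x)" "B differentiable (at x)"
  shows "\<partial> i (\<lambda>y. A y ** B y) x = A x ** \<partial> i B x + \<partial> i A x ** B x"
  by (rule partial_deriv_bilinear[OF bounded_bilinear_matrix_mult assms])

lemma partial_deriv_transpose:
  fixes A :: "real^'n \<Rightarrow> real^'k^'m"
  assumes "A differentiable (at x)"
  shows "\<partial> i (\<lambda>y. transpose (A y)) x = transpose (\<partial> i A x)"
  by (rule partial_deriv_linear[OF bounded_linear_transpose assms])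

lemma differentiable_matrix_mult:
  fixes A :: "real^'n \<Rightarrow> real^'k^'m"
  assumes "A differentiable (at x)" "B differentiable (at x)"
  shows "(\<lambda>y. A y ** B y) differentiable (at x)"
  by (rule differentiable_bilinear[OF bounded_bilinear_matrix_mult assms])

lemma differentiable_transpose:
  fixes A :: "real^'n \<Rightarrow> real^'k^'m"
  assumes "A differentiable (at x)"
  shows "(\<lambda>y. transpose (A y)) differentiable (at x)"
  by (rule differentiable_linear[OF bounded_linear_transpose assms])

text \<open>The connection form evaluated on the i-th coordinate field: the row is the upper index
  and the column is the field being differentiated. In this arrangement metric compatibility,
  curvature and coordinate changes become matrix identities.\<close>

definition connection_matrix :: "(real^'n \<Rightarrow> real^'n^'n) \<Rightarrow> 'n \<Rightarrow> real^'n \<Rightarrow> real^'n^'n" where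
  "connection_matrix G i x = (\<chi> m k. christoffel G x m i k)"

definition curvature_matrix :: "(real^'n \<Rightarrow> real^'n^'n) \<Rightarrow> 'n \<Rightarrow> 'n \<Rightarrow> real^'n \<Rightarrow> real^'n^'n" where
  "curvature_matrix G i j x = (\<chi> m k. curv_op G x i j k m)"

text \<open>Local geometry without a manifold. The instances are coordinate images of charts,
  overlaps of charts and domains of normal coordinates.\<close>

locale metric_field =
  fixes S :: "(real^'n) set" and G :: "real^'n \<Rightarrow> real^'n^'n"
  assumes open_S: "open S" and smooth_G: "smooth_on S G"
    and sym_G: "x \<in> S \<Longrightarrow> transpose (G x) = G x"
    and pos_G: "x \<in> S \<Longrightarrow> v \<noteq> 0 \<Longrightarrow> v \<bullet> (G x *v v) > 0"
begin

abbreviation \<Gamma> where "\<Gamma> \<equiv> connection_matrix G"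
abbreviation Rm where "Rm \<equiv> curvature_matrix G"

lemma det_G:
  assumes x: "x \<in> S"
  shows "det (G x) \<noteq> 0"
proof -
  have "inj ((*v) (G x))"
    using pos_G[OF x] by (auto simp: inj_matrix_vector_mult linear_injective_0 matrix_vector_mult_diff_distrib)
      (metis inner_zero_right less_irrefl)
  then show "det (G x) \<noteq> 0"
    by (simp add: invertible_det_nz[symmetric] invertible_left_inverse matrix_left_invertible_injective)
qed

abbreviation H where "H x \<equiv> matrix_inv (G x)"

lemma G_inv [simp]: "x \<in> S \<Longrightarrow> G x ** H x = mat 1"
  "x \<in> S \<Longrightarrow> H x ** G x = mat 1"
  using matrix_inv det_G by blast+

lemma sym_G_nth: "x \<in> S \<Longrightarrow> G x $ i $ j = G x $ j $ i"
  using sym_G[of x] by (simp add: transpose_def vec_eq_iff)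

lemma sym_G_inv:
  assumes x: "x \<in> S"
  shows "transpose (H x) = H x"
proof -
  have "G x ** transpose (H x) = transpose (H x ** G x)"
    by (simp only: matrix_transpose_mul sym_G[OF x])
  then show ?thesis using matrix_inv_unique[of "G x" "transpose (H x)"] x
    by (simp add: transpose_mat)
qed

lemma sym_G_inv_nth: "x \<in> S \<Longrightarrow> H x $ i $ j = H x $ j $ i"
  using sym_G_inv[of x] by (simp add: transpose_def vec_eq_iff)

lemma G_inv_sum: "x \<in> S \<Longrightarrow> (\<Sigma> p. G x $ j $ p * H x $ p $ l) = (if j = l then 1 else 0)"
  "x \<in> S \<Longrightarrow> (\<Sigma> p. H x $ j $ p * G x $ p $ l) = (if j = l then 1 else 0)"
  using G_inv[of x] by (simp_all add: matrix_matrix_mult_def vec_eq_iff mat_def)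

lemma smooth_G_inv: "smooth_on S H"
  by (rule smooth_on_matrix_inv[OF open_S smooth_G det_G])

lemma partial_deriv_G_sym:
  assumes x: "x \<in> S"
  shows "\<partial> i G x $ j $ l = \<partial> i G x $ l $ j"
proof -
  have "\<partial> i (\<lambda>y. G y $ j $ l) x = \<partial> i (\<lambda>y. G y $ l $ j) x"
    by (rule partial_deriv_cong[OF open_S x sym_G_nth])
  then show ?thesis
    using partial_deriv_nth_nth[OF smooth_on_differentiable[OF smooth_G open_S x]] by metis
qed

lemma christoffel_eq: "x \<in> S \<Longrightarrow> christoffel G x k i j = 1/2 * (\<Sigma> l. H x $ k $ l *
    (\<partial> i G x $ j $ l + \<partial> j G x $ i $ l - \<partial> l G x $ i $ j))"
  unfolding christoffel_def
  by (simp add: partial_deriv_nth_nth[OF smooth_on_differentiable[OF smooth_G open_S]])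

lemma smooth_christoffel: "smooth_on S (\<lambda>x. christoffel G x k i j)"
proof (rule smooth_on_cong[OF _ open_S christoffel_eq[symmetric]])
  have nn: "smooth_on S (\<lambda>x. f x $ a $ b)" if "smooth_on S f" for f :: "real^'n \<Rightarrow> real^'n^'n" and a b
    by (intro smooth_on_nth[OF open_S smooth_on_nth] open_S that)
  show "smooth_on S (\<lambda>x. 1/2 * (\<Sigma> l. H x $ k $ l *
    (\<partial> i G x $ j $ l + \<partial> j G x $ i $ l - \<partial> l G x $ i $ j)))"
    by (intro smooth_on_mult open_S smooth_on_const smooth_on_sum smooth_on_add smooth_on_diff nn
        smooth_G_inv smooth_on_partial_deriv smooth_G)
qed

lemma smooth_\<Gamma>: "smooth_on S (\<Gamma> i)"
  unfolding connection_matrix_def[abs_def]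
  by (intro smooth_on_vec_lambda open_S smooth_christoffel)

lemma \<Gamma>_sym: "x \<in> S \<Longrightarrow> \<Gamma> i x $ m $ k = \<Gamma> k x $ m $ i"
  by (simp add: connection_matrix_def christoffel_eq partial_deriv_G_sym[of x _ i k] add_ac)

text \<open>Lowering the upper index cancels the inverse metric and leaves the Christoffel symbols
  of the first kind.\<close>

lemma G_\<Gamma>:
  assumes x: "x \<in> S"
  shows "(G x ** \<Gamma> i x) $ j $ k =
    1/2 * (\<partial> i G x $ k $ j + \<partial> k G x $ i $ j - \<partial> j G x $ i $ k)"
proof -
  let ?f = "\<lambda>l. \<partial> i G x $ k $ l + \<partial> k G x $ i $ l - \<partial> l G x $ i $ k"
  have "(G x ** \<Gamma> i x) $ j $ k = (\<Sigma> p. G x $ j $ p * (1/2 * (\<Sigma> l. H x $ p $ l * ?f l)))"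
    using x by (simp add: matrix_matrix_mult_def connection_matrix_def christoffel_eq)
  also have "\<dots> = 1/2 * (\<Sigma> p l. G x $ j $ p * H x $ p $ l * ?f l)"
    by (simp add: sum_distrib_left sum_distrib_right mult_ac)
  also have "\<dots> = 1/2 * (\<Sigma> l. (\<Sigma> p. G x $ j $ p * H x $ p $ l) * ?f l)"
    by (subst sum.swap) (simp only: sum_distrib_right)
  also have "\<dots> = 1/2 * ?f j"
    by (simp only: G_inv_sum[OF x]) (simp add: mult_delta_left)
  finally show ?thesis .
qed

lemma metric_compatible:
  assumes x: "x \<in> S"
  shows "\<partial> i G x = G x ** \<Gamma> i x + transpose (\<Gamma> i x) ** G x"
proof -
  have t: "transpose (\<Gamma> i x) ** G x = transpose (G x ** \<Gamma> i x)"
    by (simp only: matrix_transpose_mul sym_G[OF x])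
  show ?thesis
    unfolding t using x
    by (simp add: vec_eq_iff G_\<Gamma> transpose_def partial_deriv_G_sym[OF x, of i] field_simps)
qed

text \<open>With its upper index lowered, the difference \<open>D\<close> of two such connections is
  symmetric in the direction and the column, and antisymmetric in the row and the column;
  alternating the two symmetries gives D = -D. This identifies a transformed connection without
  inserting the transformed metric into the Christoffel formula.\<close>

lemma connection_unique:
  assumes x: "x \<in> S" and sym: "\<And>i m k. C i $ m $ k = C k $ m $ i"
    and compat: "\<And>i. \<partial> i G x = G x ** C i + transpose (C i) ** G x"
  shows "C i = \<Gamma> i x"
proof -
  define D where "D i = G x ** (C i - \<Gamma> i x)" for i
  have D1: "D i $ j $ k = D k $ j $ i" for i j k
    unfolding D_def matrix_matrix_mult_def using sym \<Gamma>_sym[OF x] by (simp; metis)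
  have "D i + transpose (D i) = 0" for i
    using compat[of i] metric_compatible[OF x, of i]
    by (simp add: D_def mat_bilin matrix_transpose_mul sym_G[OF x] transpose_lin algebra_simps)
  then have D2: "D i $ j $ k = - D i $ k $ j" for i j k
    by (simp add: vec_eq_iff transpose_def eq_neg_iff_add_eq_0)
  have "D i $ j $ k = - D i $ j $ k" for i j k
    by (metis D1 D2)
  then have "D i = 0" by (simp add: vec_eq_iff)
  then have "H x ** (G x ** (C i - \<Gamma> i x)) = 0"
    by (simp add: D_def)
  then show ?thesis using x by (simp add: matrix_mul_assoc)
qed

lemma differentiable_\<Gamma>: "x \<in> S \<Longrightarrow> \<Gamma> i differentiable (at x)"
  by (rule smooth_on_differentiable[OF smooth_\<Gamma> open_S])

lemma differentiable_G: "x \<in> S \<Longrightarrow> G differentiable (at x)"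
  by (rule smooth_on_differentiable[OF smooth_G open_S])

lemma Rm_eq:
  assumes x: "x \<in> S"
  shows "Rm i j x = \<partial> i (\<Gamma> j) x - \<partial> j (\<Gamma> i) x + \<Gamma> i x ** \<Gamma> j x - \<Gamma> j x ** \<Gamma> i x"
proof -
  have "\<partial> i (\<lambda>y. christoffel G y m j k) x = \<partial> i (\<Gamma> j) x $ m $ k" for i j m k
    using partial_deriv_nth_nth[OF differentiable_\<Gamma>[OF x], of i j m k] by (simp add: connection_matrix_def)
  then show ?thesis
    by (simp add: vec_eq_iff curvature_matrix_def curv_op_def sum_subtractf)
      (simp add: connection_matrix_def matrix_matrix_mult_def)
qed

lemma smooth_Rm: "smooth_on S (Rm i j)"
  by (rule smooth_on_cong[OF _ open_S Rm_eq[symmetric]])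
    (intro smooth_on_add smooth_on_diff smooth_on_partial_deriv smooth_on_matrix_mult open_S smooth_\<Gamma>)

lemma Rm_antisym: "x \<in> S \<Longrightarrow> Rm i j x = - Rm j i x"
  by (simp add: Rm_eq)

lemma riemann_eq: "riemann G x i j k l = (G x ** Rm i j x) $ k $ l"
  by (simp add: riemann_def matrix_matrix_mult_def curvature_matrix_def)

text \<open>Second partial derivatives of the metric commute. Expanding both orders by metric
  compatibility, what remains of the difference is G Rm plus its transpose.\<close>

lemma G_Rm_antisym:
  assumes x: "x \<in> S"
  shows "transpose (G x ** Rm i j x) = - (G x ** Rm i j x)"
proof -
  have "\<partial> j (\<partial> i G) x =
      G x ** \<partial> j (\<Gamma> i) x + (G x ** \<Gamma> j x + transpose (\<Gamma> j x) ** G x) ** \<Gamma> i x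
      + (transpose (\<Gamma> i x) ** (G x ** \<Gamma> j x + transpose (\<Gamma> j x) ** G x) + transpose (\<partial> j (\<Gamma> i) x) ** G x)" for i j
  proof -
    have "\<partial> j (\<partial> i G) x = \<partial> j (\<lambda>y. G y ** \<Gamma> i y + transpose (\<Gamma> i y) ** G y) x"
      by (rule partial_deriv_cong[OF open_S x metric_compatible])
    also have "\<dots> = \<partial> j (\<lambda>y. G y ** \<Gamma> i y) x + \<partial> j (\<lambda>y. transpose (\<Gamma> i y) ** G y) x"
      by (intro partial_deriv_add differentiable_matrix_mult differentiable_transpose differentiable_\<Gamma> differentiable_G x)
    also have "\<dots> = G x ** \<partial> j (\<Gamma> i) x + \<partial> j G x ** \<Gamma> i x
       + (transpose (\<Gamma> i x) ** \<partial> j G x + transpose (\<partial> j (\<Gamma> i) x) ** G x)"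
      by (simp add: partial_deriv_matrix_mult differentiable_transpose differentiable_\<Gamma> differentiable_G x partial_deriv_transpose)
    finally show ?thesis by (simp only: metric_compatible[OF x])
  qed
  note pd = this
  show ?thesis
    using partial_deriv_commute[OF open_S smooth_G x, of j i]
    unfolding pd Rm_eq[OF x] mat_bilin transpose_lin matrix_transpose_mul sym_G[OF x] matrix_mul_assoc
    by (simp add: algebra_simps)
qed

lemma G_Rm_antisym_nth:
  assumes x: "x \<in> S"
  shows "(G x ** Rm i j x) $ k $ m = - (G x ** Rm i j x) $ m $ k"
proof -
  have "transpose (G x ** Rm i j x) $ m $ k = - (G x ** Rm i j x) $ m $ k"
    by (simp only: G_Rm_antisym[OF x] vector_uminus_component)
  then show ?thesis unfolding transpose_def vec_lambda_beta .
qed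

text \<open>Since \<Gamma> is torsion-free, the six derivative terms and the six quadratic terms of
  the cyclic sum cancel in pairs.\<close>

lemma first_bianchi:
  assumes x: "x \<in> S"
  shows "Rm i j x $ m $ l + Rm j l x $ m $ i + Rm l i x $ m $ j = 0"
proof -
  have d: "\<partial> i (\<Gamma> j) x $ m $ l = \<partial> i (\<Gamma> l) x $ m $ j" for i j l
  proof -
    have "\<partial> i (\<lambda>y. \<Gamma> j y $ m $ l) x = \<partial> i (\<lambda>y. \<Gamma> l y $ m $ j) x"
      by (rule partial_deriv_cong[OF open_S x \<Gamma>_sym])
    then show ?thesis by (simp add: partial_deriv_nth_nth[OF differentiable_\<Gamma>[OF x]])
  qed
  have s: "(\<Gamma> i x ** \<Gamma> j x) $ m $ l = (\<Gamma> i x ** \<Gamma> l x) $ m $ j" for i j l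
    by (simp add: matrix_matrix_mult_def \<Gamma>_sym[OF x, of j _ l])
  show ?thesis
    by (simp add: Rm_eq[OF x] d[of i j l] d[of j i l] d[of l i j] s[of i j l] s[of j i l] s[of l i j])
qed

section \<open>The Ricci tensor, its symmetry, and smoothness of the curvature quantities\<close>

lemma ricci_eq:
  assumes x: "x \<in> S"
  shows "ricci G x $ j $ l = (\<Sigma> i. Rm i j x $ i $ l)"
proof -
  have "(\<Sigma> k. H x $ i $ k * riemann G x i j k l) = Rm i j x $ i $ l" for i
  proof -
    have "(\<Sigma> k. H x $ i $ k * riemann G x i j k l) = (H x ** (G x ** Rm i j x)) $ i $ l"
      by (simp add: riemann_eq matrix_matrix_mult_def)
    then show ?thesis using x by (simp add: matrix_mul_assoc)
  qed
  then show ?thesis by (simp add: ricci_def)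
qed

text \<open>The trace pairs the symmetric inverse metric with the antisymmetric G Rm. In the traced
  first Bianchi identity this is the term that obstructs the symmetry of Ricci.\<close>

lemma trace_Rm:
  assumes x: "x \<in> S"
  shows "(\<Sigma> m. Rm i j x $ m $ m) = 0"
proof -
  let ?B = "G x ** Rm i j x"
  have B: "?B $ k $ m = - ?B $ m $ k" for k m
    by (rule G_Rm_antisym_nth[OF x])
  let ?s = "\<Sigma> m k. H x $ m $ k * ?B $ k $ m"
  have "?s = (\<Sigma> m k. H x $ k $ m * ?B $ m $ k)"
    by (rule sum.swap)
  also have "\<dots> = (\<Sigma> m k. - (H x $ m $ k * ?B $ k $ m))"
    by (intro sum.cong refl) (metis B minus_mult_right sym_G_inv_nth[OF x])
  also have "\<dots> = - ?s" by (simp only: sum_negf)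
  finally have "?s = 0" by simp
  moreover have "?s = (\<Sigma> m. (H x ** ?B) $ m $ m)"
    by (simp add: matrix_matrix_mult_def)
  ultimately show ?thesis using x by (simp add: matrix_mul_assoc)
qed

lemma ricci_sym:
  assumes x: "x \<in> S"
  shows "ricci G x $ j $ l = ricci G x $ l $ j"
proof -
  have "(\<Sigma> m. Rm m j x $ m $ l) - (\<Sigma> m. Rm m l x $ m $ j) = (\<Sigma> m. Rm l j x $ m $ m)"
    unfolding sum_subtractf[symmetric]
  proof (intro sum.cong refl)
    fix m
    show "Rm m j x $ m $ l - Rm m l x $ m $ j = Rm l j x $ m $ m"
      using first_bianchi[OF x, of m j m l] Rm_antisym[OF x, of l j] Rm_antisym[OF x, of m l] by simp
  qed
  then show ?thesis using trace_Rm[OF x] ricci_eq[OF x] by simp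
qed

lemma ricci_transpose: "x \<in> S \<Longrightarrow> transpose (ricci G x) = ricci G x"
  using ricci_sym by (simp add: transpose_def vec_eq_iff)

lemma smooth_ricci: "smooth_on S (ricci G)"
proof (rule smooth_on_cong[OF _ open_S])
  show "smooth_on S (\<lambda>x. \<chi> j l. \<Sigma> i. Rm i j x $ i $ l)"
    by (intro smooth_on_vec_lambda open_S smooth_on_sum smooth_on_nth[OF open_S smooth_on_nth] smooth_Rm)
qed (simp add: vec_eq_iff ricci_eq)

lemma smooth_trace2: "smooth_on S T \<Longrightarrow> smooth_on S (\<lambda>x. trace2 (G x) (T x))"
  unfolding trace2_def
  by (intro smooth_on_sum open_S smooth_on_mult smooth_on_nth[OF open_S smooth_on_nth] smooth_G_inv)

lemma smooth_scalar_curv: "smooth_on S (scalar_curv G)"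
  unfolding scalar_curv_def[abs_def] by (intro smooth_trace2 smooth_ricci)

lemma smooth_schouten: "smooth_on S (schouten G)"
  unfolding schouten_def[abs_def] divide_inverse
  by (intro smooth_on_diff smooth_on_scaleR smooth_on_mult smooth_on_const open_S smooth_ricci smooth_scalar_curv smooth_G)

lemma schouten_transpose: "x \<in> S \<Longrightarrow> transpose (schouten G x) = schouten G x"
  by (simp add: schouten_def transpose_lin ricci_transpose sym_G)

end

section \<open>Bianchi identities and the Cotton tensor\<close>

lemma trace_linear: "bounded_linear (trace :: real^'n^'n \<Rightarrow> real)"
  unfolding linear_conv_bounded_linear[symmetric]
  by (auto simp: linear_iff trace_def sum.distrib sum_distrib_left)

lemma antisym_matrix_nth:
  fixes B :: "real^'n^'n"
  assumes "transpose B = - B"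
  shows "B $ i $ j = - B $ j $ i"
proof -
  have "transpose B $ j $ i = - B $ j $ i" by (simp only: assms vector_uminus_component)
  then show ?thesis unfolding transpose_def vec_lambda_beta .
qed

lemma transpose_congruence_antisym:
  fixes B H :: "real^'n^'n"
  assumes "transpose H = H" "transpose B = - B"
  shows "transpose (H ** B ** H) = - (H ** B ** H)"
  unfolding matrix_transpose_mul assms mat_bilin matrix_mul_assoc ..

context metric_field
begin

definition nabla2 :: "'n \<Rightarrow> (real^'n \<Rightarrow> real^'n^'n) \<Rightarrow> real^'n \<Rightarrow> real^'n^'n" where
  "nabla2 m T x = \<partial> m T x - transpose (\<Gamma> m x) ** T x - T x ** \<Gamma> m x"

text \<open>Covariant derivative of the curvature seen as a 2-form with values in endomorphisms:
  \<Gamma> acts by a commutator on the matrix, and the two sums correct the form indices i and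
  j.\<close>

definition DRm :: "'n \<Rightarrow> 'n \<Rightarrow> 'n \<Rightarrow> real^'n \<Rightarrow> real^'n^'n" where
  "DRm m i j x = \<partial> m (Rm i j) x + \<Gamma> m x ** Rm i j x - Rm i j x ** \<Gamma> m x
     - (\<Sigma> p. \<Gamma> m x $ p $ i *\<^sub>R Rm p j x) - (\<Sigma> p. \<Gamma> m x $ p $ j *\<^sub>R Rm i p x)"

lemma differentiable_Rm: "x \<in> S \<Longrightarrow> Rm i j differentiable (at x)"
  by (rule smooth_on_differentiable[OF smooth_Rm open_S])

lemma DRm_antisym:
  assumes x: "x \<in> S"
  shows "DRm m i j x = - DRm m j i x"
proof -
  have "\<partial> m (Rm i j) x = \<partial> m (\<lambda>y. - Rm j i y) x"
    by (rule partial_deriv_cong[OF open_S x Rm_antisym])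
  also have "\<dots> = - \<partial> m (Rm j i) x"
    by (rule partial_deriv_minus[OF differentiable_Rm[OF x]])
  finally have 1: "\<partial> m (Rm i j) x = - \<partial> m (Rm j i) x" .
  have 2: "Rm p j x = - Rm j p x" "Rm i p x = - Rm p i x" for p
    by (rule Rm_antisym[OF x])+
  show ?thesis
    unfolding DRm_def 1 2[of j] 2[of i] 2(1) 2(2)[of _]
    by (simp add: mat_bilin sum_negf)
qed

text \<open>The part without the correction sums is the Bianchi identity of a connection form and
  needs only that partial derivatives of \<Gamma> commute (fact 1). The correction sums cancel
  pairwise in the cyclic sum by torsion-freeness and antisymmetry of the curvature (fact 2).\<close>

lemma second_bianchi:
  assumes x: "x \<in> S"
  shows "DRm m i j x + DRm i j m x + DRm j m i x = 0"
proof -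
  have pd: "\<partial> m (Rm i j) x = \<partial> m (\<partial> i (\<Gamma> j)) x - \<partial> m (\<partial> j (\<Gamma> i)) x
    + (\<Gamma> i x ** \<partial> m (\<Gamma> j) x + \<partial> m (\<Gamma> i) x ** \<Gamma> j x)
    - (\<Gamma> j x ** \<partial> m (\<Gamma> i) x + \<partial> m (\<Gamma> j) x ** \<Gamma> i x)" for m i j
  proof -
    have d: "\<partial> i (\<Gamma> j) differentiable (at x)" for i j
      by (rule smooth_on_differentiable[OF smooth_on_partial_deriv[OF smooth_\<Gamma>] open_S x])
    note dd = d differentiable_matrix_mult differentiable_\<Gamma>[OF x]
    have "\<partial> m (Rm i j) x = \<partial> m (\<lambda>y. \<partial> i (\<Gamma> j) y - \<partial> j (\<Gamma> i) y
        + \<Gamma> i y ** \<Gamma> j y - \<Gamma> j y ** \<Gamma> i y) x"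
      by (rule partial_deriv_cong[OF open_S x Rm_eq])
    then show ?thesis
      by (simp add: partial_deriv_diff partial_deriv_add partial_deriv_matrix_mult dd
          differentiable_diff differentiable_add)
  qed
  have comm: "\<partial> m (\<partial> i (\<Gamma> j)) x = \<partial> i (\<partial> m (\<Gamma> j)) x" for m i j
    by (rule partial_deriv_commute[OF open_S smooth_\<Gamma> x])
  have 1: "\<partial> m (Rm i j) x + \<Gamma> m x ** Rm i j x - Rm i j x ** \<Gamma> m x
     + (\<partial> i (Rm j m) x + \<Gamma> i x ** Rm j m x - Rm j m x ** \<Gamma> i x)
     + (\<partial> j (Rm m i) x + \<Gamma> j x ** Rm m i x - Rm m i x ** \<Gamma> j x) = 0"
    unfolding pd Rm_eq[OF x] mat_bilin matrix_mul_assoc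
    by (simp add: comm[of m i j] comm[of m j i] comm[of i j m] algebra_simps)
  have 2: "(\<Sigma> p. \<Gamma> m x $ p $ j *\<^sub>R Rm i p x) = - (\<Sigma> p. \<Gamma> j x $ p $ m *\<^sub>R Rm p i x)" for i m j
    unfolding sum_negf[symmetric]
    by (intro sum.cong refl) (simp add: \<Gamma>_sym[OF x, of m _ j] Rm_antisym[OF x, of i])
  show ?thesis
    using 1 unfolding DRm_def 2
    by (simp add: algebra_simps)
qed

text \<open>Contraction commutes with covariant differentiation: under the trace, the left product
  with \<Gamma> cancels the correction of the contracted form index, and the two surviving
  corrections are those of a 2-tensor.\<close>

lemma DRm_trace:
  assumes x: "x \<in> S"
  shows "(\<Sigma> m. DRm i m j x $ m $ k) = nabla2 i (ricci G) x $ j $ k"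
proof -
  have "\<partial> i (ricci G) x $ j $ k = \<partial> i (\<lambda>y. ricci G y $ j $ k) x"
    by (rule partial_deriv_nth_nth[OF smooth_on_differentiable[OF smooth_ricci open_S x], symmetric])
  also have "\<dots> = \<partial> i (\<lambda>y. \<Sigma> m. Rm m j y $ m $ k) x"
    by (rule partial_deriv_cong[OF open_S x ricci_eq])
  also have "\<dots> = (\<Sigma> m. \<partial> i (Rm m j) x $ m $ k)"
    by (subst partial_deriv_sum)
      (simp_all add: partial_deriv_nth_nth differentiable_Rm[OF x] differentiable_nth)
  finally have 1: "\<partial> i (ricci G) x $ j $ k = (\<Sigma> m. \<partial> i (Rm m j) x $ m $ k)" .
  have 2: "(\<Sigma> m. (\<Gamma> i x ** Rm m j x) $ m $ k) = (\<Sigma> m p. \<Gamma> i x $ p $ m * Rm p j x $ m $ k)"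
    unfolding matrix_matrix_mult_def by (simp, subst sum.swap) simp
  have 3: "(\<Sigma> m. (Rm m j x ** \<Gamma> i x) $ m $ k) = (ricci G x ** \<Gamma> i x) $ j $ k"
    unfolding matrix_matrix_mult_def
    by (simp add: ricci_eq[OF x] sum_distrib_right, subst sum.swap) simp
  have 4: "(\<Sigma> m p. \<Gamma> i x $ p $ j * Rm m p x $ m $ k) = (transpose (\<Gamma> i x) ** ricci G x) $ j $ k"
    unfolding matrix_matrix_mult_def transpose_def
    by (simp add: ricci_eq[OF x] sum_distrib_left, subst sum.swap) simp
  show ?thesis
    unfolding DRm_def nabla2_def
    by (simp add: sum.distrib sum_subtractf 1 2 3 4)
qed

lemma contracted_bianchi:
  assumes x: "x \<in> S"
  shows "(\<Sigma> m. DRm m i j x $ m $ k) = nabla2 i (ricci G) x $ j $ k - nabla2 j (ricci G) x $ i $ k"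
proof -
  have "DRm m i j x $ m $ k = DRm i m j x $ m $ k - DRm j m i x $ m $ k" for m
  proof -
    have "(DRm m i j x + DRm i j m x + DRm j m i x) $ m $ k = 0"
      by (simp add: second_bianchi[OF x])
    then show ?thesis by (simp add: DRm_antisym[OF x, of i j m])
  qed
  then show ?thesis
    by (simp add: sum_subtractf DRm_trace[OF x])
qed

text \<open>The bridge from the index-wise covariant derivative to the matrix calculus. Lowering an
  index commutes with it because the metric is parallel.\<close>

lemma cov_deriv4_riemann:
  assumes x: "x \<in> S"
  shows "cov_deriv4 G (riemann G) x m i j k l = (G x ** DRm m i j x) $ k $ l"
proof -
  have "\<partial> m (\<lambda>y. riemann G y i j k l) x = \<partial> m (\<lambda>y. G y ** Rm i j y) x $ k $ l"
    unfolding riemann_eq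
    by (rule partial_deriv_nth_nth[OF differentiable_matrix_mult[OF differentiable_G[OF x] differentiable_Rm[OF x]]])
  also have "\<partial> m (\<lambda>y. G y ** Rm i j y) x =
      G x ** \<partial> m (Rm i j) x + (G x ** \<Gamma> m x + transpose (\<Gamma> m x) ** G x) ** Rm i j x"
    by (simp add: partial_deriv_matrix_mult[OF differentiable_G[OF x] differentiable_Rm[OF x]] metric_compatible[OF x])
  finally have 1: "\<partial> m (\<lambda>y. riemann G y i j k l) x = (G x ** \<partial> m (Rm i j) x
     + (G x ** \<Gamma> m x + transpose (\<Gamma> m x) ** G x) ** Rm i j x) $ k $ l" .
  have 2: "(\<Sigma> p. christoffel G x p m k * riemann G x i j p l) = (transpose (\<Gamma> m x) ** (G x ** Rm i j x)) $ k $ l"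
    unfolding riemann_eq by (subst matrix_matrix_mult_def) (simp add: transpose_def connection_matrix_def)
  have 3: "(\<Sigma> p. christoffel G x p m l * riemann G x i j k p) = ((G x ** Rm i j x) ** \<Gamma> m x) $ k $ l"
    unfolding riemann_eq by (subst (2) matrix_matrix_mult_def) (simp add: connection_matrix_def mult.commute)
  have 4: "(\<Sigma> p. christoffel G x p m i * riemann G x p j k l) = (G x ** (\<Sigma> p. \<Gamma> m x $ p $ i *\<^sub>R Rm p j x)) $ k $ l"
    unfolding riemann_eq mat_bilin by (simp add: connection_matrix_def)
  have 5: "(\<Sigma> p. christoffel G x p m j * riemann G x i p k l) = (G x ** (\<Sigma> p. \<Gamma> m x $ p $ j *\<^sub>R Rm i p x)) $ k $ l"
    unfolding riemann_eq mat_bilin by (simp add: connection_matrix_def)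
  show ?thesis
    unfolding cov_deriv4_def sum.distrib 1 2 3 4 5 DRm_def
    by (simp add: mat_bilin(1-6) matrix_mul_assoc)
qed

lemma differentiable_riemann:
  assumes x: "x \<in> S"
  shows "(\<lambda>y. riemann G y i j k l) differentiable (at x)"
  unfolding riemann_eq
  by (intro differentiable_nth differentiable_matrix_mult differentiable_G differentiable_Rm x)

lemma G_DRm_antisym:
  assumes x: "x \<in> S"
  shows "(G x ** DRm m i j x) $ k $ l = - (G x ** DRm m i j x) $ l $ k"
proof -
  have a: "riemann G y i j k l = - riemann G y i j l k" if "y \<in> S" for y i j k l
    unfolding riemann_eq by (rule G_Rm_antisym_nth[OF that])
  have "\<partial> m (\<lambda>y. riemann G y i j k l) x = \<partial> m (\<lambda>y. - riemann G y i j l k) x"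
    by (rule partial_deriv_cong[OF open_S x a])
  also have "\<dots> = - \<partial> m (\<lambda>y. riemann G y i j l k) x"
    by (rule partial_deriv_minus[OF differentiable_riemann[OF x]])
  finally have p: "\<partial> m (\<lambda>y. riemann G y i j k l) x = - \<partial> m (\<lambda>y. riemann G y i j l k) x" .
  show ?thesis
    unfolding cov_deriv4_riemann[OF x, symmetric] cov_deriv4_def p
      a[OF x, of _ _ k] a[OF x, of i j _ l] sum.distrib
    by (simp add: sum_negf)
qed

text \<open>The divergence is taken in the last slot. Antisymmetry moves it to the third slot, at
  the cost of the minus sign, where it becomes the trace evaluated by the contracted Bianchi
  identity.\<close>

lemma div_riemann:
  assumes x: "x \<in> S"
  shows "(\<Sigma> l m. ginv (G x) l m * cov_deriv4 G (riemann G) x m i j k l)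
    = - (nabla2 i (ricci G) x $ j $ k - nabla2 j (ricci G) x $ i $ k)"
proof -
  have "(\<Sigma> l. ginv (G x) l m * cov_deriv4 G (riemann G) x m i j k l) = - DRm m i j x $ m $ k" for m
  proof -
    have "(\<Sigma> l. ginv (G x) l m * cov_deriv4 G (riemann G) x m i j k l)
      = (\<Sigma> l. - (ginv (G x) m l * (G x ** DRm m i j x) $ l $ k))"
      by (simp add: cov_deriv4_riemann[OF x] G_DRm_antisym[OF x, of m i j k] sym_G_inv_nth[OF x, of _ m])
    also have "\<dots> = - (H x ** (G x ** DRm m i j x)) $ m $ k"
      by (subst (2) matrix_matrix_mult_def) (simp add: sum_negf)
    finally show ?thesis using x by (simp add: matrix_mul_assoc)
  qed
  then show ?thesis
    by (subst sum.swap) (simp add: sum_negf contracted_bianchi[OF x])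
qed

lemma trace2_eq: "x \<in> S \<Longrightarrow> trace2 (G x) T = trace (H x ** T)"
  unfolding trace2_def trace_def matrix_matrix_mult_def
  by (subst sum.swap) (simp add: sym_G_inv_nth)

lemma partial_deriv_G_inv:
  assumes x: "x \<in> S"
  shows "\<partial> i H x = - (\<Gamma> i x ** H x) - H x ** transpose (\<Gamma> i x)"
proof -
  have d: "H differentiable (at x)" by (rule smooth_on_differentiable[OF smooth_G_inv open_S x])
  have "\<partial> i (\<lambda>y. H y ** G y) x = \<partial> i (\<lambda>y. mat 1 :: real^'n^'n) x"
    by (rule partial_deriv_cong[OF open_S x]) simp
  then have "H x ** \<partial> i G x + \<partial> i H x ** G x = 0"
    by (simp add: partial_deriv_matrix_mult[OF d differentiable_G[OF x]])
  then have "\<partial> i H x ** G x ** H x = - (H x ** \<partial> i G x ** H x)"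
    by (metis (no_types) add_eq_0_iff mat_bilin(5))
  moreover have "\<partial> i H x ** G x ** H x = \<partial> i H x"
    by (simp only: matrix_mul_assoc[symmetric] G_inv[OF x] matrix_mul_rid)
  moreover have "H x ** \<partial> i G x ** H x = H x ** G x ** \<Gamma> i x ** H x + H x ** transpose (\<Gamma> i x) ** (G x ** H x)"
    by (simp add: metric_compatible[OF x] mat_bilin matrix_mul_assoc)
  ultimately show ?thesis by (simp add: G_inv[OF x])
qed

lemma trace_nabla2:
  assumes x: "x \<in> S" and T: "T differentiable (at x)"
  shows "trace2 (G x) (nabla2 i T x) = \<partial> i (\<lambda>y. trace2 (G y) (T y)) x"
proof -
  have d: "H differentiable (at x)" by (rule smooth_on_differentiable[OF smooth_G_inv open_S x])
  have "\<partial> i (\<lambda>y. trace2 (G y) (T y)) x = \<partial> i (\<lambda>y. trace (H y ** T y)) x"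
    by (rule partial_deriv_cong[OF open_S x trace2_eq])
  also have "\<dots> = trace (\<partial> i (\<lambda>y. H y ** T y) x)"
    by (rule partial_deriv_linear[OF trace_linear differentiable_matrix_mult[OF d T]])
  also have "\<partial> i (\<lambda>y. H y ** T y) x = H x ** \<partial> i T x - \<Gamma> i x ** (H x ** T x) - H x ** transpose (\<Gamma> i x) ** T x"
    by (simp add: partial_deriv_matrix_mult[OF d T] partial_deriv_G_inv[OF x] mat_bilin matrix_mul_assoc)
  also have "trace \<dots> = trace (H x ** nabla2 i T x)"
    unfolding nabla2_def mat_bilin trace_sub trace_mul_sym[of "\<Gamma> i x"] by (simp add: matrix_mul_assoc)
  finally show ?thesis by (simp add: trace2_eq[OF x])
qed

text \<open>Trace the contracted Bianchi identity once more. By antisymmetry in both index pairs the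
  left side is again the divergence of Ricci, and the right side is dR minus that divergence; this
  is the origin of the factor 2.\<close>

lemma div_ricci:
  assumes x: "x \<in> S"
  shows "2 * (\<Sigma> l m. ginv (G x) l m * nabla2 m (ricci G) x $ i $ l) = \<partial> i (scalar_curv G) x"
proof -
  let ?d = "\<Sigma> l m. ginv (G x) l m * nabla2 m (ricci G) x $ i $ l"
  have up: "DRm m i j x ** H x = H x ** (G x ** DRm m i j x) ** H x" for m j
    by (simp add: matrix_mul_assoc G_inv[OF x])
  have "transpose (G x ** DRm m i j x) = - (G x ** DRm m i j x)" for m j
    unfolding vec_eq_iff transpose_def vec_lambda_beta vector_uminus_component
    by (intro allI G_DRm_antisym[OF x])
  then have "transpose (DRm m i j x ** H x) = - (DRm m i j x ** H x)" for m j
    unfolding up by (intro transpose_congruence_antisym sym_G_inv[OF x])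
  note anti = antisym_matrix_nth[OF this]
  have "(\<Sigma> j k. H x $ j $ k * (\<Sigma> m. DRm m i j x $ m $ k)) = (\<Sigma> j m. (DRm m i j x ** H x) $ m $ j)"
    unfolding matrix_matrix_mult_def sum_distrib_left
    by (rule sum.cong[OF refl], subst sum.swap) (simp add: sym_G_inv_nth[OF x] mult.commute)
  also have "\<dots> = (\<Sigma> j m. - (DRm m i j x ** H x) $ j $ m)"
    by (rule sum.cong[OF refl], rule sum.cong[OF refl], rule anti)
  also have "\<dots> = (\<Sigma> m k. H x $ k $ m * (\<Sigma> j. DRm m j i x $ j $ k))"
  proof (subst sum.swap, rule sum.cong[OF refl])
    fix m
    have "(\<Sigma> j. - (DRm m i j x ** H x) $ j $ m) = (\<Sigma> j k. DRm m j i x $ j $ k * H x $ k $ m)"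
      unfolding matrix_matrix_mult_def by (simp add: DRm_antisym[OF x, of m i] sum_negf)
    also have "\<dots> = (\<Sigma> k j. H x $ k $ m * DRm m j i x $ j $ k)"
      by (subst sum.swap) (simp add: mult.commute)
    finally show "(\<Sigma> j. - (DRm m i j x ** H x) $ j $ m) = (\<Sigma> k. H x $ k $ m * (\<Sigma> j. DRm m j i x $ j $ k))"
      by (simp add: sum_distrib_left)
  qed
  also have "\<dots> = ?d"
    unfolding DRm_trace[OF x] by (rule sum.swap)
  finally have 1: "(\<Sigma> j k. H x $ j $ k * (\<Sigma> m. DRm m i j x $ m $ k)) = ?d" .
  have "(\<Sigma> j k. H x $ j $ k * (\<Sigma> m. DRm m i j x $ m $ k))
     = trace2 (G x) (nabla2 i (ricci G) x) - (\<Sigma> j k. H x $ j $ k * nabla2 j (ricci G) x $ i $ k)"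
    unfolding contracted_bianchi[OF x] trace2_def by (simp add: algebra_simps sum_subtractf)
  also have "(\<Sigma> j k. H x $ j $ k * nabla2 j (ricci G) x $ i $ k) = ?d"
    by (subst sum.swap) (simp add: sym_G_inv_nth[OF x])
  also have "trace2 (G x) (nabla2 i (ricci G) x) = \<partial> i (scalar_curv G) x"
    unfolding trace_nabla2[OF x smooth_on_differentiable[OF smooth_ricci open_S x]] scalar_curv_def[abs_def] ..
  finally show ?thesis using 1 by simp
qed

text \<open>The antisymmetrized covariant derivative after cancelling the two terms in which
  \<Gamma> acts on the first tensor index, equal by torsion-freeness. With fewer products left, the
  equation is easier to differentiate and to transform.\<close>

definition cotton :: "(real^'n \<Rightarrow> real^'n^'n) \<Rightarrow> real^'n \<Rightarrow> 'n \<Rightarrow> 'n \<Rightarrow> 'n \<Rightarrow> real" where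
  "cotton T x i j k = \<partial> i T x $ j $ k - \<partial> j T x $ i $ k
     - (T x ** \<Gamma> i x) $ j $ k + (T x ** \<Gamma> j x) $ i $ k"

lemma cotton_eq:
  assumes x: "x \<in> S"
  shows "cotton T x i j k = nabla2 i T x $ j $ k - nabla2 j T x $ i $ k"
proof -
  have "(transpose (\<Gamma> i x) ** T x) $ j $ k = (transpose (\<Gamma> j x) ** T x) $ i $ k"
    by (simp add: matrix_matrix_mult_def transpose_def \<Gamma>_sym[OF x, of i _ j])
  then show ?thesis by (simp add: cotton_def nabla2_def)
qed

section \<open>The divergence of the Weyl tensor as a multiple of the Cotton tensor\<close>

lemma cov_deriv4_swap:
  "cov_deriv4 G (\<lambda>y i j k l. T y j i k l) x m i j k l = cov_deriv4 G T x m j i k l"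
  "cov_deriv4 G (\<lambda>y i j k l. T y i j l k) x m i j k l = cov_deriv4 G T x m i j l k"
  by (simp_all add: cov_deriv4_def sum.distrib)

lemma cov_deriv4_diff:
  assumes "\<And>i j k l. (\<lambda>y. T y i j k l) differentiable (at x)" "\<And>i j k l. (\<lambda>y. U y i j k l) differentiable (at x)"
  shows "cov_deriv4 G (\<lambda>y i j k l. T y i j k l - U y i j k l) x m i j k l
    = cov_deriv4 G T x m i j k l - cov_deriv4 G U x m i j k l"
  by (simp add: cov_deriv4_def sum.distrib partial_deriv_diff assms right_diff_distrib sum_subtractf)

lemma cov_deriv4_cmult:
  assumes "\<And>i j k l. (\<lambda>y. T y i j k l) differentiable (at x)"
  shows "cov_deriv4 G (\<lambda>y i j k l. c * T y i j k l) x m i j k l = c * cov_deriv4 G T x m i j k l"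
proof -
  have "\<partial> m (\<lambda>y. c * T y i j k l) x = c * \<partial> m (\<lambda>y. T y i j k l) x"
    by (rule partial_deriv_linear[OF bounded_linear_mult_right assms])
  then show ?thesis
    by (simp add: cov_deriv4_def sum.distrib sum_distrib_left distrib_left right_diff_distrib mult.left_commute)
qed

lemma differentiable_G_tensor:
  assumes "x \<in> S" "T differentiable (at x)"
  shows "(\<lambda>y. G y $ i $ k * T y $ j $ l) differentiable (at x)"
  by (intro differentiable_mult differentiable_nth assms differentiable_G)

lemma cov_deriv4_G_tensor:
  fixes T :: "real^'n \<Rightarrow> real^'n^'n"
  assumes x: "x \<in> S" and T: "T differentiable (at x)"
  shows "cov_deriv4 G (\<lambda>y i j k l. G y $ i $ k * T y $ j $ l) x m i j k l = G x $ i $ k * nabla2 m T x $ j $ l"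
proof -
  have "\<partial> m (\<lambda>y. G y $ i $ k * T y $ j $ l) x
     = G x $ i $ k * \<partial> m T x $ j $ l + \<partial> m G x $ i $ k * T x $ j $ l"
    using partial_deriv_bilinear[OF bounded_bilinear_mult
        differentiable_nth[OF differentiable_nth[OF differentiable_G[OF x]]] differentiable_nth[OF differentiable_nth[OF T]]]
    by (simp add: partial_deriv_nth_nth[OF T] partial_deriv_nth_nth[OF differentiable_G[OF x]])
  then show ?thesis
    unfolding cov_deriv4_def nabla2_def metric_compatible[OF x]
    by (simp add: sum.distrib matrix_matrix_mult_def transpose_def connection_matrix_def
        sum_distrib_left sum_distrib_right algebra_simps)
qed

text \<open>The Kulkarni-Nomizu product with the metric, bracketed as two successive
  antisymmetrizations of one product G_ik T_jl. Covariant derivatives and coordinate changes then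
  need to be computed for that single product only.\<close>

definition kulkarni :: "(real^'n \<Rightarrow> real^'n^'n) \<Rightarrow> real^'n \<Rightarrow> 'n tensor4" where
  "kulkarni T x i j k l = G x $ i $ k * T x $ j $ l - G x $ i $ l * T x $ j $ k
     - (G x $ j $ k * T x $ i $ l - G x $ j $ l * T x $ i $ k)"

lemma differentiable_kulkarni:
  assumes x: "x \<in> S" and T: "T differentiable (at x)"
  shows "(\<lambda>y. kulkarni T y i j k l) differentiable (at x)"
  unfolding kulkarni_def by (intro differentiable_diff differentiable_G_tensor assms)

lemma cov_deriv4_kulkarni:
  assumes x: "x \<in> S" and T: "T differentiable (at x)"
  shows "cov_deriv4 G (kulkarni T) x m i j k l =
    G x $ i $ k * nabla2 m T x $ j $ l - G x $ i $ l * nabla2 m T x $ j $ k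
    - (G x $ j $ k * nabla2 m T x $ i $ l - G x $ j $ l * nabla2 m T x $ i $ k)"
proof -
  let ?T = "\<lambda>y i j k l. G y $ i $ k * T y $ j $ l"
  let ?U = "\<lambda>y i j k l. ?T y i j k l - ?T y i j l k"
  note d = differentiable_G_tensor[OF assms]
  have U: "cov_deriv4 G ?U x m i j k l = cov_deriv4 G ?T x m i j k l - cov_deriv4 G ?T x m i j l k" for i j k l
    using cov_deriv4_diff[of ?T x "\<lambda>y i j k l. ?T y i j l k", OF d d] cov_deriv4_swap(2)[of ?T] by simp
  have "cov_deriv4 G (\<lambda>y i j k l. ?U y i j k l - ?U y j i k l) x m i j k l
      = cov_deriv4 G ?U x m i j k l - cov_deriv4 G ?U x m j i k l"
    using cov_deriv4_diff[of ?U x "\<lambda>y i j k l. ?U y j i k l", OF differentiable_diff[OF d d] differentiable_diff[OF d d]]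
      cov_deriv4_swap(1)[of ?U] by simp
  then show ?thesis
    unfolding U cov_deriv4_G_tensor[OF assms] kulkarni_def[abs_def] by simp
qed

lemma G_inv_contract:
  assumes x: "x \<in> S"
  shows "(\<Sigma> l m. ginv (G x) l m * (G x $ i $ l * f m)) = f i"
proof -
  have "(\<Sigma> l m. ginv (G x) l m * (G x $ i $ l * f m)) = (\<Sigma> m. (\<Sigma> l. G x $ i $ l * ginv (G x) l m) * f m)"
    by (subst sum.swap) (simp add: sum_distrib_left sum_distrib_right mult_ac)
  then show ?thesis by (simp only: G_inv_sum[OF x]) (simp add: mult_delta_left)
qed

lemma div_kulkarni:
  assumes x: "x \<in> S" and T: "T differentiable (at x)"
  shows "(\<Sigma> l m. ginv (G x) l m * cov_deriv4 G (kulkarni T) x m i j k l) =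
    G x $ i $ k * (\<Sigma> l m. ginv (G x) l m * nabla2 m T x $ j $ l)
    - G x $ j $ k * (\<Sigma> l m. ginv (G x) l m * nabla2 m T x $ i $ l)
    - (nabla2 i T x $ j $ k - nabla2 j T x $ i $ k)"
  unfolding cov_deriv4_kulkarni[OF assms] right_diff_distrib sum_subtractf G_inv_contract[OF x]
  by (simp add: sum_distrib_left mult.left_commute)

text \<open>The Schouten normalization is the one that absorbs the scalar curvature term of the Weyl
  tensor into the product with the metric.\<close>

lemma weyl_eq:
  assumes n: "real CARD('n) > 2"
  shows "weyl G x i j k l = riemann G x i j k l - 1 / (real CARD('n) - 2) * kulkarni (schouten G) x i j k l"
proof -
  have "real CARD('n) - 1 \<noteq> 0" "real CARD('n) - 2 \<noteq> 0" using n by auto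
  then show ?thesis
    by (simp add: weyl_def kulkarni_def schouten_def Let_def divide_simps) (simp add: algebra_simps)
qed

lemma differentiable_schouten: "x \<in> S \<Longrightarrow> schouten G differentiable (at x)"
  by (rule smooth_on_differentiable[OF smooth_schouten open_S])

lemma nabla2_schouten:
  assumes x: "x \<in> S"
  shows "nabla2 m (schouten G) x = nabla2 m (ricci G) x
    - (\<partial> m (scalar_curv G) x / (2 * (real CARD('n) - 1))) *\<^sub>R G x"
proof -
  let ?c = "1 / (2 * (real CARD('n) - 1))"
  have dR: "scalar_curv G differentiable (at x)" by (rule smooth_on_differentiable[OF smooth_scalar_curv open_S x])
  have dRic: "ricci G differentiable (at x)" by (rule smooth_on_differentiable[OF smooth_ricci open_S x])
  have dcR: "(\<lambda>y. ?c * scalar_curv G y) differentiable (at x)"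
    by (intro differentiable_mult dR) simp
  have S: "schouten G y = ricci G y - (?c * scalar_curv G y) *\<^sub>R G y" for y
    by (simp add: schouten_def)
  have "\<partial> m (schouten G) x = \<partial> m (ricci G) x
     - ((?c * scalar_curv G x) *\<^sub>R \<partial> m G x + (?c * \<partial> m (scalar_curv G) x) *\<^sub>R G x)"
    unfolding S[abs_def]
    using partial_deriv_diff[OF dRic differentiable_bilinear[OF bounded_bilinear_scaleR dcR differentiable_G[OF x]]]
      partial_deriv_bilinear[OF bounded_bilinear_scaleR dcR differentiable_G[OF x]]
      partial_deriv_linear[OF bounded_linear_mult_right dR, of m ?c] by simp
  then show ?thesis
    unfolding nabla2_def metric_compatible[OF x] S mat_bilin
    by (simp add: algebra_simps)
qed

lemma div_schouten:
  assumes x: "x \<in> S" and n: "real CARD('n) > 2"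
  shows "(\<Sigma> l m. ginv (G x) l m * nabla2 m (schouten G) x $ i $ l)
    = (real CARD('n) - 2) / (2 * (real CARD('n) - 1)) * \<partial> i (scalar_curv G) x"
proof -
  let ?c = "1 / (2 * (real CARD('n) - 1))"
  let ?r = "\<lambda>m. \<partial> m (scalar_curv G) x"
  have "(\<Sigma> l m. ginv (G x) l m * nabla2 m (schouten G) x $ i $ l)
    = (\<Sigma> l m. ginv (G x) l m * nabla2 m (ricci G) x $ i $ l)
     - ?c * (\<Sigma> l m. ginv (G x) l m * (G x $ i $ l * ?r m))"
    unfolding sum_distrib_left sum_subtractf[symmetric]
    by (intro sum.cong refl) (simp add: nabla2_schouten[OF x] algebra_simps)
  also have "\<dots> = ?r i / 2 - ?c * ?r i"
    unfolding G_inv_contract[OF x] using div_ricci[OF x, of i] by simp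
  also have "\<dots> = (real CARD('n) - 2) / (2 * (real CARD('n) - 1)) * ?r i"
    using n by (simp add: field_simps)
  finally show ?thesis .
qed

text \<open>The gradients of R coming from the divergence of the product (\<open>?X\<close>) and
  from replacing Ricci by Schouten (\<open>?Y\<close>) cancel. The Cotton tensor is left with
  coefficient -1 + 1/(n-2).\<close>

lemma div_weyl_eq:
  assumes x: "x \<in> S" and n: "real CARD('n) > 2"
  shows "div_weyl G x i j k = - (real CARD('n) - 3) / (real CARD('n) - 2) * cotton (schouten G) x i j k"
proof -
  let ?n = "real CARD('n)"
  let ?r = "\<lambda>m. \<partial> m (scalar_curv G) x"
  let ?C = "cotton (schouten G) x i j k"
    and ?X = "G x $ i $ k * ((?n - 2) / (2 * (?n - 1)) * ?r j) - G x $ j $ k * ((?n - 2) / (2 * (?n - 1)) * ?r i)"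
    and ?Y = "?r i / (2 * (?n - 1)) * G x $ j $ k - ?r j / (2 * (?n - 1)) * G x $ i $ k"
  have w: "weyl G = (\<lambda>y i j k l. riemann G y i j k l - 1 / (?n - 2) * kulkarni (schouten G) y i j k l)"
    using weyl_eq[OF n] by (intro ext)
  have dk: "(\<lambda>y. 1 / (?n - 2) * kulkarni (schouten G) y i j k l) differentiable (at x)" for i j k l
    by (intro differentiable_mult differentiable_kulkarni x differentiable_schouten) simp
  have "div_weyl G x i j k =
     (\<Sigma> l m. ginv (G x) l m * cov_deriv4 G (riemann G) x m i j k l)
     - 1 / (?n - 2) * (\<Sigma> l m. ginv (G x) l m * cov_deriv4 G (kulkarni (schouten G)) x m i j k l)"
    unfolding div_weyl_def w cov_deriv4_diff[OF differentiable_riemann[OF x] dk]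
      cov_deriv4_cmult[OF differentiable_kulkarni[OF x differentiable_schouten[OF x]]]
      right_diff_distrib sum_subtractf sum_distrib_left
    by (simp add: mult.left_commute)
  also have "\<dots> = - (nabla2 i (ricci G) x $ j $ k - nabla2 j (ricci G) x $ i $ k)
     - 1 / (?n - 2) * (?X - ?C)"
    unfolding div_riemann[OF x] div_kulkarni[OF x differentiable_schouten[OF x]] div_schouten[OF assms] cotton_eq[OF x] ..
  also have "nabla2 i (ricci G) x $ j $ k - nabla2 j (ricci G) x $ i $ k = ?C + ?Y"
    unfolding cotton_eq[OF x] nabla2_schouten[OF x] by simp
  finally have *: "div_weyl G x i j k = - (?C + ?Y) - 1 / (?n - 2) * (?X - ?C)" .
  have cancel: "1 / (?n - 2) * (a * ((?n - 2) / b * r)) = a * r / b" for a b r :: real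
    using n by simp
  have "div_weyl G x i j k = - ?C + 1 / (?n - 2) * ?C"
    unfolding * right_diff_distrib cancel by simp
  then show ?thesis
    using n by (simp add: field_simps)
qed

end

section \<open>Pullback along a change of coordinates\<close>

lemma matrix_mult_nth: "(A ** B) $ i $ j = (\<Sigma> k. A $ i $ k * B $ k $ j)"
  by (simp add: matrix_matrix_mult_def)

lemma transpose_mult_nth:
  fixes A :: "'a::semiring_1^'n^'m"
  shows "(transpose A ** B) $ i $ j = (\<Sigma> k. A $ k $ i * B $ k $ j)"
  by (simp add: matrix_matrix_mult_def transpose_def)

text \<open>A local isometry between two coordinate domains. Nondegeneracy of the pulled-back metric
  makes the Jacobian invertible. Transition maps and normal coordinates are both treated as
  instances.\<close>

locale metric_pullback = src: metric_field S G + tgt: metric_field T h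
  for S :: "(real^'n) set" and G and T :: "(real^'n) set" and h +
  fixes F :: "real^'n \<Rightarrow> real^'n"
  assumes smooth_F: "smooth_on S F" and F_image: "F ` S \<subseteq> T"
    and G_eq: "x \<in> S \<Longrightarrow> G x = transpose (jacobian F (at x)) ** h (F x) ** jacobian F (at x)"
begin

definition J where "J x = jacobian F (at x)"

lemma J_nth: "J x $ a $ i = \<partial> i F x $ a"
  by (simp add: J_def jacobian_def matrix_def partial_deriv_def)

lemma F_in: "x \<in> S \<Longrightarrow> F x \<in> T"
  using F_image by auto

lemma smooth_J: "smooth_on S J"
proof -
  have "J = (\<lambda>x. \<chi> a i. \<partial> i F x $ a)"
    by (simp add: fun_eq_iff vec_eq_iff J_nth)
  moreover have "smooth_on S (\<lambda>x. \<chi> a i. \<partial> i F x $ a)"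
    by (intro smooth_on_vec_lambda smooth_on_nth smooth_on_partial_deriv src.open_S smooth_F)
  ultimately show ?thesis by simp
qed

abbreviation Ji where "Ji x \<equiv> matrix_inv (J x)"

lemma G_J: "x \<in> S \<Longrightarrow> G x = transpose (J x) ** h (F x) ** J x"
  by (simp add: G_eq J_def)

lemma det_J: "x \<in> S \<Longrightarrow> det (J x) \<noteq> 0"
  using src.det_G[of x] by (auto simp: G_J det_mul)

lemma J_inv [simp]: "x \<in> S \<Longrightarrow> J x ** Ji x = mat 1" "x \<in> S \<Longrightarrow> Ji x ** J x = mat 1"
  using matrix_inv det_J by blast+

lemma differentiable_J: "x \<in> S \<Longrightarrow> J differentiable (at x)"
  by (rule smooth_on_differentiable[OF smooth_J src.open_S])

lemma differentiable_F: "x \<in> S \<Longrightarrow> F differentiable (at x)"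
  by (rule smooth_on_differentiable[OF smooth_F src.open_S])

lemma partial_deriv_J_sym:
  assumes x: "x \<in> S"
  shows "\<partial> i J x $ a $ j = \<partial> j J x $ a $ i"
proof -
  have "\<partial> i J x $ a $ j = \<partial> i (\<partial> j F) x $ a" for i j
  proof -
    have "\<partial> i J x $ a $ j = \<partial> i (\<lambda>y. J y $ a $ j) x"
      by (rule partial_deriv_nth_nth[OF differentiable_J[OF x], symmetric])
    also have "\<dots> = \<partial> i (\<partial> j F) x $ a"
      unfolding J_nth
      by (rule partial_deriv_nth[OF smooth_on_differentiable[OF smooth_on_partial_deriv[OF smooth_F] src.open_S x]])
    finally show ?thesis .
  qed
  then show ?thesis
    by (simp add: partial_deriv_commute[OF src.open_S smooth_F x, of i j])
qed

lemma partial_deriv_pullback: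
  assumes x: "x \<in> S" and f: "f differentiable (at (F x))"
  shows "\<partial> i (\<lambda>y. f (F y)) x = (\<Sigma> a. J x $ a $ i *\<^sub>R \<partial> a f (F x))"
  unfolding J_nth by (rule partial_deriv_compose[OF f differentiable_F[OF x]])

lemma differentiable_pullback:
  assumes x: "x \<in> S" and f: "f differentiable (at (F x))"
  shows "(\<lambda>y. f (F y)) differentiable (at x)"
  using has_derivative_compose_partial[OF f differentiable_F[OF x]] by (auto simp: differentiable_def)

text \<open>The connection form of the target pulled back as a 1-form: only the direction is
  converted to source coordinates, while row and column still refer to target coordinates.\<close>

definition pull_\<Gamma> where "pull_\<Gamma> i x = (\<Sigma> a. J x $ a $ i *\<^sub>R tgt.\<Gamma> a (F x))"

lemma differentiable_h: "x \<in> S \<Longrightarrow> (\<lambda>y. h (F y)) differentiable (at x)"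
  by (intro differentiable_pullback tgt.differentiable_G F_in)

lemma partial_deriv_h:
  assumes x: "x \<in> S"
  shows "\<partial> i (\<lambda>y. h (F y)) x = h (F x) ** pull_\<Gamma> i x + transpose (pull_\<Gamma> i x) ** h (F x)"
  unfolding partial_deriv_pullback[OF x tgt.differentiable_G[OF F_in[OF x]]]
    tgt.metric_compatible[OF F_in[OF x]] pull_\<Gamma>_def
  by (simp add: mat_bilin transpose_lin scaleR_add_right sum.distrib)

lemma partial_deriv_congruence:
  assumes x: "x \<in> S" and A: "A differentiable (at x)"
  shows "\<partial> i (\<lambda>y. transpose (J y) ** A y ** J y) x =
    transpose (J x) ** A x ** \<partial> i J x + transpose (J x) ** \<partial> i A x ** J x
    + transpose (\<partial> i J x) ** A x ** J x"
  using x A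
  by (simp add: partial_deriv_matrix_mult partial_deriv_transpose differentiable_matrix_mult
      differentiable_transpose differentiable_J mat_bilin matrix_mul_assoc)

text \<open>The gauge law. Solving it for the source connection gives a candidate \<open>C\<close>;
  it is torsion-free because second derivatives of \<open>F\<close> commute, and it is compatible
  with G by the product rule, so uniqueness of the connection identifies it.\<close>

lemma connection_transform:
  assumes x: "x \<in> S"
  shows "J x ** src.\<Gamma> i x = pull_\<Gamma> i x ** J x + \<partial> i J x"
proof -
  define X where "X i = pull_\<Gamma> i x ** J x + \<partial> i J x" for i
  define C where "C i = Ji x ** X i" for i
  have X: "X i = J x ** C i" for i
    using x by (simp add: C_def matrix_mul_assoc)
  have sym1: "(pull_\<Gamma> i x ** J x) $ a $ k = (pull_\<Gamma> k x ** J x) $ a $ i" for i k a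
  proof -
    have "(pull_\<Gamma> i x ** J x) $ a $ k = (\<Sigma> c b. J x $ b $ i * tgt.\<Gamma> b (F x) $ a $ c * J x $ c $ k)" for i k
      by (simp add: pull_\<Gamma>_def matrix_matrix_mult_def sum_distrib_right)
    moreover have "(\<Sigma> c b. J x $ b $ i * tgt.\<Gamma> b (F x) $ a $ c * J x $ c $ k)
      = (\<Sigma> b c. J x $ c $ k * tgt.\<Gamma> c (F x) $ a $ b * J x $ b $ i)"
      by (subst sum.swap, rule sum.cong[OF refl], rule sum.cong[OF refl])
        (simp add: tgt.\<Gamma>_sym[OF F_in[OF x]] mult_ac)
    ultimately show ?thesis by simp
  qed
  have sym: "C i $ m $ k = C k $ m $ i" for i m k
  proof -
    have "X i $ a $ k = X k $ a $ i" for a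
      by (simp add: X_def sym1[of i a k] partial_deriv_J_sym[OF x, of i a k])
    then show ?thesis by (simp add: C_def matrix_matrix_mult_def)
  qed
  have "\<partial> i G x = G x ** C i + transpose (C i) ** G x" for i
  proof -
    have "\<partial> i G x = \<partial> i (\<lambda>y. transpose (J y) ** h (F y) ** J y) x"
      by (rule partial_deriv_cong[OF src.open_S x G_J])
    also have "\<dots> = transpose (J x) ** h (F x) ** X i + transpose (X i) ** h (F x) ** J x"
      unfolding partial_deriv_congruence[OF x differentiable_h[OF x]] partial_deriv_h[OF x] X_def
      by (simp add: mat_bilin transpose_lin matrix_transpose_mul matrix_mul_assoc)
    also have "\<dots> = G x ** C i + transpose (C i) ** G x"
      unfolding X G_J[OF x] by (simp add: matrix_transpose_mul matrix_mul_assoc)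
    finally show ?thesis .
  qed
  from src.connection_unique[OF x sym this] X show ?thesis
    by (simp add: X_def)
qed

lemma differentiable_tgt_\<Gamma>: "x \<in> S \<Longrightarrow> (\<lambda>y. tgt.\<Gamma> a (F y)) differentiable (at x)"
  by (intro differentiable_pullback tgt.differentiable_\<Gamma> F_in)

lemma differentiable_pull_\<Gamma>: "x \<in> S \<Longrightarrow> pull_\<Gamma> i differentiable (at x)"
  unfolding pull_\<Gamma>_def[abs_def]
  by (intro differentiable_sum ballI finite differentiable_bilinear[OF bounded_bilinear_scaleR]
      differentiable_nth differentiable_J differentiable_tgt_\<Gamma>)

definition pull_Rm where
  "pull_Rm i j x = (\<Sigma> a b. (J x $ a $ i * J x $ b $ j) *\<^sub>R tgt.Rm a b (F x))"

lemma partial_deriv_pull_\<Gamma>: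
  assumes x: "x \<in> S"
  shows "\<partial> i (pull_\<Gamma> j) x = (\<Sigma> b. \<partial> i J x $ b $ j *\<^sub>R tgt.\<Gamma> b (F x))
     + (\<Sigma> a b. (J x $ a $ i * J x $ b $ j) *\<^sub>R \<partial> a (tgt.\<Gamma> b) (F x))"
proof -
  have "\<partial> i (pull_\<Gamma> j) x = (\<Sigma> b. \<partial> i (\<lambda>y. J y $ b $ j *\<^sub>R tgt.\<Gamma> b (F y)) x)"
    unfolding pull_\<Gamma>_def[abs_def]
    by (intro partial_deriv_sum differentiable_bilinear[OF bounded_bilinear_scaleR] differentiable_nth differentiable_J[OF x] differentiable_tgt_\<Gamma>[OF x])
  also have "\<dots> = (\<Sigma> b. J x $ b $ j *\<^sub>R (\<Sigma> a. J x $ a $ i *\<^sub>R \<partial> a (tgt.\<Gamma> b) (F x))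
      + \<partial> i J x $ b $ j *\<^sub>R tgt.\<Gamma> b (F x))"
  proof (rule sum.cong[OF refl])
    fix b
    show "\<partial> i (\<lambda>y. J y $ b $ j *\<^sub>R tgt.\<Gamma> b (F y)) x = J x $ b $ j *\<^sub>R (\<Sigma> a. J x $ a $ i *\<^sub>R \<partial> a (tgt.\<Gamma> b) (F x))
      + \<partial> i J x $ b $ j *\<^sub>R tgt.\<Gamma> b (F x)"
      using partial_deriv_bilinear[OF bounded_bilinear_scaleR
          differentiable_nth[OF differentiable_nth[OF differentiable_J[OF x]]] differentiable_tgt_\<Gamma>[OF x]]
      by (simp add: partial_deriv_nth_nth[OF differentiable_J[OF x]]
         partial_deriv_pullback[OF x tgt.differentiable_\<Gamma>[OF F_in[OF x]]])
  qed
  also have "\<dots> = (\<Sigma> b. \<partial> i J x $ b $ j *\<^sub>R tgt.\<Gamma> b (F x))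
     + (\<Sigma> b a. (J x $ a $ i * J x $ b $ j) *\<^sub>R \<partial> a (tgt.\<Gamma> b) (F x))"
    by (simp add: sum.distrib scaleR_sum_right mult.commute)
  finally show ?thesis by (subst sum.swap)
qed

text \<open>The structure equation survives pullback: the extra terms with derivatives of
  \<open>J\<close> are symmetric in i and j and drop out.\<close>

lemma pull_Rm_eq:
  assumes x: "x \<in> S"
  shows "pull_Rm i j x = \<partial> i (pull_\<Gamma> j) x - \<partial> j (pull_\<Gamma> i) x
     + pull_\<Gamma> i x ** pull_\<Gamma> j x - pull_\<Gamma> j x ** pull_\<Gamma> i x"
proof -
  let ?c = "\<lambda>a b. J x $ a $ i * J x $ b $ j"
  let ?\<Gamma> = "\<lambda>a. tgt.\<Gamma> a (F x)"
  have 1: "(\<Sigma> b. \<partial> i J x $ b $ j *\<^sub>R ?\<Gamma> b) = (\<Sigma> b. \<partial> j J x $ b $ i *\<^sub>R ?\<Gamma> b)"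
    by (simp add: partial_deriv_J_sym[OF x, of i _ j])
  have 2: "(\<Sigma> a b. (J x $ a $ j * J x $ b $ i) *\<^sub>R f a b) = (\<Sigma> a b. ?c a b *\<^sub>R f b a)"
    for f :: "'n \<Rightarrow> 'n \<Rightarrow> real^'n^'n"
    by (subst sum.swap) (simp add: mult.commute)
  have 3: "pull_\<Gamma> i x ** pull_\<Gamma> j x = (\<Sigma> a b. ?c a b *\<^sub>R (?\<Gamma> a ** ?\<Gamma> b))"
    by (simp add: pull_\<Gamma>_def mat_bilin scaleR_sum_right, subst sum.swap) (simp add: mult.commute)
  have 4: "pull_\<Gamma> j x ** pull_\<Gamma> i x = (\<Sigma> a b. (J x $ a $ j * J x $ b $ i) *\<^sub>R (?\<Gamma> a ** ?\<Gamma> b))"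
    by (simp add: pull_\<Gamma>_def mat_bilin scaleR_sum_right, subst sum.swap) (simp add: mult.commute)
  show ?thesis
    unfolding pull_Rm_def tgt.Rm_eq[OF F_in[OF x]] partial_deriv_pull_\<Gamma>[OF x] 1 3 4 2
    by (simp add: sum.distrib sum_subtractf scaleR_add_right scaleR_diff_right)
qed

text \<open>Differentiate the gauge law and antisymmetrize: second derivatives of \<open>J\<close>
  cancel, and so do all products containing first derivatives of \<open>J\<close> once the gauge law
  is inserted for them.\<close>

lemma curvature_transform:
  assumes x: "x \<in> S"
  shows "J x ** src.Rm i j x = pull_Rm i j x ** J x"
proof -
  let ?B = "\<lambda>i. pull_\<Gamma> i x" and ?J = "J x"
  have dJ: "\<partial> i J x = ?J ** src.\<Gamma> i x - ?B i ** ?J" for i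
    using connection_transform[OF x, of i] by simp
  have e: "?J ** \<partial> i (src.\<Gamma> j) x + \<partial> i J x ** src.\<Gamma> j x
     = ?B j ** \<partial> i J x + \<partial> i (pull_\<Gamma> j) x ** ?J + \<partial> i (\<partial> j J) x" for i j
  proof -
    have d: "\<partial> j J differentiable (at x)"
      by (rule smooth_on_differentiable[OF smooth_on_partial_deriv[OF smooth_J] src.open_S x])
    have "\<partial> i (\<lambda>y. J y ** src.\<Gamma> j y) x = \<partial> i (\<lambda>y. pull_\<Gamma> j y ** J y + \<partial> j J y) x"
      by (rule partial_deriv_cong[OF src.open_S x connection_transform])
    then show ?thesis
      by (simp add: partial_deriv_matrix_mult partial_deriv_add differentiable_matrix_mult d
          differentiable_J[OF x] src.differentiable_\<Gamma>[OF x] differentiable_pull_\<Gamma>[OF x])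
  qed
  have e': "?J ** \<partial> i (src.\<Gamma> j) x = ?B j ** \<partial> i J x + \<partial> i (pull_\<Gamma> j) x ** ?J
      + \<partial> i (\<partial> j J) x - \<partial> i J x ** src.\<Gamma> j x" for i j
    unfolding e[symmetric] by simp
  have "?J ** \<partial> i (src.\<Gamma> j) x - ?J ** \<partial> j (src.\<Gamma> i) x =
     (?B j ** \<partial> i J x + \<partial> i (pull_\<Gamma> j) x ** ?J - \<partial> i J x ** src.\<Gamma> j x)
     - (?B i ** \<partial> j J x + \<partial> j (pull_\<Gamma> i) x ** ?J - \<partial> j J x ** src.\<Gamma> i x)"
    unfolding e'[of i j] e'[of j i] partial_deriv_commute[OF src.open_S smooth_J x, of i j]
    by (simp add: algebra_simps)
  then show ?thesis
    unfolding src.Rm_eq[OF x] pull_Rm_eq[OF x] dJ mat_bilin matrix_mul_assoc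
    by (simp add: algebra_simps)
qed

lemma J_inv_sum: "x \<in> S \<Longrightarrow> (\<Sigma> i. J x $ a $ i * Ji x $ i $ c) = (if a = c then 1 else 0)"
  using J_inv(1)[of x] by (simp add: matrix_matrix_mult_def vec_eq_iff mat_def)

section \<open>Ricci, scalar and Schouten curvature and the Codazzi equation under coordinate
  changes\<close>

lemma ricci_transform:
  assumes x: "x \<in> S"
  shows "ricci G x = transpose (J x) ** ricci h (F x) ** J x"
proof -
  let ?I = "Ji x"
  have Rm: "src.Rm i j x = ?I ** (pull_Rm i j x ** J x)" for i j
    unfolding curvature_transform[OF x, symmetric] using x by (simp add: matrix_mul_assoc)
  have "ricci G x $ j $ l = (transpose (J x) ** ricci h (F x) ** J x) $ j $ l" for j l
  proof -
    let ?f = "\<lambda>a b c. (tgt.Rm a b (F x) ** J x) $ c $ l"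
    have "ricci G x $ j $ l = (\<Sigma> i c. ?I $ i $ c * (\<Sigma> a b. J x $ a $ i * J x $ b $ j * ?f a b c))"
    proof -
      have "(pull_Rm i j x ** J x) $ c $ l = (\<Sigma> a b. J x $ a $ i * J x $ b $ j * ?f a b c)" for i c
        by (simp add: pull_Rm_def mat_bilin)
      then show ?thesis
        unfolding src.ricci_eq[OF x] Rm by (simp add: matrix_mult_nth[of "Ji x"])
    qed
    also have "\<dots> = (\<Sigma> c a. (\<Sigma> i. J x $ a $ i * ?I $ i $ c) * (\<Sigma> b. J x $ b $ j * ?f a b c))"
    proof -
      have "(\<Sigma> i. ?I $ i $ c * (\<Sigma> a b. J x $ a $ i * J x $ b $ j * ?f a b c))
        = (\<Sigma> a. (\<Sigma> i. J x $ a $ i * ?I $ i $ c) * (\<Sigma> b. J x $ b $ j * ?f a b c))" for c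
        unfolding sum_distrib_left sum_distrib_right
        by (subst sum.swap, rule sum.cong[OF refl], subst sum.swap) (simp add: mult_ac)
      then show ?thesis by (subst sum.swap) simp
    qed
    also have "\<dots> = (\<Sigma> c b. J x $ b $ j * ?f c b c)"
      unfolding J_inv_sum[OF x] by (simp add: mult_delta_left)
    also have "\<dots> = (\<Sigma> b. J x $ b $ j * (\<Sigma> c. ?f c b c))"
      by (subst sum.swap) (simp add: sum_distrib_left)
    also have "\<dots> = (\<Sigma> b. J x $ b $ j * (ricci h (F x) ** J x) $ b $ l)"
      unfolding matrix_matrix_mult_def
      by (simp add: tgt.ricci_eq[OF F_in[OF x]] sum_distrib_right, rule sum.cong[OF refl])
        (rule arg_cong[where f="(*) _"], rule sum.swap)
    also have "\<dots> = (transpose (J x) ** (ricci h (F x) ** J x)) $ j $ l"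
      by (simp add: transpose_mult_nth)
    finally show ?thesis by (simp add: matrix_mul_assoc)
  qed
  then show ?thesis by (simp add: vec_eq_iff)
qed

lemma matrix_inv_G: "x \<in> S \<Longrightarrow> matrix_inv (G x) = Ji x ** matrix_inv (h (F x)) ** transpose (Ji x)"
proof (rule matrix_inv_unique)
  assume x: "x \<in> S"
  have "G x ** (Ji x ** matrix_inv (h (F x)) ** transpose (Ji x))
     = transpose (J x) ** (h (F x) ** (J x ** Ji x) ** matrix_inv (h (F x))) ** transpose (Ji x)"
    by (simp add: G_J[OF x] matrix_mul_assoc)
  also have "\<dots> = transpose (Ji x ** J x)"
    using x by (simp add: F_in matrix_transpose_mul[symmetric])
  finally show "G x ** (Ji x ** matrix_inv (h (F x)) ** transpose (Ji x)) = mat 1"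
    using x by (simp add: transpose_mat)
qed

text \<open>With one index raised a covariant 2-tensor becomes an endomorphism and changes by
  conjugation, so traces of its powers are invariant.\<close>

lemma raise_transform:
  assumes x: "x \<in> S" and A: "A = transpose (J x) ** B ** J x"
  shows "matrix_inv (G x) ** A = Ji x ** (matrix_inv (h (F x)) ** B) ** J x"
proof -
  have "transpose (Ji x) ** transpose (J x) = mat 1"
    using x by (simp add: matrix_transpose_mul[symmetric] transpose_mat)
  then have "Ji x ** matrix_inv (h (F x)) ** (transpose (Ji x) ** transpose (J x)) ** (B ** J x)
    = Ji x ** (matrix_inv (h (F x)) ** B) ** J x"
    by (simp add: matrix_mul_assoc)
  then show ?thesis
    unfolding matrix_inv_G[OF x] A by (simp add: matrix_mul_assoc)
qed

lemma trace_conj: "x \<in> S \<Longrightarrow> trace (Ji x ** M ** J x) = trace M"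
  by (subst trace_mul_sym) (simp add: matrix_mul_assoc)

lemma trace2_transform:
  assumes x: "x \<in> S" and A: "A = transpose (J x) ** B ** J x"
  shows "trace2 (G x) A = trace2 (h (F x)) B"
  unfolding src.trace2_eq[OF x] tgt.trace2_eq[OF F_in[OF x]] raise_transform[OF assms] trace_conj[OF x] ..

lemma scalar_transform: "x \<in> S \<Longrightarrow> scalar_curv G x = scalar_curv h (F x)"
  unfolding scalar_curv_def by (intro trace2_transform ricci_transform)

lemma schouten_transform:
  assumes x: "x \<in> S"
  shows "schouten G x = transpose (J x) ** schouten h (F x) ** J x"
  unfolding schouten_def scalar_transform[OF x]
  by (simp add: mat_bilin ricci_transform[OF x] G_J[OF x])

text \<open>The combination dA - A \<Gamma> transforms like a tensor up to a term with the
  derivative of \<open>J\<close>. That term is symmetric in the two antisymmetrized indices, so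
  vanishing of the Cotton tensor is preserved.\<close>

lemma cotton_transform:
  assumes A: "\<And>y. y \<in> S \<Longrightarrow> A y = transpose (J y) ** B (F y) ** J y" and x: "x \<in> S"
    and B: "B differentiable (at (F x))" and cot: "\<And>a b c. tgt.cotton B (F x) a b c = 0"
  shows "src.cotton A x i j k = 0"
proof -
  define P where "P a = \<partial> a B (F x) - B (F x) ** tgt.\<Gamma> a (F x)" for a
  have P: "P a $ b $ c = P b $ a $ c" for a b c
    using cot[of a b c] by (simp add: P_def tgt.cotton_def)
  let ?Q = "\<lambda>i. \<Sigma> a. J x $ a $ i *\<^sub>R P a"
  have dA: "\<partial> i A x - A x ** src.\<Gamma> i x
     = transpose (\<partial> i J x) ** B (F x) ** J x + transpose (J x) ** ?Q i ** J x" for i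
  proof -
    have "\<partial> i A x = \<partial> i (\<lambda>y. transpose (J y) ** B (F y) ** J y) x"
      by (rule partial_deriv_cong[OF src.open_S x A])
    moreover have "A x ** src.\<Gamma> i x = transpose (J x) ** B (F x) ** (J x ** src.\<Gamma> i x)"
      by (simp add: A[OF x] matrix_mul_assoc)
    moreover have "?Q i = \<partial> i (\<lambda>y. B (F y)) x - B (F x) ** pull_\<Gamma> i x"
      unfolding partial_deriv_pullback[OF x B] P_def pull_\<Gamma>_def
      by (simp add: mat_bilin scaleR_diff_right sum_subtractf)
    ultimately show ?thesis
      unfolding partial_deriv_congruence[OF x differentiable_pullback[OF x B]] connection_transform[OF x]
      by (simp add: mat_bilin matrix_mul_assoc)
  qed
  have s1: "(transpose (\<partial> i J x) ** B (F x) ** J x) $ j $ k = (transpose (\<partial> j J x) ** B (F x) ** J x) $ i $ k"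
    unfolding matrix_mul_assoc[symmetric]
    by (simp add: transpose_mult_nth partial_deriv_J_sym[OF x, of i _ j])
  have "(transpose (J x) ** ?Q i ** J x) $ j $ k = (\<Sigma> b a. J x $ b $ j * J x $ a $ i * (P a ** J x) $ b $ k)" for i j
    unfolding matrix_mul_assoc[symmetric] mat_bilin
    by (simp add: transpose_mult_nth sum_distrib_left, subst sum.swap) (simp add: mult_ac)
  note s2 = this
  have "(P a ** J x) $ b $ k = (P b ** J x) $ a $ k" for a b
    unfolding matrix_matrix_mult_def by (simp add: P[of a b])
  then have "(\<Sigma> b a. J x $ b $ j * J x $ a $ i * (P a ** J x) $ b $ k)
     = (\<Sigma> a b. J x $ a $ i * J x $ b $ j * (P b ** J x) $ a $ k)"
    by (subst sum.swap) (simp add: mult_ac)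
  then have "(\<partial> i A x - A x ** src.\<Gamma> i x) $ j $ k = (\<partial> j A x - A x ** src.\<Gamma> j x) $ i $ k"
    unfolding dA vector_add_component s1 s2 by simp
  then show ?thesis by (simp add: src.cotton_def)
qed

end

section \<open>Symmetric forms and orthonormal frames\<close>

definition spd :: "real^'n^'n \<Rightarrow> bool" where
  "spd G \<longleftrightarrow> transpose G = G \<and> (\<forall>v. v \<noteq> 0 \<longrightarrow> v \<bullet> (G *v v) > 0)"

lemma symmetric_form:
  fixes S :: "real^'n^'n"
  assumes "transpose S = S"
  shows "u \<bullet> (S *v w) = w \<bullet> (S *v u)"
  by (metis assms dot_lmul_matrix inner_commute transpose_matrix_vector)

lemma nonneg_quadratic_imp_linear_zero:
  fixes b c :: real
  assumes "\<And>t. 2 * t * b + t\<^sup>2 * c \<ge> 0"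
  shows "b = 0"
proof (rule ccontr)
  assume "b \<noteq> 0"
  \<comment> \<open>The sign of t makes the linear term negative, and the denominator exceeds |c|,
    so the quadratic expression is at most -t^2 (|c| + 2).\<close>
  define t where "t = - b / (\<bar>c\<bar> + 1)"
  have c1: "\<bar>c\<bar> + 1 > 0" by simp
  have "t * (\<bar>c\<bar> + 1) = - b" using c1 by (simp add: t_def)
  then have "b = - (t * (\<bar>c\<bar> + 1))" by simp
  then have "2 * t * b = 2 * t * (- (t * (\<bar>c\<bar> + 1)))" by (rule arg_cong)
  then have "2 * t * b = - 2 * t\<^sup>2 * (\<bar>c\<bar> + 1)" by (simp only: power2_eq_square mult_minus_right mult_minus_left mult_ac)
  moreover have "t\<^sup>2 * c \<le> t\<^sup>2 * \<bar>c\<bar>" by (intro mult_left_mono) auto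
  moreover have "t\<^sup>2 > 0" using \<open>b \<noteq> 0\<close> c1 by (simp add: t_def)
  moreover have "- 2 * t\<^sup>2 * (\<bar>c\<bar> + 1) + t\<^sup>2 * \<bar>c\<bar> = - (t\<^sup>2 * \<bar>c\<bar>) - 2 * t\<^sup>2" by (simp add: algebra_simps)
  moreover have "t\<^sup>2 * \<bar>c\<bar> \<ge> 0" by simp
  ultimately show False using assms[of t] by linarith
qed

text \<open>The spectral theorem for \<open>S\<close> relative to \<open>G\<close>, adjoining one
  eigenvector at a time: the new one maximizes the Rayleigh quotient on the
  \<open>G\<close>-orthogonal complement \<open>V\<close> of those already found.\<close>

lemma partial_eigenframe:
  fixes G S :: "real^'n^'n" and A :: "'n set"
  assumes G: "spd G" and S: "transpose S = S"
  shows "\<exists>e \<mu>. (\<forall>a\<in>A. \<forall>b\<in>A. e a \<bullet> (G *v e b) = (if a = b then 1 else 0)) \<and> (\<forall>a\<in>A. S *v e a = \<mu> a *\<^sub>R (G *v e a))"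
proof -
  have "finite A" by simp
  then show ?thesis
  proof (induction A)
    case empty then show ?case by simp
  next
    case (insert c A)
    then obtain e \<mu> where on: "\<And>a b. a \<in> A \<Longrightarrow> b \<in> A \<Longrightarrow> e a \<bullet> (G *v e b) = (if a = b then 1 else 0)"
      and ev: "\<And>a. a \<in> A \<Longrightarrow> S *v e a = \<mu> a *\<^sub>R (G *v e a)" by blast
    have symG: "u \<bullet> (G *v w) = w \<bullet> (G *v u)" for u w
      using G symmetric_form by (auto simp: spd_def)
    have posG: "v \<noteq> 0 \<Longrightarrow> v \<bullet> (G *v v) > 0" for v using G by (auto simp: spd_def)
    define V where "V = {v. \<forall>b\<in>A. e b \<bullet> (G *v v) = 0}"
    let ?L = "\<lambda>v. (\<chi> b. if b \<in> A then e b \<bullet> (G *v v) else 0) :: real^'n"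
      and ?q = "\<lambda>v. (v \<bullet> (S *v v)) / (v \<bullet> (G *v v))"
    have lin: "linear ?L"
      by (auto simp: linear_iff vec_eq_iff matrix_vector_right_distrib inner_add_right
          matrix_vector_mult_scaleR)
    \<comment> \<open>The coordinate c of \<open>?L v\<close> is always 0 because c is not in
      \<open>A\<close>. Hence \<open>?L\<close> has a nontrivial kernel, which supplies a nonzero
      vector of \<open>V\<close>.\<close>
    have "\<not> surj ?L"
    proof
      assume "surj ?L"
      then obtain v where "axis c 1 = ((\<chi> b. if b \<in> A then e b \<bullet> (G *v v) else 0) :: real^'n)" by blast
      then have "(axis c 1 :: real^'n) $ c = (if c \<in> A then e c \<bullet> (G *v v) else 0)" by simp
      then show False using insert.hyps by simp
    qed
    then have "\<not> inj ?L"
      using linear_injective_imp_surjective[OF lin] by blast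
    then obtain v1 where v1: "v1 \<noteq> 0" "(\<chi> b. if b \<in> A then e b \<bullet> (G *v v1) else 0) = (0 :: real^'n)"
      unfolding linear_injective_0[OF lin] by blast
    have v1V: "v1 \<in> V"
      using v1(2) by (auto simp: V_def vec_eq_iff split: if_splits)
    have subV: "r *\<^sub>R u + s *\<^sub>R w \<in> V" if "u \<in> V" "w \<in> V" for r s u w
      using that by (simp add: V_def matrix_vector_right_distrib inner_add_right matrix_vector_mult_scaleR)
    have contM: "continuous_on X (\<lambda>v. M *v v)" for X and M :: "real^'n^'n"
      by (rule linear_continuous_on[OF matrix_vector_mul_bounded_linear])
    have "closed V"
    proof -
      have "V = (\<Inter>b\<in>A. {v. e b \<bullet> (G *v v) = 0})" by (auto simp: V_def)
      moreover have "closed {v. e b \<bullet> (G *v v) = 0}" for b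
        by (intro closed_Collect_eq continuous_intros contM)
      ultimately show ?thesis by auto
    qed
    then have comp: "compact (sphere 0 1 \<inter> V)"
      by (intro compact_Int_closed) auto
    have ne: "sphere 0 1 \<inter> V \<noteq> {}"
    proof -
      have "(1 / norm v1) *\<^sub>R v1 + 0 *\<^sub>R v1 \<in> V" by (intro subV v1V)
      then have "(1 / norm v1) *\<^sub>R v1 \<in> sphere 0 1 \<inter> V" using v1 by simp
      then show ?thesis by blast
    qed
    have "continuous_on (sphere 0 1 \<inter> V) ?q"
    proof (intro continuous_on_divide continuous_on_inner continuous_on_id contM ballI)
      fix v assume "v \<in> sphere 0 1 \<inter> V"
      then have "v \<noteq> 0" by auto
      then show "v \<bullet> (G *v v) \<noteq> 0" using posG[of v] by simp
    qed
    from continuous_attains_sup[OF comp ne this] obtain v0 where v0: "v0 \<in> sphere 0 1" "v0 \<in> V"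
      and mx: "\<And>v. v \<in> sphere 0 1 \<Longrightarrow> v \<in> V \<Longrightarrow> ?q v \<le> ?q v0"
      by blast
    have v00: "v0 \<noteq> 0" using v0 by auto
    define m where "m = ?q v0"
    define B where "B w = m * (w \<bullet> (G *v w)) - w \<bullet> (S *v w)" for w
    have B0: "B v0 = 0" using posG[OF v00] by (simp add: B_def m_def)
    have Bpos: "B w \<ge> 0" if w: "w \<in> V" for w
    proof (cases "w = 0")
      case False
      let ?u = "(1 / norm w) *\<^sub>R w"
      have "?u + 0 *\<^sub>R w \<in> V" by (intro subV w)
      then have "(?u \<bullet> (S *v ?u)) / (?u \<bullet> (G *v ?u)) \<le> m"
        using mx[of ?u] False by (simp add: m_def)
      moreover have "(?u \<bullet> (S *v ?u)) / (?u \<bullet> (G *v ?u)) = (w \<bullet> (S *v w)) / (w \<bullet> (G *v w))"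
        using False posG[OF False] by (simp add: matrix_vector_mult_scaleR)
      ultimately have "(w \<bullet> (S *v w)) / (w \<bullet> (G *v w)) \<le> m" by (simp only:)
      then show ?thesis using posG[OF False] by (simp add: B_def divide_le_eq)
    qed (simp add: B_def)
    \<comment> \<open>The residual of the eigenvalue equation. Maximality makes it orthogonal to
      \<open>V\<close>, and the eigenvalue equations already known make it orthogonal to the vectors
      of \<open>A\<close>.\<close>
    define z where "z = m *\<^sub>R (G *v v0) - S *v v0"
    have zV: "w \<bullet> z = 0" if w: "w \<in> V" for w
    proof (rule nonneg_quadratic_imp_linear_zero[where c="B w"])
      fix t :: real
      have "B (1 *\<^sub>R v0 + t *\<^sub>R w) \<ge> 0" by (intro Bpos subV v0 w)
      moreover have "B (v0 + t *\<^sub>R w) = B v0 + 2 * t * (w \<bullet> z) + t\<^sup>2 * B w"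
        unfolding B_def z_def matrix_vector_right_distrib matrix_vector_mult_scaleR
        by (simp add: inner_add_left inner_add_right inner_diff_right symG[of v0 w] symmetric_form[OF S, of v0 w]
            algebra_simps power2_eq_square)
      ultimately show "2 * t * (w \<bullet> z) + t\<^sup>2 * B w \<ge> 0" using B0 by simp
    qed
    have zA: "e b \<bullet> z = 0" if b: "b \<in> A" for b
    proof -
      have "e b \<bullet> (G *v v0) = 0" using v0(2) b by (simp add: V_def)
      moreover have "e b \<bullet> (S *v v0) = \<mu> b * (v0 \<bullet> (G *v e b))"
        using symmetric_form[OF S, of "e b" v0] ev[OF b] by simp
      ultimately show ?thesis by (simp add: z_def inner_diff_right symG[of v0 "e b"])
    qed
    have "z \<bullet> z = 0"
    proof -
      \<comment> \<open>The \<open>G\<close>-orthogonal projection of z to the span of the earlier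
        vectors. It splits z into a part in that span and a part in \<open>V\<close>, and z is
        orthogonal to both.\<close>
      let ?p = "\<Sum>b\<in>A. (e b \<bullet> (G *v z)) *\<^sub>R e b"
      have "e a \<bullet> (G *v (z - ?p)) = 0" if a: "a \<in> A" for a
      proof -
        have "e a \<bullet> (G *v ?p) = (\<Sum>b\<in>A. (e b \<bullet> (G *v z)) * (e a \<bullet> (G *v e b)))"
          by (simp add: linear_sum[OF matrix_vector_mul_linear] inner_sum_right matrix_vector_mult_scaleR)
        also have "\<dots> = (\<Sum>b\<in>A. if a = b then e b \<bullet> (G *v z) else 0)"
          by (intro sum.cong refl) (use on a in auto)
        finally show ?thesis using a insert.hyps
          by (simp add: matrix_vector_mult_diff_distrib inner_diff_right)
      qed
      then have "(z - ?p) \<bullet> z = 0" by (intro zV) (simp add: V_def)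
      moreover have "?p \<bullet> z = 0" using zA by (simp add: inner_sum_left)
      ultimately show ?thesis by (simp add: inner_diff_left)
    qed
    then have Sv0: "S *v v0 = m *\<^sub>R (G *v v0)" by (simp add: z_def)
    define k where "k = 1 / sqrt (v0 \<bullet> (G *v v0))"
    have k: "k * k * (v0 \<bullet> (G *v v0)) = 1" using posG[OF v00] by (simp add: k_def)
    have v0A: "e b \<bullet> (G *v v0) = 0" if "b \<in> A" for b using v0(2) that by (simp add: V_def)
    have v0A': "v0 \<bullet> (G *v e b) = 0" if "b \<in> A" for b using v0A[OF that] by (simp add: symG[of v0 "e b"])
    define e' where "e' = e(c := k *\<^sub>R v0)"
    define \<mu>' where "\<mu>' = \<mu>(c := m)"
    have "e' a \<bullet> (G *v e' b) = (if a = b then 1 else 0)" if "a \<in> insert c A" "b \<in> insert c A" for a b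
      using that insert.hyps on v0A v0A' k
      by (auto simp: e'_def matrix_vector_mult_scaleR mult.assoc)
    moreover have "S *v e' a = \<mu>' a *\<^sub>R (G *v e' a)" if "a \<in> insert c A" for a
      using that insert.hyps ev Sv0 by (auto simp: e'_def \<mu>'_def matrix_vector_mult_scaleR)
    ultimately show ?case by blast
  qed
qed

lemma eigenframe_exists:
  fixes G S :: "real^'n^'n"
  assumes "spd G" "transpose S = S"
  obtains e \<mu> where "orthonormal_frame G e" "\<And>a. S *v e a = \<mu> a *\<^sub>R (G *v e a)"
  using partial_eigenframe[OF assms, of UNIV] unfolding orthonormal_frame_def by auto

section \<open>Traces and full contractions in an orthonormal frame\<close>

definition frame_matrix :: "('n \<Rightarrow> real^'n) \<Rightarrow> real^'n^'n" where
  "frame_matrix e = (\<chi> i a. e a $ i)"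

lemma frame_matrix_congruence:
  "(transpose (frame_matrix e) ** S ** frame_matrix e) $ a $ b = e a \<bullet> (S *v e b)"
proof -
  have "(transpose (frame_matrix e) ** (S ** frame_matrix e)) $ a $ b = e a \<bullet> (S *v e b)"
    unfolding transpose_mult_nth by (simp add: frame_matrix_def matrix_mult_nth matrix_vector_mult_def inner_vec_def)
  then show ?thesis by (simp add: matrix_mul_assoc)
qed

lemma orthonormal_frame_matrix:
  "orthonormal_frame G e \<longleftrightarrow> transpose (frame_matrix e) ** G ** frame_matrix e = mat 1"
  by (simp add: orthonormal_frame_def vec_eq_iff frame_matrix_congruence mat_def)

lemma matrix_inv_frame:
  assumes "orthonormal_frame G e"
  shows "matrix_inv G = frame_matrix e ** transpose (frame_matrix e)"
proof (rule matrix_inv_unique)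
  let ?P = "frame_matrix e"
  have "?P ** (transpose ?P ** G) = mat 1"
    using assms matrix_left_right_inverse unfolding orthonormal_frame_matrix by blast
  then have "(?P ** transpose ?P) ** G = mat 1" by (simp add: matrix_mul_assoc)
  then show "G ** (?P ** transpose ?P) = mat 1" using matrix_left_right_inverse by blast
qed

lemma ginv_frame:
  assumes "orthonormal_frame G e"
  shows "ginv G i j = (\<Sigma> a. e a $ i * e a $ j)"
  by (simp add: matrix_inv_frame[OF assms] matrix_matrix_mult_def transpose_def frame_matrix_def)

lemma sum_UNIV_prod:
  fixes F :: "'a::finite \<Rightarrow> 'b::finite \<Rightarrow> real"
  shows "(\<Sigma> p. F (fst p) (snd p)) = (\<Sigma> a b. F a b)"
  by (simp add: sum.cartesian_product split_beta)

text \<open>Converts one pair of metric-contracted indices into a sum over a frame index. The index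
  d carries the pairs converted earlier, and the result has again the form of the inner sum, so the
  step can be iterated slot by slot.\<close>

lemma ginv_contract:
  fixes G :: "real^'n^'n" and f g :: "'n \<Rightarrow> 'd::finite \<Rightarrow> real"
  assumes "orthonormal_frame G e"
  shows "(\<Sigma> i j. ginv G i j * (\<Sigma> d. f i d * g j d))
    = (\<Sigma> p. (\<Sigma> i. e (fst p) $ i * f i (snd p)) * (\<Sigma> j. e (fst p) $ j * g j (snd p)))"
proof -
  have "(\<Sigma> i j. ginv G i j * (\<Sigma> d. f i d * g j d))
    = (\<Sigma> i j a d. (e a $ i * f i d) * (e a $ j * g j d))"
    unfolding ginv_frame[OF assms] sum_product by (simp add: mult_ac)
  also have "\<dots> = (\<Sigma> i a d j. (e a $ i * f i d) * (e a $ j * g j d))"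
  proof (rule sum.cong[OF refl])
    fix i
    show "(\<Sigma> j a d. (e a $ i * f i d) * (e a $ j * g j d))
      = (\<Sigma> a d j. (e a $ i * f i d) * (e a $ j * g j d))"
      by (subst sum.swap, rule sum.cong[OF refl], rule sum.swap)
  qed
  also have "\<dots> = (\<Sigma> a d i j. (e a $ i * f i d) * (e a $ j * g j d))"
    by (subst sum.swap, rule sum.cong[OF refl], rule sum.swap)
  finally show ?thesis
    unfolding sum_UNIV_prod[where F="\<lambda>a d. \<Sigma> i j. e a $ i * f i d * (e a $ j * g j d)"] sum_product .
qed

lemma trace2_frame:
  assumes "orthonormal_frame G e"
  shows "trace2 G S = (\<Sigma> a. e a \<bullet> (S *v e a))"
proof -
  have "trace2 G S = (\<Sigma> i j a. e a $ i * (S $ i $ j * e a $ j))"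
    unfolding trace2_def ginv_frame[OF assms] sum_distrib_right by (simp add: mult_ac)
  also have "\<dots> = (\<Sigma> i a j. e a $ i * (S $ i $ j * e a $ j))"
    by (rule sum.cong[OF refl], rule sum.swap)
  also have "\<dots> = (\<Sigma> a i j. e a $ i * (S $ i $ j * e a $ j))"
    by (rule sum.swap)
  finally show ?thesis
    by (simp add: inner_vec_def matrix_vector_mult_def sum_distrib_left)
qed

lemma normsq2_frame:
  fixes G :: "real^'n^'n"
  assumes e: "orthonormal_frame G e"
  shows "normsq2 G S = (\<Sigma> a b. (e a \<bullet> (S *v e b))\<^sup>2)"
proof -
  define T1 where "T1 i p = (\<Sigma> j. e (fst p) $ j * S $ i $ j)" for i and p :: "'n \<times> unit"
  have 1: "(\<Sigma> j b. ginv G j b * (S $ i $ j * S $ a $ b)) = (\<Sigma> p. T1 i p * T1 a p)" for i a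
    using ginv_contract[OF e, of "\<lambda>j (d::unit). S $ i $ j" "\<lambda>b d. S $ a $ b"]
    by (simp add: T1_def)
  have "normsq2 G S = (\<Sigma> i a. ginv G i a * (\<Sigma> j b. ginv G j b * (S $ i $ j * S $ a $ b)))"
    by (simp add: normsq2_def sum_distrib_left mult.assoc)
  also have "\<dots> = (\<Sigma> p. (\<Sigma> i. e (fst p) $ i * T1 i (snd p))\<^sup>2)"
    unfolding 1 ginv_contract[OF e] by (simp add: power2_eq_square)
  also have "\<dots> = (\<Sigma> a q. (\<Sigma> i. e a $ i * T1 i q)\<^sup>2)"
    by (simp add: sum.cartesian_product split_beta)
  also have "\<dots> = (\<Sigma> a b. (\<Sigma> i. e a $ i * T1 i (b, ()))\<^sup>2)"
    by (simp add: sum.cartesian_product' UNIV_unit flip: UNIV_Times_UNIV)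
  finally show ?thesis
    by (simp add: T1_def inner_vec_def matrix_vector_mult_def mult.commute)
qed

lemma normsq4_frame:
  fixes G :: "real^'n^'n" and T :: "'n tensor4"
  assumes e: "orthonormal_frame G e"
  shows "normsq4 G T = (\<Sigma> p q r s.
    (\<Sigma> i. e p $ i * (\<Sigma> j. e q $ j * (\<Sigma> k. e r $ k * (\<Sigma> l. e s $ l * T i j k l))))\<^sup>2)"
proof -
  \<comment> \<open>Slots are converted from the last to the first. The tuple argument lists the
    frame indices produced so far, and the unit type starts the iteration with none.\<close>
  define T1 where "T1 i j k p = (\<Sigma> l. e (fst p) $ l * T i j k l)" for i j k and p :: "'n \<times> unit"
  define T2 where "T2 i j p = (\<Sigma> k. e (fst p) $ k * T1 i j k (snd p))" for i j and p :: "'n \<times> 'n \<times> unit"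
  define T3 where "T3 i p = (\<Sigma> j. e (fst p) $ j * T2 i j (snd p))" for i and p :: "'n \<times> 'n \<times> 'n \<times> unit"
  have 1: "(\<Sigma> l d. ginv G l d * (T i j k l * T a b c d)) = (\<Sigma> p. T1 i j k p * T1 a b c p)" for i j k a b c
    using ginv_contract[OF e, of "\<lambda>l (d::unit). T i j k l" "\<lambda>l d. T a b c l"]
    by (simp add: T1_def)
  have 2: "(\<Sigma> k c. ginv G k c * (\<Sigma> p. T1 i j k p * T1 a b c p)) = (\<Sigma> p. T2 i j p * T2 a b p)" for i j a b
    unfolding ginv_contract[OF e] T2_def ..
  have 3: "(\<Sigma> j b. ginv G j b * (\<Sigma> p. T2 i j p * T2 a b p)) = (\<Sigma> p. T3 i p * T3 a p)" for i a
    unfolding ginv_contract[OF e] T3_def ..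
  have "normsq4 G T = (\<Sigma> i a. ginv G i a * (\<Sigma> j b. ginv G j b *
     (\<Sigma> k c. ginv G k c * (\<Sigma> l d. ginv G l d * (T i j k l * T a b c d)))))"
    by (simp add: normsq4_def sum_distrib_left mult.assoc)
  also have "\<dots> = (\<Sigma> p. (\<Sigma> i. e (fst p) $ i * T3 i (snd p))\<^sup>2)"
    unfolding 1 2 3 ginv_contract[OF e] by (simp add: power2_eq_square)
  also have "\<dots> = (\<Sigma> p q r s. (\<Sigma> i. e p $ i * T3 i (q, r, s, ()))\<^sup>2)"
    by (simp add: sum.cartesian_product' UNIV_unit flip: UNIV_Times_UNIV)
  finally show ?thesis by (simp add: T1_def T2_def T3_def)
qed

lemma sum_pairs:
  fixes \<mu> :: "'a \<Rightarrow> real"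
  assumes "finite A"
  shows "(\<Sum>a\<in>A. \<mu> a)\<^sup>2 = (\<Sum>a\<in>A. (\<mu> a)\<^sup>2) + 2 * (\<Sum>T | T \<subseteq> A \<and> card T = 2. \<Prod>a\<in>T. \<mu> a)"
  using assms
proof (induction A)
  case empty
  then have "{T. T \<subseteq> {} \<and> card T = 2} = ({} :: 'a set set)" by auto
  then show ?case by simp
next
  case (insert x A)
  have e: "{T. T \<subseteq> insert x A \<and> card T = 2} = {T. T \<subseteq> A \<and> card T = 2} \<union> (\<lambda>a. {x, a}) ` A"
  proof (intro set_eqI iffI)
    fix T assume "T \<in> {T. T \<subseteq> insert x A \<and> card T = 2}"
    then have T: "T \<subseteq> insert x A" "card T = 2" by auto
    show "T \<in> {T. T \<subseteq> A \<and> card T = 2} \<union> (\<lambda>a. {x, a}) ` A"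
    proof (cases "x \<in> T")
      case True
      then have "card (T - {x}) = 1" using T by simp
      then obtain a where "T - {x} = {a}" using card_1_singletonE by metis
      then have "T = {x, a}" "a \<in> A" using True T by auto
      then show ?thesis by blast
    qed (use T in auto)
  next
    fix T assume "T \<in> {T. T \<subseteq> A \<and> card T = 2} \<union> (\<lambda>a. {x, a}) ` A"
    then show "T \<in> {T. T \<subseteq> insert x A \<and> card T = 2}"
      using insert.hyps by (auto simp: card_2_iff)
  qed
  have fin: "finite {T. T \<subseteq> A \<and> card T = 2}" using insert.hyps by simp
  have disj: "{T. T \<subseteq> A \<and> card T = 2} \<inter> (\<lambda>a. {x, a}) ` A = {}" using insert.hyps by auto
  have inj: "inj_on (\<lambda>a. {x, a}) A" using insert.hyps by (auto simp: inj_on_def doubleton_eq_iff)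
  have "(\<Sum>T\<in>(\<lambda>a. {x, a}) ` A. \<Prod>a\<in>T. \<mu> a) = (\<Sum>a\<in>A. \<mu> x * \<mu> a)"
    unfolding sum.reindex[OF inj] o_def
  proof (rule sum.cong[OF refl])
    fix a assume "a \<in> A"
    then have "x \<noteq> a" using insert.hyps by auto
    then show "prod \<mu> {x, a} = \<mu> x * \<mu> a" by simp
  qed
  then have "(\<Sum>T | T \<subseteq> insert x A \<and> card T = 2. \<Prod>a\<in>T. \<mu> a)
     = (\<Sum>T | T \<subseteq> A \<and> card T = 2. \<Prod>a\<in>T. \<mu> a) + \<mu> x * (\<Sum>a\<in>A. \<mu> a)"
    unfolding e using sum.union_disjoint[OF fin _ disj, of "\<lambda>T. \<Prod>a\<in>T. \<mu> a"] insert.hyps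
    by (simp add: sum_distrib_left)
  then show ?case using insert by (simp add: power2_sum algebra_simps)
qed

text \<open>Replaces the definition through chosen eigenvalues by trace and norm, which are computed
  in the frame belonging to the chosen family and can be differentiated.\<close>

lemma sigma2_eq:
  fixes G S :: "real^'n^'n"
  assumes "spd G" "transpose S = S"
  shows "2 * sigma2 G S = (trace2 G S)\<^sup>2 - normsq2 G S"
proof -
  define \<mu> where "\<mu> = (SOME \<mu>. eigenvalues_wrt G S \<mu>)"
  have "\<exists>\<mu>. eigenvalues_wrt G S \<mu>"
    using eigenframe_exists[OF assms] unfolding eigenvalues_wrt_def by metis
  then have "eigenvalues_wrt G S \<mu>" unfolding \<mu>_def by (rule someI_ex)
  then obtain e where e: "orthonormal_frame G e" and ev: "\<And>a. S *v e a = \<mu> a *\<^sub>R (G *v e a)"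
    unfolding eigenvalues_wrt_def by blast
  have s: "e a \<bullet> (S *v e b) = (if a = b then \<mu> a else 0)" for a b
    using e by (simp add: ev orthonormal_frame_def)
  have "trace2 G S = (\<Sigma> a. \<mu> a)" by (simp add: trace2_frame[OF e] s)
  moreover have "normsq2 G S = (\<Sigma> a. (\<mu> a)\<^sup>2)"
    by (simp add: normsq2_frame[OF e] s if_distrib[of "\<lambda>x. x\<^sup>2"] cong: if_cong)
  moreover have "sigma2 G S = (\<Sum>T | card T = 2. \<Prod>a\<in>T. \<mu> a)"
    by (simp add: sigma2_def \<mu>_def Let_def)
  ultimately show ?thesis using sum_pairs[of UNIV \<mu>] by simp
qed

lemma frame_exists:
  fixes G :: "real^'n^'n"
  assumes "spd G"
  obtains e where "orthonormal_frame G e"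
  using eigenframe_exists[OF assms, of G] assms unfolding spd_def by metis

lemma normsq2_shift:
  fixes G S :: "real^'n^'n"
  assumes "spd G"
  shows "normsq2 G (S - c *\<^sub>R G) = normsq2 G S - 2 * c * trace2 G S + c\<^sup>2 * real CARD('n)"
    and "trace2 G (S - c *\<^sub>R G) = trace2 G S - c * real CARD('n)"
proof -
  obtain e where e: "orthonormal_frame G e" using frame_exists[OF assms] .
  have s: "e a \<bullet> ((S - c *\<^sub>R G) *v e b) = e a \<bullet> (S *v e b) - (if a = b then c else 0)" for a b
    using e by (simp add: orthonormal_frame_def matrix_vector_mult_diff_rdistrib inner_diff_right scaleR_matrix_vector_assoc[symmetric])
  have sq: "(e a \<bullet> (S *v e b) - (if a = b then c else 0))\<^sup>2
     = (e a \<bullet> (S *v e b))\<^sup>2 - (if a = b then 2 * c * (e a \<bullet> (S *v e a)) - c\<^sup>2 else 0)" for a b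
    by (simp add: power2_diff)
  show "normsq2 G (S - c *\<^sub>R G) = normsq2 G S - 2 * c * trace2 G S + c\<^sup>2 * real CARD('n)"
    unfolding normsq2_frame[OF e] trace2_frame[OF e] s sq
    by (simp add: sum_subtractf sum_distrib_left)
  show "trace2 G (S - c *\<^sub>R G) = trace2 G S - c * real CARD('n)"
    unfolding trace2_frame[OF e] s by (simp add: sum_subtractf)
qed

lemma normsq2_nonneg:
  assumes "spd G"
  shows "normsq2 G S \<ge> 0"
proof -
  obtain e where e: "orthonormal_frame G e" using frame_exists[OF assms] .
  show ?thesis unfolding normsq2_frame[OF e] by (intro sum_nonneg) simp
qed

lemma normsq2_eq_0:
  fixes G S :: "real^'n^'n"
  assumes "spd G" "normsq2 G S = 0"
  shows "S = 0"
proof -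
  obtain e where e: "orthonormal_frame G e" using frame_exists[OF assms(1)] .
  let ?P = "frame_matrix e"
  have "(\<Sigma> b. (e a \<bullet> (S *v e b))\<^sup>2) = 0" for a
    using assms(2) unfolding normsq2_frame[OF e]
    by (subst (asm) sum_nonneg_eq_0_iff) (auto intro: sum_nonneg)
  then have "e a \<bullet> (S *v e b) = 0" for a b
    by (subst (asm) sum_nonneg_eq_0_iff) auto
  then have PSP: "transpose ?P ** S ** ?P = 0" by (simp add: vec_eq_iff frame_matrix_congruence)
  have I: "(transpose ?P ** G) ** ?P = mat 1" using e by (simp add: orthonormal_frame_matrix)
  then have R: "?P ** (transpose ?P ** G) = mat 1" using matrix_left_right_inverse by blast
  have "transpose (?P ** (transpose ?P ** G)) = mat 1" by (simp only: R transpose_mat)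
  then have L: "(G ** ?P) ** transpose ?P = mat 1"
    using assms(1) by (simp add: matrix_transpose_mul spd_def)
  have "S = ((G ** ?P) ** transpose ?P) ** S ** (?P ** (transpose ?P ** G))"
    by (simp only: L R) simp
  also have "\<dots> = (G ** ?P) ** (transpose ?P ** S ** ?P) ** (transpose ?P ** G)"
    by (simp add: matrix_mul_assoc)
  finally show ?thesis by (simp add: PSP)
qed

section \<open>The algebraic pinching estimate\<close>

text \<open>\<open>\<tau>\<close> is the part of \<open>e\<^sub>i e\<^sub>j\<close> with vanishing row sums, i.e. the only part seen by the Weyl curvature.\<close>

lemma weyl_part_norm:
  fixes e :: "'n::finite \<Rightarrow> real"
  defines "N \<equiv> real CARD('n)"
  defines "p2 \<equiv> \<Sigma> i. (e i)\<^sup>2"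
  defines "\<tau> \<equiv> \<lambda>i j. e i * e j + ((e i)\<^sup>2 + (e j)\<^sup>2) / (N - 2) - p2 / ((N - 1) * (N - 2))"
  assumes N: "N > 2" and p1: "(\<Sigma> i. e i) = 0"
  shows "(\<Sigma> i j. (if i = j then 0 else \<tau> i j)\<^sup>2) + N / (N - 2) * (\<Sigma> i. ((e i)\<^sup>2 - p2 / N)\<^sup>2)
    = (N - 2) / (N - 1) * p2\<^sup>2"
proof -
  define \<alpha> where "\<alpha> = 1 / (N - 2)"
  define c where "c = p2 / ((N - 1) * (N - 2))"
  define p4 where "p4 = (\<Sigma> i. (e i) ^ 4)"
  have \<tau>: "\<tau> i j = e i * e j + \<alpha> * ((e i)\<^sup>2 + (e j)\<^sup>2) - c" for i j
    by (simp add: \<tau>_def \<alpha>_def c_def)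
  have sq: "(\<tau> i j)\<^sup>2 = (e i)\<^sup>2 * (e j)\<^sup>2 + \<alpha>\<^sup>2 * ((e i) ^ 4) + \<alpha>\<^sup>2 * ((e j) ^ 4) + 2 * \<alpha>\<^sup>2 * ((e i)\<^sup>2 * (e j)\<^sup>2)
     + c\<^sup>2 + 2 * \<alpha> * ((e i) ^ 3 * e j) + 2 * \<alpha> * (e i * (e j) ^ 3) - 2 * c * (e i * e j)
     - 2 * c * \<alpha> * (e i)\<^sup>2 - 2 * c * \<alpha> * (e j)\<^sup>2" for i j
    unfolding \<tau> by algebra
  have full: "(\<Sigma> i j. (\<tau> i j)\<^sup>2) = p2\<^sup>2 + 2 * \<alpha>\<^sup>2 * N * p4 + 2 * \<alpha>\<^sup>2 * p2\<^sup>2 + N\<^sup>2 * c\<^sup>2 - 4 * c * \<alpha> * N * p2"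
    unfolding sq sum.distrib sum_subtractf sum_constant sum_distrib_left[symmetric] sum_distrib_right[symmetric]
      p1 p2_def[symmetric] p4_def[symmetric] N_def[symmetric]
    by (simp add: power2_eq_square algebra_simps)
  have diag_sq: "(\<tau> i i)\<^sup>2 = (1 + 2 * \<alpha>)\<^sup>2 * (e i) ^ 4 - 2 * c * (1 + 2 * \<alpha>) * (e i)\<^sup>2 + c\<^sup>2" for i
    unfolding \<tau> by algebra
  have diag: "(\<Sigma> i. (\<tau> i i)\<^sup>2) = (1 + 2 * \<alpha>)\<^sup>2 * p4 - 2 * c * (1 + 2 * \<alpha>) * p2 + N * c\<^sup>2"
    unfolding diag_sq sum.distrib sum_subtractf sum_distrib_left[symmetric]
    by (simp add: p2_def[symmetric] p4_def[symmetric] N_def[symmetric])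
  have "(if i = j then 0 else \<tau> i j)\<^sup>2 = (\<tau> i j)\<^sup>2 - (if i = j then (\<tau> i i)\<^sup>2 else 0)" for i j by simp
  then have off: "(\<Sigma> i j. (if i = j then 0 else \<tau> i j)\<^sup>2)
     = (\<Sigma> i j. (\<tau> i j)\<^sup>2) - (\<Sigma> i. (\<tau> i i)\<^sup>2)"
    by (simp add: sum_subtractf)
  have bsq: "((e i)\<^sup>2 - p2 / N)\<^sup>2 = (e i) ^ 4 - 2 * (p2 / N) * (e i)\<^sup>2 + (p2 / N)\<^sup>2" for i
    by algebra
  have "(\<Sigma> i. ((e i)\<^sup>2 - p2 / N)\<^sup>2) = p4 - 2 * (p2 / N) * p2 + N * (p2 / N)\<^sup>2"
    unfolding bsq sum.distrib sum_subtractf sum_distrib_left[symmetric]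
    by (simp add: p2_def[symmetric] p4_def[symmetric] N_def[symmetric])
  also have "\<dots> = p4 - p2\<^sup>2 / N"
    using N by (simp add: field_simps power2_eq_square)
  finally have B: "(\<Sigma> i. ((e i)\<^sup>2 - p2 / N)\<^sup>2) = p4 - p2\<^sup>2 / N" .
  have nz: "N - 2 \<noteq> 0" "N - 1 \<noteq> 0" "N \<noteq> 0" using N by auto
  have \<alpha>N: "\<alpha> * (N - 2) = 1" using nz by (simp add: \<alpha>_def)
  have cc: "c = p2 * \<alpha> / (N - 1)" by (simp add: c_def \<alpha>_def)
  define \<beta> where "\<beta> = 1 / (N - 1)"
  have \<beta>N: "\<beta> * (N - 1) = 1" using nz by (simp add: \<beta>_def)
  have cb: "c = p2 * \<alpha> * \<beta>" by (simp add: cc \<beta>_def)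
  have "N / (N - 2) = N * \<alpha>" "(N - 2) / (N - 1) = (N - 2) * \<beta>" by (simp_all add: \<alpha>_def \<beta>_def)
  moreover have "N * \<alpha> * (p4 - p2\<^sup>2 / N) = N * \<alpha> * p4 - \<alpha> * p2\<^sup>2" using nz by (simp add: field_simps)
  \<comment> \<open>The weight N/(N-2) is the one for which the fourth powers cancel: 2 N \<alpha>^2
    - (1 + 2 \<alpha>)^2 + N \<alpha> = 0. The reciprocals \<alpha> and \<beta> make the whole
    identity polynomial modulo their defining relations.\<close>
  moreover have "p2\<^sup>2 + 2 * \<alpha>\<^sup>2 * N * p4 + 2 * \<alpha>\<^sup>2 * p2\<^sup>2 + N\<^sup>2 * c\<^sup>2 - 4 * c * \<alpha> * N * p2
     - ((1 + 2 * \<alpha>)\<^sup>2 * p4 - 2 * c * (1 + 2 * \<alpha>) * p2 + N * c\<^sup>2) + (N * \<alpha> * p4 - \<alpha> * p2\<^sup>2) = (N - 2) * \<beta> * p2\<^sup>2"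
    unfolding cb using \<alpha>N \<beta>N by algebra
  ultimately show ?thesis
    unfolding off full diag B by simp
qed

text \<open>Symmetry and zero row sums make w orthogonal to every function of a single index. For
  the Weyl sectional curvatures this expresses trace-freeness.\<close>

lemma weights_orthogonal:
  fixes w :: "'n::finite \<Rightarrow> 'n \<Rightarrow> real"
  assumes w_sym: "\<And>i j. w i j = w j i" and w_sum: "\<And>i. (\<Sigma> j. w i j) = 0"
  shows "(\<Sigma> i j. w i j * f i) = 0" "(\<Sigma> i j. w i j * f j) = 0"
proof -
  show w: "(\<Sigma> i j. w i j * f i) = 0"
    by (simp add: sum_distrib_right[symmetric] w_sum)
  have "(\<Sigma> i j. w i j * f j) = (\<Sigma> j i. w j i * f j)"
    by (subst sum.swap) (simp add: w_sym)
  then show "(\<Sigma> i j. w i j * f j) = 0" using w by simp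
qed

text \<open>Cauchy-Schwarz for the pairs (w, -e) and (t, b), with weight k = N/(N-2) on the second
  component. The pairing is \<open>Q\<close>, the quantity to be bounded; the norm of (t, b) is
  \<open>M\<close> by \<open>weyl_part_norm\<close>; twice the norm of (w, -e) is bounded by the
  left side of \<open>pinch\<close>. The right side of \<open>pinch\<close> times M/2 is exactly the
  square of R p2 / (N-1).\<close>

lemma weyl_ricci_pinching:
  fixes e :: "'n::finite \<Rightarrow> real" and w :: "'n \<Rightarrow> 'n \<Rightarrow> real" and W2 R :: real
  defines "N \<equiv> real CARD('n)"
  defines "p2 \<equiv> \<Sigma> i. (e i)\<^sup>2"
  assumes N: "N > 2" and p1: "(\<Sigma> i. e i) = 0"
    and w_diag: "\<And>i. w i i = 0" and w_sym: "\<And>i j. w i j = w j i" and w_sum: "\<And>i. (\<Sigma> j. w i j) = 0"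
    and W2: "2 * (\<Sigma> i j. (w i j)\<^sup>2) \<le> W2" and R: "R > 0"
    and pinch: "W2 + 2 * N / (N - 2) * p2 < 2 * R\<^sup>2 / ((N - 1) * (N - 2))"
    and p2: "p2 \<noteq> 0"
  shows "0 < - (\<Sigma> i j. w i j * (e i * e j)) + N / (N - 2) * (\<Sigma> i. (e i) ^ 3) + R / (N - 1) * p2"
proof -
  define \<tau> where "\<tau> i j = e i * e j + ((e i)\<^sup>2 + (e j)\<^sup>2) / (N - 2) - p2 / ((N - 1) * (N - 2))" for i j
  define t where "t i j = (if i = j then 0 else \<tau> i j)" for i j
  define b where "b i = (e i)\<^sup>2 - p2 / N" for i
  define k where "k = N / (N - 2)"
  define X where "X = (\<Sigma> i j. w i j * (e i * e j))"
  define p3 where "p3 = (\<Sigma> i. (e i) ^ 3)"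
  define M where "M = (N - 2) / (N - 1) * p2\<^sup>2"
  define ww where "ww = (\<Sigma> i j. (w i j)\<^sup>2)"
  define Q where "Q = X - k * p3"
  have M: "(\<Sigma> i j. (t i j)\<^sup>2) + k * (\<Sigma> i. (b i)\<^sup>2) = M"
    using weyl_part_norm[of e] N p1
    unfolding M_def t_def \<tau>_def b_def k_def N_def p2_def by simp
  have p2pos: "p2 > 0" using p2 by (simp add: p2_def sum_nonneg less_le)
  have Mpos: "M > 0" using N p2pos by (simp add: M_def)
  have k0: "k \<ge> 0" using N by (simp add: k_def)
  note w1 = weights_orthogonal(1)[OF w_sym w_sum] and w2 = weights_orthogonal(2)[OF w_sym w_sum]
  have "(\<Sigma> i j. w i j * t i j) = (\<Sigma> i j. w i j * (e i * e j)
     + w i j * ((e i)\<^sup>2 / (N - 2)) + w i j * ((e j)\<^sup>2 / (N - 2)) - w i j * (p2 / ((N - 1) * (N - 2))))"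
  proof (rule sum.cong[OF refl], rule sum.cong[OF refl])
    fix i j
    show "w i j * t i j = w i j * (e i * e j)
     + w i j * ((e i)\<^sup>2 / (N - 2)) + w i j * ((e j)\<^sup>2 / (N - 2)) - w i j * (p2 / ((N - 1) * (N - 2)))"
      by (cases "i = j") (simp_all add: w_diag t_def \<tau>_def distrib_left right_diff_distrib add_divide_distrib)
  qed
  also have "\<dots> = X"
    unfolding sum.distrib sum_subtractf X_def
    using w1[of "\<lambda>i. (e i)\<^sup>2 / (N - 2)"] w2[of "\<lambda>i. (e i)\<^sup>2 / (N - 2)"] w1[of "\<lambda>i. p2 / ((N - 1) * (N - 2))"] by simp
  finally have wt: "(\<Sigma> i j. w i j * t i j) = X" .
  have eb: "(\<Sigma> i. e i * b i) = p3"
  proof -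
    have *: "e i * b i = (e i) ^ 3 - p2 / N * e i" for i
      by (simp add: b_def power3_eq_cube power2_eq_square right_diff_distrib)
    show ?thesis unfolding * sum_subtractf sum_distrib_left[symmetric] p1 p3_def by simp
  qed
  \<comment> \<open>The minimizer of the quadratic in s obtained by subtracting s (t, b) from (w,
    -e); its minimum value is the Cauchy-Schwarz defect.\<close>
  define s where "s = Q / M"
  have "0 \<le> (\<Sigma> i j. (w i j - s * t i j)\<^sup>2) + k * (\<Sigma> i. (e i + s * b i)\<^sup>2)"
    using k0 by (intro add_nonneg_nonneg mult_nonneg_nonneg sum_nonneg) auto
  also have "\<dots> = (ww + k * p2) - 2 * s * (X - k * p3) + s\<^sup>2 * ((\<Sigma> i j. (t i j)\<^sup>2) + k * (\<Sigma> i. (b i)\<^sup>2))"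
  proof -
    have "(w i j - s * t i j)\<^sup>2 = (w i j)\<^sup>2 - 2 * s * (w i j * t i j) + s\<^sup>2 * (t i j)\<^sup>2" for i j by algebra
    then have 1: "(\<Sigma> i j. (w i j - s * t i j)\<^sup>2) = ww - 2 * s * X + s\<^sup>2 * (\<Sigma> i j. (t i j)\<^sup>2)"
      by (simp add: sum.distrib sum_subtractf sum_distrib_left[symmetric] wt ww_def)
    have "(e i + s * b i)\<^sup>2 = (e i)\<^sup>2 + 2 * s * (e i * b i) + s\<^sup>2 * (b i)\<^sup>2" for i by algebra
    then have 2: "(\<Sigma> i. (e i + s * b i)\<^sup>2) = p2 + 2 * s * p3 + s\<^sup>2 * (\<Sigma> i. (b i)\<^sup>2)"
      by (simp add: sum.distrib sum_distrib_left[symmetric] eb p2_def)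
    show ?thesis unfolding 1 2 by algebra
  qed
  finally have "0 \<le> (ww + k * p2) - 2 * s * Q + s\<^sup>2 * M" unfolding M Q_def .
  moreover have "2 * s * Q - s\<^sup>2 * M = Q\<^sup>2 / M" using Mpos by (simp add: s_def power2_eq_square field_simps)
  ultimately have "Q\<^sup>2 / M \<le> ww + k * p2" by simp
  then have "Q\<^sup>2 \<le> (ww + k * p2) * M" using Mpos by (simp add: divide_le_eq)
  also have "\<dots> < (R\<^sup>2 / ((N - 1) * (N - 2))) * M"
  proof (rule mult_strict_right_mono[OF _ Mpos])
    have "2 * (ww + k * p2) \<le> W2 + 2 * N / (N - 2) * p2" using W2 by (simp add: ww_def k_def)
    then show "ww + k * p2 < R\<^sup>2 / ((N - 1) * (N - 2))" using pinch by simp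
  qed
  also have "\<dots> = (R / (N - 1) * p2)\<^sup>2"
    using N by (simp add: M_def power_mult_distrib power_divide) (simp add: power2_eq_square)
  finally have "Q\<^sup>2 < (R / (N - 1) * p2)\<^sup>2" .
  then have "Q < R / (N - 1) * p2"
    by (rule power2_less_imp_less) (use R N p2pos in simp)
  then show ?thesis by (simp add: Q_def X_def k_def p3_def)
qed

section \<open>The Bochner argument at a maximum\<close>

text \<open>Writes the norm without a frame, as the trace of the squared endomorphism. In this form
  it can be differentiated and is visibly invariant under conjugation.\<close>

lemma normsq2_eq_trace:
  fixes G A :: "real^'n^'n"
  assumes "spd G" "transpose A = A"
  shows "normsq2 G A = trace ((matrix_inv G ** A) ** (matrix_inv G ** A))"
proof -
  obtain e where e: "orthonormal_frame G e" using frame_exists[OF assms(1)] .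
  let ?P = "frame_matrix e"
  let ?B = "transpose ?P ** A ** ?P"
  have Bs: "?B $ b $ a = ?B $ a $ b" for a b
    unfolding frame_matrix_congruence by (rule symmetric_form[OF assms(2)])
  have "trace ((matrix_inv G ** A) ** (matrix_inv G ** A)) = trace (?P ** (transpose ?P ** A ** ?P ** transpose ?P ** A))"
    by (simp add: matrix_inv_frame[OF e] matrix_mul_assoc)
  also have "\<dots> = trace (?B ** ?B)"
    by (subst trace_mul_sym) (simp add: matrix_mul_assoc)
  also have "\<dots> = (\<Sigma> a b. ?B $ a $ b * ?B $ a $ b)"
    unfolding trace_def matrix_mult_nth[of ?B ?B]
    by (rule sum.cong[OF refl], rule sum.cong[OF refl], rule arg_cong[where f="(*) _"], rule Bs)
  finally show ?thesis
    by (simp add: normsq2_frame[OF e] frame_matrix_congruence power2_eq_square)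
qed

lemma trace_square_symmetric_nonneg:
  fixes B :: "real^'n^'n"
  assumes "\<And>i j. B $ i $ j = B $ j $ i"
  shows "trace (B ** B) \<ge> 0"
proof -
  have "trace (B ** B) = (\<Sigma> i j. (B $ i $ j)\<^sup>2)"
    unfolding trace_def matrix_mult_nth power2_eq_square
    by (rule sum.cong[OF refl], rule sum.cong[OF refl], rule arg_cong[where f="(*) _"], rule assms)
  then show ?thesis by (simp add: sum_nonneg)
qed

context metric_field
begin

lemma spd_G: "x \<in> S \<Longrightarrow> spd (G x)"
  using sym_G pos_G by (auto simp: spd_def)

lemma partial_deriv_sym_matrix:
  fixes A :: "real^'n \<Rightarrow> real^'n^'n"
  assumes A: "smooth_on S A" and sym: "\<And>y. y \<in> S \<Longrightarrow> transpose (A y) = A y" and x: "x \<in> S"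
  shows "\<partial> i A x $ j $ k = \<partial> i A x $ k $ j"
proof -
  have "\<partial> i A x = \<partial> i (\<lambda>y. transpose (A y)) x"
    by (rule partial_deriv_cong[OF open_S x]) (simp add: sym)
  also have "\<dots> = transpose (\<partial> i A x)"
    by (rule partial_deriv_transpose[OF smooth_on_differentiable[OF A open_S x]])
  finally have e: "\<partial> i A x = transpose (\<partial> i A x)" .
  show ?thesis
    using arg_cong[OF e, of "\<lambda>M. M $ j $ k"] by (simp add: transpose_def)
qed

text \<open>One derivative of the Codazzi equation at a point where \<Gamma> vanishes and A is
  diagonal: of each product A \<Gamma> only the derivative of \<Gamma> survives, weighted by an
  eigenvalue.\<close>

lemma codazzi_second_derivative:
  fixes A :: "real^'n \<Rightarrow> real^'n^'n"
  assumes x: "x \<in> S" and \<Gamma>0: "\<And>i. \<Gamma> i x = 0" and A: "smooth_on S A"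
    and cod: "\<And>y i j k. y \<in> S \<Longrightarrow> cotton A y i j k = 0"
    and diag: "\<And>i j. A x $ i $ j = (if i = j then \<mu> i else 0)"
  shows "\<partial> k (\<partial> k A) x $ i $ i = \<partial> k (\<partial> i A) x $ k $ i
    + \<mu> i * \<partial> k (\<Gamma> k) x $ i $ i - \<mu> k * \<partial> k (\<Gamma> i) x $ k $ i"
proof -
  note dA = smooth_on_differentiable[OF A open_S x]
  note d1 = smooth_on_differentiable[OF smooth_on_partial_deriv[OF A] open_S x]
  note dP = differentiable_matrix_mult[OF dA differentiable_\<Gamma>[OF x]]
  note n1 = differentiable_nth[OF differentiable_nth[OF d1]] and nP = differentiable_nth[OF differentiable_nth[OF dP]]
  have "\<partial> k (\<partial> k A) x $ i $ i = \<partial> k (\<lambda>y. \<partial> k A y $ i $ i) x"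
    by (rule partial_deriv_nth_nth[OF d1, symmetric])
  also have "\<dots> = \<partial> k (\<lambda>y. \<partial> i A y $ k $ i + (A y ** \<Gamma> k y) $ i $ i - (A y ** \<Gamma> i y) $ k $ i) x"
  proof (rule partial_deriv_cong[OF open_S x])
    fix y assume "y \<in> S"
    then show "\<partial> k A y $ i $ i = \<partial> i A y $ k $ i + (A y ** \<Gamma> k y) $ i $ i - (A y ** \<Gamma> i y) $ k $ i"
      using cod[of y k i i] by (simp add: cotton_def)
  qed
  also have "\<dots> = \<partial> k (\<partial> i A) x $ k $ i
     + \<partial> k (\<lambda>y. A y ** \<Gamma> k y) x $ i $ i - \<partial> k (\<lambda>y. A y ** \<Gamma> i y) x $ k $ i"
    using partial_deriv_diff[OF differentiable_add[OF n1 nP] nP, of k]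
      partial_deriv_add[OF n1 nP, of k]
    by (simp add: partial_deriv_nth_nth[OF d1] partial_deriv_nth_nth[OF dP])
  finally have *: "\<partial> k (\<partial> k A) x $ i $ i = \<partial> k (\<partial> i A) x $ k $ i
     + \<partial> k (\<lambda>y. A y ** \<Gamma> k y) x $ i $ i - \<partial> k (\<lambda>y. A y ** \<Gamma> i y) x $ k $ i" .
  have prod: "\<partial> k (\<lambda>y. A y ** \<Gamma> j y) x $ l $ m = \<mu> l * \<partial> k (\<Gamma> j) x $ l $ m" for j l m
    by (simp add: partial_deriv_matrix_mult[OF dA differentiable_\<Gamma>[OF x]] \<Gamma>0 matrix_mult_nth[of "A x"] diag
        mult_delta_left)
  show ?thesis unfolding * prod ..
qed

text \<open>For each k the concavity of u is weighted by u - \<mu>_k and compared with the second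
  derivative of the constraint. After summation over k the Codazzi equation leaves only derivatives
  of \<Gamma>, and these assemble to curvature.\<close>

lemma bochner_at_maximum:
  fixes A :: "real^'n \<Rightarrow> real^'n^'n"
  assumes x: "x \<in> S" and G1: "G x = mat 1" and \<Gamma>0: "\<And>i. \<Gamma> i x = 0" and A: "smooth_on S A"
    and sym: "\<And>y. y \<in> S \<Longrightarrow> transpose (A y) = A y"
    and cod: "\<And>y i j k. y \<in> S \<Longrightarrow> cotton A y i j k = 0"
    and diag: "\<And>i j. A x $ i $ j = (if i = j then \<mu> i else 0)"
    and const: "\<And>y. y \<in> S \<Longrightarrow> (trace2 (G y) (A y))\<^sup>2 - normsq2 (G y) (A y) = c"
    and max: "\<And>y. y \<in> S \<Longrightarrow> trace2 (G y) (A y) \<le> trace2 (G x) (A x)"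
    and le: "\<And>i. \<mu> i \<le> trace2 (G x) (A x)"
  shows "(\<Sigma> k i. ((\<mu> i)\<^sup>2 - \<mu> i * \<mu> k) * Rm i k x $ i $ k) \<le> 0"
proof -
  \<comment> \<open>The mixed form of A: its plain trace is u and the trace of its square is |A|^2,
    so the metric enters second derivatives only through \<open>M\<close>.\<close>
  define M where "M y = H y ** A y" for y
  define u where "u y = trace (M y)" for y
  have sH: "smooth_on S H" by (rule smooth_G_inv)
  have sM: "smooth_on S M" unfolding M_def[abs_def] by (intro smooth_on_matrix_mult open_S sH A)
  have su: "smooth_on S u" unfolding u_def[abs_def] by (rule smooth_on_linear[OF open_S trace_linear sM])
  note dif = smooth_on_differentiable[OF _ open_S]
  note dH = dif[OF sH] and dM = dif[OF sM] and du = dif[OF su] and dA = dif[OF A]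
    and dH1 = dif[OF smooth_on_partial_deriv[OF sH]] and dM1 = dif[OF smooth_on_partial_deriv[OF sM]]
    and dA1 = dif[OF smooth_on_partial_deriv[OF A]] and du1 = dif[OF smooth_on_partial_deriv[OF su]]
  have H1: "H x = mat 1" by (rule matrix_inv_unique) (simp add: G1)
  have Hk: "\<partial> k H y = - (\<Gamma> k y ** H y) - H y ** transpose (\<Gamma> k y)" if "y \<in> S" for k y
    by (rule partial_deriv_G_inv[OF that])
  have Hk0: "\<partial> k H x = 0" for k
    unfolding Hk[OF x] \<Gamma>0 by (simp add: matrix_matrix_mult_def transpose_def vec_eq_iff)
  have Hkk: "\<partial> k (\<partial> k H) x = - \<partial> k (\<Gamma> k) x - transpose (\<partial> k (\<Gamma> k) x)" for k
  proof -
    note d\<Gamma> = differentiable_\<Gamma>[OF x]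
    have "\<partial> k (\<partial> k H) x = \<partial> k (\<lambda>y. - (\<Gamma> k y ** H y) - H y ** transpose (\<Gamma> k y)) x"
      by (rule partial_deriv_cong[OF open_S x Hk])
    also have "\<dots> = - \<partial> k (\<lambda>y. \<Gamma> k y ** H y) x - \<partial> k (\<lambda>y. H y ** transpose (\<Gamma> k y)) x"
      using partial_deriv_minus[OF differentiable_matrix_mult[OF d\<Gamma> dH[OF x]], of k k]
      by (simp add: partial_deriv_diff differentiable_matrix_mult differentiable_transpose d\<Gamma> dH[OF x])
    finally show ?thesis
      by (simp add: partial_deriv_matrix_mult differentiable_transpose d\<Gamma> dH[OF x] partial_deriv_transpose Hk0 H1 \<Gamma>0
          matrix_matrix_mult_def[of 0] matrix_matrix_mult_def[of _ 0] zero_vec_def[symmetric])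
  qed
  have M1: "\<partial> k M y = H y ** \<partial> k A y + \<partial> k H y ** A y" if "y \<in> S" for k y
    unfolding M_def[abs_def] by (rule partial_deriv_matrix_mult[OF dH[OF that] dA[OF that]])
  have zl: "(0::real^'n^'n) ** X = 0" and zr: "X ** (0::real^'n^'n) = 0" for X :: "real^'n^'n"
    by (simp_all add: matrix_matrix_mult_def vec_eq_iff)
  have M1x: "\<partial> k M x = \<partial> k A x" for k
    by (simp add: M1[OF x] H1 Hk0 zl)
  have M2x: "\<partial> k (\<partial> k M) x = \<partial> k (\<partial> k A) x + \<partial> k (\<partial> k H) x ** A x" for k
  proof -
    have "\<partial> k (\<partial> k M) x = \<partial> k (\<lambda>y. H y ** \<partial> k A y + \<partial> k H y ** A y) x"
      by (rule partial_deriv_cong[OF open_S x M1])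
    then show ?thesis
      by (simp add: partial_deriv_add partial_deriv_matrix_mult differentiable_matrix_mult
          dH[OF x] dH1[OF x] dA[OF x] dA1[OF x] H1 Hk0 zl zr)
  qed
  have Mx: "M x = A x" by (simp add: M_def H1)
  define a where "a k i = \<partial> k (\<partial> k A) x $ i $ i" for k i
  define d where "d i k = \<partial> i (\<Gamma> k) x $ i $ k" for i k
  define f where "f k i = \<partial> k (\<Gamma> k) x $ i $ i" for k i
  \<comment> \<open>The i-th diagonal entry of the second derivative of \<open>M\<close> in
    direction k. The correction by f comes from the second derivative of the inverse metric, whose
    first derivative vanishes at x.\<close>
  define D where "D k i = a k i - 2 * f k i * \<mu> i" for k i
  have M2d: "\<partial> k (\<partial> k M) x $ i $ i = D k i" for k i
  proof -
    have "(X ** A x) $ i $ i = X $ i $ i * \<mu> i" for X :: "real^'n^'n"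
      by (simp add: matrix_mult_nth diag mult_delta_right)
    then show ?thesis
      unfolding M2x Hkk by (simp add: transpose_def D_def a_def f_def algebra_simps)
  qed
  have u1: "\<partial> k u y = trace (\<partial> k M y)" if "y \<in> S" for k y
    unfolding u_def[abs_def] by (rule partial_deriv_linear[OF trace_linear dM[OF that]])
  have u2: "\<partial> k (\<partial> k u) x = (\<Sigma> i. D k i)" for k
  proof -
    have "\<partial> k (\<partial> k u) x = \<partial> k (\<lambda>y. trace (\<partial> k M y)) x"
      by (rule partial_deriv_cong[OF open_S x u1])
    also have "\<dots> = trace (\<partial> k (\<partial> k M) x)"
      by (rule partial_deriv_linear[OF trace_linear dM1[OF x]])
    finally show ?thesis by (simp add: trace_def M2d)
  qed
  have u_eq: "trace2 (G y) (A y) = u y" if "y \<in> S" for y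
    by (simp add: trace2_eq[OF that] u_def M_def)
  have umax: "u y \<le> u x" if "y \<in> S" for y using max[OF that] u_eq that x by simp
  note uk = interior_max_derivatives[OF open_S su x umax]
  have const': "u y * u y - trace (M y ** M y) = c" if "y \<in> S" for y
    using const[OF that] unfolding u_eq[OF that] normsq2_eq_trace[OF spd_G[OF that] sym[OF that]]
    by (simp add: M_def power2_eq_square)
  \<comment> \<open>Differentiating u^2 - tr(M^2) = c twice, with du = 0 at x, gives u u_kk = tr(M
    M_kk) + tr((d_k A)^2). The last trace is the k-th part of |\<nabla>A|^2; only its sign is
    kept.\<close>
  have key: "u x * (\<Sigma> i. D k i) \<ge> (\<Sigma> i. \<mu> i * D k i)" for k
  proof -
    have e1: "u y * \<partial> k u y - trace (M y ** \<partial> k M y) = 0" if y: "y \<in> S" for y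
    proof -
      have "\<partial> k (\<lambda>y. u y * u y - trace (M y ** M y)) y = \<partial> k (\<lambda>y. c) y"
        by (rule partial_deriv_cong[OF open_S y const'])
      moreover have "\<partial> k (\<lambda>y. u y * u y - trace (M y ** M y)) y =
         \<partial> k (\<lambda>y. u y * u y) y - \<partial> k (\<lambda>y. trace (M y ** M y)) y"
        by (intro partial_deriv_diff differentiable_mult differentiable_linear[OF trace_linear]
            differentiable_matrix_mult dM y du)
      moreover have "\<partial> k (\<lambda>y. trace (M y ** M y)) y = trace (M y ** \<partial> k M y + \<partial> k M y ** M y)"
        by (simp add: partial_deriv_linear[OF trace_linear] differentiable_matrix_mult dM[OF y] partial_deriv_matrix_mult)
      moreover have "\<partial> k (\<lambda>y. u y * u y) y = 2 * (u y * \<partial> k u y)"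
        using partial_deriv_bilinear[OF bounded_bilinear_mult du[OF y] du[OF y], of k] by simp
      ultimately show ?thesis
        using trace_mul_sym[of "\<partial> k M y" "M y"] by (simp add: trace_add)
    qed
    have "\<partial> k (\<lambda>y. u y * \<partial> k u y - trace (M y ** \<partial> k M y)) x = \<partial> k (\<lambda>y. 0::real) x"
      by (rule partial_deriv_cong[OF open_S x e1])
    moreover have "\<partial> k (\<lambda>y. u y * \<partial> k u y - trace (M y ** \<partial> k M y)) x
       = \<partial> k (\<lambda>y. u y * \<partial> k u y) x - \<partial> k (\<lambda>y. trace (M y ** \<partial> k M y)) x"
      by (intro partial_deriv_diff differentiable_mult differentiable_linear[OF trace_linear]
          differentiable_matrix_mult dM x du du1 dM1)
    moreover have "\<partial> k (\<lambda>y. u y * \<partial> k u y) x = u x * (\<Sigma> i. D k i)"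
      using partial_deriv_bilinear[OF bounded_bilinear_mult du[OF x] du1[OF x], of k k] by (simp add: uk(1) u2)
    moreover have "\<partial> k (\<lambda>y. trace (M y ** \<partial> k M y)) x
       = trace (A x ** \<partial> k (\<partial> k M) x) + trace (\<partial> k A x ** \<partial> k A x)"
      using partial_deriv_linear[OF trace_linear differentiable_matrix_mult[OF dM[OF x] dM1[OF x]], of k k]
      by (simp add: partial_deriv_matrix_mult dM[OF x] dM1[OF x] trace_add M1x Mx)
    moreover have "trace (A x ** \<partial> k (\<partial> k M) x) = (\<Sigma> i. \<mu> i * D k i)"
      by (simp add: trace_def matrix_mult_nth[of "A x"] diag if_distrib[of "\<lambda>c. c * _"] M2d cong: if_cong)
    moreover have "trace (\<partial> k A x ** \<partial> k A x) \<ge> 0"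
      by (rule trace_square_symmetric_nonneg) (rule partial_deriv_sym_matrix[OF A sym x])
    ultimately show ?thesis by simp
  qed
  \<comment> \<open>Here the nonpositive second derivative u_kk meets the nonnegative weight u -
    \<mu>_k.\<close>
  have "(\<Sigma> i. \<mu> i * D k i) \<le> \<mu> k * (\<Sigma> i. D k i)" for k
  proof -
    have "(u x - \<mu> k) * (\<Sigma> i. D k i) \<le> 0"
      using le[of k] uk(2)[of k] u_eq[OF x] u2[of k] by (simp add: mult_nonneg_nonpos)
    then show ?thesis using key[of k] by (simp add: left_diff_distrib)
  qed
  then have "(\<Sigma> k i. \<mu> i * D k i) \<le> (\<Sigma> k. \<mu> k * (\<Sigma> i. D k i))"
    by (rule sum_mono)
  then have 1: "(\<Sigma> k i. \<mu> i * D k i - \<mu> k * D k i) \<le> 0"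
    by (simp add: sum_subtractf sum_distrib_left)
  have swap: "(\<Sigma> k i. g k i) = (\<Sigma> k i. g i k)" for g :: "'n \<Rightarrow> 'n \<Rightarrow> real"
    by (rule sum.swap)
  \<comment> \<open>Two instances of the differentiated Codazzi equation with i and k exchanged.
    Their mixed second derivatives of A agree by symmetry of A and commuting partial derivatives, so
    the difference contains only \<Gamma>.\<close>
  have cod2: "a k i - a i k = \<mu> i * (f k i + d i k) - \<mu> k * (d k i + f i k)" for k i
  proof -
    have "\<partial> k (\<partial> i A) x $ k $ i = \<partial> i (\<partial> k A) x $ i $ k"
    proof -
      have s: "\<partial> i (\<lambda>y. \<partial> k A y $ k $ i) x = \<partial> i (\<lambda>y. \<partial> k A y $ i $ k) x"
        by (rule partial_deriv_cong[OF open_S x partial_deriv_sym_matrix[OF A sym]])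
      show ?thesis
        using s by (simp add: partial_deriv_nth_nth[OF dA1[OF x]] partial_deriv_commute[OF open_S A x, of k i])
    qed
    then show ?thesis
      using codazzi_second_derivative[OF x \<Gamma>0 A cod diag, of k i] codazzi_second_derivative[OF x \<Gamma>0 A cod diag, of i k]
      by (simp add: a_def f_def d_def algebra_simps)
  qed
  have K: "Rm i k x $ i $ k = d i k - f k i" for i k
  proof -
    have "\<partial> k (\<lambda>y. \<Gamma> i y $ i $ k) x = \<partial> k (\<lambda>y. \<Gamma> k y $ i $ i) x"
      by (rule partial_deriv_cong[OF open_S x \<Gamma>_sym])
    then show ?thesis
      by (simp add: Rm_eq[OF x] \<Gamma>0 zl d_def f_def partial_deriv_nth_nth[OF differentiable_\<Gamma>[OF x]])
  qed
  \<comment> \<open>Renaming the summation indices pairs a k i with a i k, so that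
    \<open>cod2\<close> eliminates all second derivatives of A. A second renaming collects d i k - f
    k i, which is the sectional curvature by \<open>K\<close>.\<close>
  have "(\<Sigma> k i. \<mu> i * D k i - \<mu> k * D k i) = (\<Sigma> k i. \<mu> i * a k i) - (\<Sigma> k i. \<mu> k * a k i)
       + (\<Sigma> k i. 2 * f k i * (\<mu> i * \<mu> k - (\<mu> i)\<^sup>2))"
    unfolding sum.distrib[symmetric] sum_subtractf[symmetric]
    by (intro sum.cong refl) (simp add: D_def algebra_simps power2_eq_square)
  also have "(\<Sigma> k i. \<mu> k * a k i) = (\<Sigma> k i. \<mu> i * a i k)"
    by (rule swap)
  also have "(\<Sigma> k i. \<mu> i * a k i) - (\<Sigma> k i. \<mu> i * a i k)
       + (\<Sigma> k i. 2 * f k i * (\<mu> i * \<mu> k - (\<mu> i)\<^sup>2))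
     = (\<Sigma> k i. (\<mu> i)\<^sup>2 * (d i k - f k i) + 2 * (\<mu> i * \<mu> k * f k i))
       - (\<Sigma> k i. \<mu> i * \<mu> k * (d k i + f i k))"
  proof -
    have "\<mu> i * a k i - \<mu> i * a i k = \<mu> i * (\<mu> i * (f k i + d i k) - \<mu> k * (d k i + f i k))" for k i
      unfolding cod2[symmetric] by (simp add: right_diff_distrib)
    then have "\<mu> i * a k i - \<mu> i * a i k + 2 * f k i * (\<mu> i * \<mu> k - (\<mu> i)\<^sup>2)
      = (\<mu> i)\<^sup>2 * (d i k - f k i) + 2 * (\<mu> i * \<mu> k * f k i) - \<mu> i * \<mu> k * (d k i + f i k)" for k i
      by (simp add: algebra_simps power2_eq_square)
    then show ?thesis
      unfolding sum.distrib[symmetric] sum_subtractf[symmetric] by simp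
  qed
  also have "(\<Sigma> k i. \<mu> i * \<mu> k * (d k i + f i k)) = (\<Sigma> k i. \<mu> k * \<mu> i * (d i k + f k i))"
    by (rule swap)
  also have "(\<Sigma> k i. (\<mu> i)\<^sup>2 * (d i k - f k i) + 2 * (\<mu> i * \<mu> k * f k i)) - \<dots>
     = (\<Sigma> k i. ((\<mu> i)\<^sup>2 - \<mu> i * \<mu> k) * Rm i k x $ i $ k)"
    unfolding sum_subtractf[symmetric] K by (simp add: algebra_simps)
  finally show ?thesis using 1 by simp
qed

end

section \<open>Normal coordinates\<close>

lemma partial_deriv_matrix_vector:
  fixes P :: "real^'n^'m"
  shows "\<partial> k (\<lambda>y. P *v y) y = column k P"
  by (subst partial_deriv_eq[OF bounded_linear_imp_has_derivative[OF matrix_vector_mul_bounded_linear]])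
    (simp add: matrix_vector_mul_component matrix_vector_mult_basis)

lemma smooth_on_matrix_vector:
  fixes P :: "real^'n^'m" and S :: "(real^'n) set"
  assumes "open S"
  shows "smooth_on S (\<lambda>y. P *v y)"
  by (rule smooth_on_linear[OF assms matrix_vector_mul_bounded_linear smooth_on_id])

lemma partial_deriv_coordinate:
  "\<partial> k (\<lambda>y::real^'n. y $ i) y = (if i = k then 1 else 0)"
  by (subst partial_deriv_eq[OF bounded_linear_imp_has_derivative[OF bounded_linear_vec_nth]])
    (simp add: axis_def)

lemma smooth_quadratic:
  fixes P :: "real^'n^'n" and Q :: "'n \<Rightarrow> 'n \<Rightarrow> real^'n" and S :: "(real^'n) set" and x0 y :: "real^'n" and k :: 'n
  assumes S: "open S" and sym: "\<And>i j. Q i j = Q j i"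
  defines "F \<equiv> \<lambda>y. x0 + P *v y - (1/2) *\<^sub>R (\<Sigma> i j. (y $ i * y $ j) *\<^sub>R Q i j)"
  shows "smooth_on S F" and "\<partial> k F y = column k P - (\<Sigma> j. y $ j *\<^sub>R Q k j)"
proof -
  have sm: "smooth_on S F" if "open S" for S
    unfolding F_def
    by (intro smooth_on_diff smooth_on_add smooth_on_const smooth_on_scaleR smooth_on_sum smooth_on_mult
        smooth_on_nth smooth_on_id smooth_on_matrix_vector that)
  show "smooth_on S F" by (rule sm[OF S])
  let ?q = "\<lambda>i j y. (y $ i * y $ j) *\<^sub>R Q i j"
  have dn: "(\<lambda>y::real^'n. y $ i) differentiable (at y)" for i
    by (rule bounded_linear_imp_differentiable[OF bounded_linear_vec_nth])
  have dm: "(\<lambda>y::real^'n. y $ i * y $ j) differentiable (at y)" for i j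
    by (intro differentiable_mult dn)
  have dq: "?q i j differentiable (at y)" for i j
    by (rule differentiable_linear[OF bounded_linear_scaleR_left dm])
  have ds: "(\<lambda>y. \<Sigma> j. ?q i j y) differentiable (at y)" for i
    by (intro differentiable_sum ballI finite dq)
  have dss: "(\<lambda>y. \<Sigma> i j. ?q i j y) differentiable (at y)"
    by (intro differentiable_sum ballI finite ds)
  have dP: "(\<lambda>y. P *v y) differentiable (at y)"
    by (rule bounded_linear_imp_differentiable[OF matrix_vector_mul_bounded_linear])
  have d1: "(\<lambda>y. x0 + P *v y) differentiable (at y)" by (intro differentiable_add dP) simp
  have pq: "\<partial> k (?q i j) y = (if i = k then y $ j *\<^sub>R Q i j else 0) + (if j = k then y $ i *\<^sub>R Q i j else 0)" for i j
  proof -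
    have "\<partial> k (\<lambda>y::real^'n. y $ i * y $ j) y = y $ i * (if j = k then 1 else 0) + (if i = k then 1 else 0) * y $ j"
      using partial_deriv_bilinear[OF bounded_bilinear_mult dn dn] by (simp add: partial_deriv_coordinate)
    then show ?thesis
      by (simp add: partial_deriv_linear[OF bounded_linear_scaleR_left dm] scaleR_add_left)
  qed
  have "\<partial> k (\<lambda>y. \<Sigma> i j. ?q i j y) y = (\<Sigma> i j. \<partial> k (?q i j) y)"
    by (simp add: partial_deriv_sum ds dq)
  also have "\<dots> = (\<Sigma> i j. (if i = k then y $ j *\<^sub>R Q i j else 0)) + (\<Sigma> i j. (if j = k then y $ i *\<^sub>R Q i j else 0))"
    unfolding pq by (simp add: sum.distrib)
  also have "(\<Sigma> i j. (if i = k then y $ j *\<^sub>R Q i j else 0)) = (\<Sigma> j. y $ j *\<^sub>R Q k j)"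
    by (subst sum.swap) simp
  also have "(\<Sigma> i j. (if j = k then y $ i *\<^sub>R Q i j else 0)) = (\<Sigma> j. y $ j *\<^sub>R Q k j)"
    by (simp add: sym[of _ k])
  finally have pss: "\<partial> k (\<lambda>y. \<Sigma> i j. ?q i j y) y = 2 *\<^sub>R (\<Sigma> j. y $ j *\<^sub>R Q k j)"
    by (simp add: scaleR_2)
  have "\<partial> k F y = \<partial> k (\<lambda>y. x0 + P *v y) y - \<partial> k (\<lambda>y. (1/2) *\<^sub>R (\<Sigma> i j. ?q i j y)) y"
    unfolding F_def by (intro partial_deriv_diff d1 differentiable_linear[OF bounded_linear_scaleR_right dss])
  also have "\<partial> k (\<lambda>y. x0 + P *v y) y = column k P"
    using partial_deriv_add[of "\<lambda>y. x0" y "\<lambda>y. P *v y" k] dP by (simp add: partial_deriv_matrix_vector)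
  also have "\<partial> k (\<lambda>y. (1/2) *\<^sub>R (\<Sigma> i j. ?q i j y)) y = (\<Sigma> j. y $ j *\<^sub>R Q k j)"
    by (simp add: partial_deriv_linear[OF bounded_linear_scaleR_right dss] pss)
  finally show "\<partial> k F y = column k P - (\<Sigma> j. y $ j *\<^sub>R Q k j)" .
qed

text \<open>Restricting to points where \<open>F\<close> stays in \<open>S\<close> and its Jacobian
  is invertible keeps the pulled-back form positive definite; the restricted domain is open by
  continuity of \<open>F\<close> and of the determinant.\<close>

lemma (in metric_field) pullback_metric:
  fixes F :: "real^'n \<Rightarrow> real^'n"
  assumes F: "smooth_on UNIV F"
  defines "U \<equiv> {y. F y \<in> S \<and> det (jacobian F (at y)) \<noteq> 0}"
  defines "G' \<equiv> \<lambda>y. transpose (jacobian F (at y)) ** G (F y) ** jacobian F (at y)"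
  shows "metric_pullback U G' S G F"
proof -
  let ?J = "\<lambda>y. jacobian F (at y)"
  have J: "?J = (\<lambda>y. \<chi> a i. \<partial> i F y $ a)"
    by (simp add: fun_eq_iff vec_eq_iff jacobian_def matrix_def partial_deriv_def)
  have sJ: "smooth_on UNIV ?J"
    unfolding J by (intro smooth_on_vec_lambda smooth_on_nth smooth_on_partial_deriv F open_UNIV)
  have oU: "open U"
  proof -
    have "open (F -` S)"
      using smooth_on_continuous[OF F] open_S by (simp add: continuous_on_open_vimage)
    moreover have "open ((\<lambda>y. det (?J y)) -` (- {0}))"
      using smooth_on_continuous[OF smooth_on_det[OF open_UNIV sJ]] by (simp add: continuous_on_open_vimage open_delete Compl_eq_Diff_UNIV)
    moreover have "U = F -` S \<inter> (\<lambda>y. det (?J y)) -` (- {0})" by (auto simp: U_def)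
    ultimately show ?thesis by auto
  qed
  have sF: "smooth_on U F" and sJU: "smooth_on U ?J" using smooth_on_subset[OF F] smooth_on_subset[OF sJ] by auto
  have im: "F ` U \<subseteq> S" by (auto simp: U_def)
  have sG: "smooth_on U G'"
    unfolding G'_def
    by (intro smooth_on_matrix_mult smooth_on_transpose smooth_on_compose[OF oU open_S im smooth_G sF] oU sJU)
  have "metric_field U G'"
  proof
    show "open U" "smooth_on U G'" by fact+
    fix y assume y: "y \<in> U"
    then have yS: "F y \<in> S" by (auto simp: U_def)
    show "transpose (G' y) = G' y"
      by (simp add: G'_def matrix_transpose_mul sym_G[OF yS] matrix_mul_assoc)
    fix v :: "real^'n" assume v: "v \<noteq> 0"
    have Jv: "?J y *v v \<noteq> 0"
    proof
      assume z: "?J y *v v = 0"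
      have "matrix_inv (?J y) *v (?J y *v v) = v"
        using y by (simp add: U_def matrix_vector_mul_assoc matrix_inv)
      then show False using z v by simp
    qed
    have "v \<bullet> (G' y *v v) = (?J y *v v) \<bullet> (G (F y) *v (?J y *v v))"
    proof -
      have "G' y *v v = transpose (?J y) *v (G (F y) *v (?J y *v v))"
        by (simp add: G'_def matrix_vector_mul_assoc matrix_mul_assoc)
      then show ?thesis
        by (metis dot_lmul_matrix inner_commute transpose_matrix_vector transpose_transpose)
    qed
    then show "v \<bullet> (G' y *v v) > 0" using pos_G[OF yS Jv] by simp
  qed
  then show ?thesis
    using metric_field_axioms sF im by (simp add: metric_pullback_def metric_pullback_axioms_def G'_def)
qed

text \<open>The quadratic term of the coordinate change is chosen so that the Hessian cancels the pulled-back
  connection in the gauge law \<open>connection_transform\<close>.\<close>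

lemma (in metric_field) normal_coordinates:
  assumes x0: "x0 \<in> S" and e: "orthonormal_frame (G x0) e"
  obtains U G' F where "metric_pullback U G' S G F" "0 \<in> U" "F 0 = x0"
    "metric_pullback.J F 0 = frame_matrix e" "G' 0 = mat 1" "\<And>i. connection_matrix G' i 0 = 0"
proof -
  let ?P = "frame_matrix e"
  define Q where "Q i j = (\<chi> a. (\<Sigma> b c. ?P $ b $ i * \<Gamma> b x0 $ a $ c * ?P $ c $ j))" for i j
  have Qs: "Q i j = Q j i" for i j
  proof -
    have "Q i j $ a = Q j i $ a" for a
      unfolding Q_def vec_lambda_beta
      by (subst sum.swap, rule sum.cong[OF refl], rule sum.cong[OF refl]) (simp add: \<Gamma>_sym[OF x0] mult_ac)
    then show ?thesis by (simp add: vec_eq_iff)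
  qed
  \<comment> \<open>Since Q is symmetric, the factor 1/2 makes the derivative of the Jacobian at 0
    exactly -Q, while Q is the pulled-back connection at 0 expressed in the frame e.\<close>
  define F where "F y = x0 + ?P *v y - (1/2) *\<^sub>R (\<Sigma> i j. (y $ i * y $ j) *\<^sub>R Q i j)" for y
  have sF: "smooth_on UNIV F"
    unfolding F_def[abs_def] by (rule smooth_quadratic(1)[OF open_UNIV Qs])
  have pF: "\<partial> k F y = column k ?P - (\<Sigma> j. y $ j *\<^sub>R Q k j)" for k y
    unfolding F_def[abs_def] by (rule smooth_quadratic(2)[OF open_UNIV Qs])
  define U where "U = {y. F y \<in> S \<and> det (jacobian F (at y)) \<noteq> 0}"
  define G' where "G' y = transpose (jacobian F (at y)) ** G (F y) ** jacobian F (at y)" for y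
  have mp: "metric_pullback U G' S G F"
    unfolding U_def G'_def[abs_def] by (rule pullback_metric[OF sF])
  then interpret p: metric_pullback U G' S G F .
  have F0: "F 0 = x0" by (simp add: F_def)
  have Jn: "p.J y $ a $ k = ?P $ a $ k - (\<Sigma> j. y $ j * Q k j $ a)" for y a k
    unfolding p.J_nth pF by (simp add: column_def)
  have J0: "p.J 0 = ?P" by (simp add: vec_eq_iff Jn)
  have G1: "transpose ?P ** G x0 ** ?P = mat 1" using e by (simp add: orthonormal_frame_matrix)
  have "det ?P \<noteq> 0"
  proof
    assume "det ?P = 0"
    then have "det (transpose ?P ** G x0 ** ?P) = 0" by (simp add: det_mul)
    then show False by (simp add: G1)
  qed
  then have U0: "0 \<in> U" using J0 x0 by (simp add: U_def F0 p.J_def)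
  have G'0: "G' 0 = mat 1" using p.G_J[OF U0] by (simp add: J0 F0 G1)
  have "connection_matrix G' i 0 = 0" for i
  proof -
    have dJ: "\<partial> i p.J 0 $ a $ k = - Q i k $ a" for a k
    proof -
      have dn: "(\<lambda>y::real^'n. y $ j) differentiable (at 0)" for j
        by (rule bounded_linear_imp_differentiable[OF bounded_linear_vec_nth])
      have dd: "(\<lambda>y::real^'n. y $ j * c) differentiable (at 0)" for j c
        by (rule differentiable_linear[OF bounded_linear_mult_left dn])
      have "\<partial> i p.J 0 $ a $ k = \<partial> i (\<lambda>y. p.J y $ a $ k) 0"
        by (rule partial_deriv_nth_nth[OF p.differentiable_J[OF U0], symmetric])
      also have "\<dots> = \<partial> i (\<lambda>y. ?P $ a $ k) 0 - \<partial> i (\<lambda>y. \<Sigma> j. y $ j * Q k j $ a) 0"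
        unfolding Jn by (intro partial_deriv_diff differentiable_sum ballI finite dd) simp
      also have "\<dots> = - (\<Sigma> j. \<partial> i (\<lambda>y. y $ j * Q k j $ a) 0)"
        using partial_deriv_sum[of UNIV "\<lambda>j y. y $ j * Q k j $ a" 0 i, OF dd] by simp
      also have "\<dots> = - Q k i $ a"
        by (simp add: partial_deriv_linear[OF bounded_linear_mult_left dn] partial_deriv_coordinate mult_delta_left)
      finally show ?thesis by (simp add: Qs[of k i])
    qed
    have "(p.pull_\<Gamma> i 0 ** p.J 0) $ a $ k = Q i k $ a" for a k
      unfolding p.pull_\<Gamma>_def J0 F0 mat_bilin
      by (simp add: Q_def matrix_mult_nth sum_distrib_left mult.assoc)
    then have "p.J 0 ** connection_matrix G' i 0 = 0"
      unfolding p.connection_transform[OF U0] by (simp add: vec_eq_iff dJ)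
    then have "matrix_inv (p.J 0) ** (p.J 0 ** connection_matrix G' i 0) = 0"
      by (simp add: matrix_matrix_mult_def vec_eq_iff)
    then show ?thesis using U0 by (simp add: matrix_mul_assoc)
  qed
  then show ?thesis using that[OF mp U0 F0 J0 G'0] by blast
qed

text \<open>Pullback of a covariant 4-tensor by the linear map J. For a frame matrix it gives the
  components in that frame; this is why the Weyl components at the origin of normal coordinates
  compute |W|^2 at the base point.\<close>

definition contract4 :: "real^'n^'n \<Rightarrow> 'n tensor4 \<Rightarrow> 'n tensor4" where
  "contract4 J T p q r s = (\<Sigma> i j k l. J $ i $ p * J $ j $ q * J $ k $ r * J $ l $ s * T i j k l)"

lemma contract4_diff: "contract4 J (\<lambda>i j k l. T i j k l - U i j k l) p q r s = contract4 J T p q r s - contract4 J U p q r s"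
  by (simp add: contract4_def right_diff_distrib sum_subtractf)

lemma contract4_cmult: "contract4 J (\<lambda>i j k l. c * T i j k l) p q r s = c * contract4 J T p q r s"
  by (simp add: contract4_def sum_distrib_left mult_ac)

lemma contract4_swap:
  "contract4 J (\<lambda>i j k l. T j i k l) p q r s = contract4 J T q p r s"
  "contract4 J (\<lambda>i j k l. T i j l k) p q r s = contract4 J T p q s r"
proof -
  show "contract4 J (\<lambda>i j k l. T j i k l) p q r s = contract4 J T q p r s"
    unfolding contract4_def by (subst sum.swap) (simp add: mult_ac)
  show "contract4 J (\<lambda>i j k l. T i j l k) p q r s = contract4 J T p q s r"
    unfolding contract4_def
    by (rule sum.cong[OF refl], rule sum.cong[OF refl], subst sum.swap) (simp add: mult_ac)
qed

lemma contract4_product: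
  fixes A B J :: "real^'n^'n"
  shows "contract4 J (\<lambda>i j k l. A $ i $ k * B $ j $ l) p q r s = (transpose J ** A ** J) $ p $ r * (transpose J ** B ** J) $ q $ s"
proof -
  have c: "(transpose J ** A ** J) $ p $ r = (\<Sigma> i k. J $ i $ p * (A $ i $ k * J $ k $ r))" for A :: "real^'n^'n" and p r
    unfolding matrix_mul_assoc[symmetric] transpose_mult_nth by (simp add: matrix_mult_nth sum_distrib_left)
  have "(\<Sigma> j k l. J $ i $ p * J $ j $ q * J $ k $ r * J $ l $ s * (A $ i $ k * B $ j $ l))
     = (\<Sigma> k j l. J $ i $ p * (A $ i $ k * J $ k $ r) * (J $ j $ q * (B $ j $ l * J $ l $ s)))" for i
    by (subst sum.swap) (simp add: mult_ac)
  then show ?thesis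
    unfolding contract4_def c by (simp add: sum_product) (simp add: sum_distrib_left sum_distrib_right mult_ac)
qed

lemma normsq4_contract4:
  assumes "orthonormal_frame G e"
  shows "normsq4 G T = (\<Sigma> p q r s. (contract4 (frame_matrix e) T p q r s)\<^sup>2)"
  unfolding normsq4_frame[OF assms] contract4_def frame_matrix_def
  by (simp add: sum_distrib_left mult.assoc)

context metric_pullback
begin

lemma riemann_transform:
  assumes x: "x \<in> S"
  shows "riemann G x p q r s = contract4 (J x) (riemann h (F x)) p q r s"
proof -
  have "G x ** src.Rm p q x = transpose (J x) ** h (F x) ** (J x ** src.Rm p q x)"
    by (simp add: G_J[OF x] matrix_mul_assoc)
  also have "\<dots> = (\<Sigma> a b. (J x $ a $ p * J x $ b $ q) *\<^sub>R (transpose (J x) ** ((h (F x) ** tgt.Rm a b (F x)) ** J x)))"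
    unfolding curvature_transform[OF x] pull_Rm_def mat_bilin by (simp add: matrix_mul_assoc)
  finally have "riemann G x p q r s = (\<Sigma> a b. J x $ a $ p * J x $ b $ q *
      (transpose (J x) ** ((h (F x) ** tgt.Rm a b (F x)) ** J x)) $ r $ s)"
    by (simp add: src.riemann_eq)
  moreover have "(transpose (J x) ** ((h (F x) ** tgt.Rm a b (F x)) ** J x)) $ r $ s
     = (\<Sigma> k l. J x $ k $ r * (riemann h (F x) a b k l * J x $ l $ s))" for a b
    unfolding transpose_mult_nth matrix_mult_nth[of "h (F x) ** tgt.Rm a b (F x)"] tgt.riemann_eq
    by (simp add: sum_distrib_left)
  ultimately show ?thesis
    by (simp add: contract4_def sum_distrib_left mult_ac)
qed

lemma kulkarni_transform:
  assumes x: "x \<in> S" and A: "A x = transpose (J x) ** B (F x) ** J x"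
  shows "src.kulkarni A x p q r s = contract4 (J x) (tgt.kulkarni B (F x)) p q r s"
proof -
  let ?T = "\<lambda>i j k l. h (F x) $ i $ k * B (F x) $ j $ l"
  let ?U = "\<lambda>i j k l. ?T i j k l - ?T i j l k"
  have T: "contract4 (J x) ?T p q r s = G x $ p $ r * A x $ q $ s" for p q r s
    by (simp only: contract4_product G_J[OF x] A)
  have U: "contract4 (J x) ?U p q r s = G x $ p $ r * A x $ q $ s - G x $ p $ s * A x $ q $ r" for p q r s
    using contract4_diff[of "J x" ?T "\<lambda>i j k l. ?T i j l k"] contract4_swap(2)[of "J x" ?T] by (simp add: T)
  have "contract4 (J x) (\<lambda>i j k l. ?U i j k l - ?U j i k l) p q r s = contract4 (J x) ?U p q r s - contract4 (J x) ?U q p r s"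
    using contract4_diff[of "J x" ?U "\<lambda>i j k l. ?U j i k l"] contract4_swap(1)[of "J x" ?U] by simp
  then show ?thesis
    unfolding U src.kulkarni_def tgt.kulkarni_def[abs_def] by simp
qed

lemma weyl_transform:
  assumes x: "x \<in> S" and n: "real CARD('n) > 2"
  shows "weyl G x p q r s = contract4 (J x) (weyl h (F x)) p q r s"
proof -
  have "contract4 (J x) (weyl h (F x)) p q r s = contract4 (J x) (\<lambda>i j k l. riemann h (F x) i j k l
      - 1 / (real CARD('n) - 2) * tgt.kulkarni (schouten h) (F x) i j k l) p q r s"
    by (simp only: contract4_def tgt.weyl_eq[OF n])
  also have "\<dots> = riemann G x p q r s - 1 / (real CARD('n) - 2) * src.kulkarni (schouten G) x p q r s"
    unfolding contract4_diff contract4_cmult riemann_transform[OF x] kulkarni_transform[where A="schouten G" and B="schouten h", OF x schouten_transform[OF x]] ..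
  finally show ?thesis by (simp only: src.weyl_eq[OF n])
qed

lemma normsq2_transform:
  assumes x: "x \<in> S" and A: "A = transpose (J x) ** B ** J x" and B: "transpose B = B"
  shows "normsq2 (G x) A = normsq2 (h (F x)) B"
proof -
  have As: "transpose A = A" by (simp add: A matrix_transpose_mul B matrix_mul_assoc)
  let ?M = "matrix_inv (h (F x)) ** B"
  have "(Ji x ** ?M ** J x) ** (Ji x ** ?M ** J x) = Ji x ** (?M ** (J x ** Ji x) ** ?M) ** J x"
    by (simp add: matrix_mul_assoc)
  also have "\<dots> = Ji x ** (?M ** ?M) ** J x"
    by (simp only: J_inv(1)[OF x] matrix_mul_rid)
  finally show ?thesis
    unfolding normsq2_eq_trace[OF src.spd_G[OF x] As] normsq2_eq_trace[OF tgt.spd_G[OF F_in[OF x]] B] raise_transform[OF x A]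
    by (simp only: trace_conj[OF x])
qed

end

section \<open>Vanishing of the trace-free Ricci tensor at a maximum\<close>

text \<open>K_ik = w_ik + (\<mu>_i + \<mu>_k)/(N-2) is the Weyl-Schouten decomposition of the
  sectional curvatures in an eigenframe. In terms of e_i = \<mu>_i - m, the zero row sums of w leave
  only its pairing with e_i e_k, and the vanishing sum of the e_i removes the linear terms.\<close>

lemma bochner_term_expansion:
  fixes \<mu> :: "'n::finite \<Rightarrow> real" and w :: "'n \<Rightarrow> 'n \<Rightarrow> real" and m :: real
  defines "N \<equiv> real CARD('n)"
  assumes N: "N > 2" and tr: "(\<Sigma> i. \<mu> i) = N * m"
    and w_diag: "\<And>i. w i i = 0" and w_sym: "\<And>i j. w i j = w j i" and w_sum: "\<And>i. (\<Sigma> j. w i j) = 0"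
  shows "(\<Sigma> k i. ((\<mu> i)\<^sup>2 - \<mu> i * \<mu> k) * (w i k + (if i = k then 0 else (\<mu> i + \<mu> k) / (N - 2))))
    = - (\<Sigma> i j. w i j * ((\<mu> i - m) * (\<mu> j - m))) + N / (N - 2) * (\<Sigma> i. (\<mu> i - m) ^ 3)
      + 2 * N * m / (N - 2) * (\<Sigma> i. (\<mu> i - m)\<^sup>2)"
proof -
  let ?T = "\<lambda>i k. ((\<mu> i)\<^sup>2 - \<mu> i * \<mu> k) * (w i k + (if i = k then 0 else (\<mu> i + \<mu> k) / (N - 2)))"
  define e where "e i = \<mu> i - m" for i
  define p2 where "p2 = (\<Sigma> i. (e i)\<^sup>2)"
  define p3 where "p3 = (\<Sigma> i. (e i) ^ 3)"
  have p1: "(\<Sigma> i. e i) = 0" by (simp add: e_def sum_subtractf tr N_def)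
  note w1 = weights_orthogonal(1)[OF w_sym w_sum] and w2 = weights_orthogonal(2)[OF w_sym w_sum]
  \<comment> \<open>This is \<open>((\<mu> i)\<^sup>2 - \<mu> i * \<mu> k) * (\<mu> i + \<mu>
    k)\<close> expanded in e. It vanishes for i = k, so the diagonal needs no separate sum.\<close>
  define Y where "Y i k = (e i) ^ 3 - e i * (e k)\<^sup>2 + 3 * m * (e i)\<^sup>2 - m * (e k)\<^sup>2 - 2 * m * (e i * e k)
         + 2 * m\<^sup>2 * e i - 2 * m\<^sup>2 * e k" for i k
  have t: "?T i k = w i k * ((e i)\<^sup>2 + m * e i) - w i k * (m * e k) - w i k * (e i * e k)
       + 1 / (N - 2) * Y i k" for i k
  proof (cases "i = k")
    case True
    have "e k * (e k)\<^sup>2 = e k ^ 3" by (simp add: power3_eq_cube power2_eq_square)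
    with True show ?thesis by (simp add: w_diag power2_eq_square Y_def)
  next
    case False
    have 1: "((\<mu> i)\<^sup>2 - \<mu> i * \<mu> k) * w i k = w i k * ((e i)\<^sup>2 + m * e i) - w i k * (m * e k) - w i k * (e i * e k)"
      unfolding e_def by algebra
    have "((\<mu> i)\<^sup>2 - \<mu> i * \<mu> k) * (\<mu> i + \<mu> k) = (e i) ^ 3 - e i * (e k)\<^sup>2 + 3 * m * (e i)\<^sup>2 - m * (e k)\<^sup>2 - 2 * m * (e i * e k)
         + 2 * m\<^sup>2 * e i - 2 * m\<^sup>2 * e k"
      unfolding e_def by algebra
    then show ?thesis using False 1 by (simp add: distrib_left Y_def)
  qed
  have "(\<Sigma> k i. ?T i k) = (\<Sigma> i k. ?T i k)"
    by (rule sum.swap)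
  also have "\<dots> = (\<Sigma> i k. w i k * ((e i)\<^sup>2 + m * e i)) - (\<Sigma> i k. w i k * (m * e k))
     - (\<Sigma> i k. w i k * (e i * e k))
     + 1 / (N - 2) * (\<Sigma> i k. Y i k)"
    unfolding t by (simp only: sum.distrib sum_subtractf sum_distrib_left[symmetric])
  also have "\<dots> = - (\<Sigma> i k. w i k * (e i * e k)) + 1 / (N - 2) * (N * p3 + 2 * N * m * p2)"
  proof -
    have "(\<Sigma> i k. Y i k) = N * p3 + 2 * N * m * p2"
      unfolding Y_def sum.distrib sum_subtractf sum_constant sum_distrib_left[symmetric] sum_distrib_right[symmetric]
        p1 p2_def[symmetric] p3_def[symmetric] N_def[symmetric]
      by (simp add: algebra_simps)
    then show ?thesis using w1[of "\<lambda>i. (e i)\<^sup>2 + m * e i"] w2[of "\<lambda>k. m * e k"] by simp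
  qed
  finally show ?thesis
    unfolding e_def[symmetric] p2_def[symmetric] p3_def[symmetric] by (simp add: add_divide_distrib)
qed

context metric_field
begin

lemma trace_schouten:
  assumes x: "x \<in> S" and n: "real CARD('n) > 2"
  shows "trace2 (G x) (schouten G x) = (real CARD('n) - 2) / (2 * (real CARD('n) - 1)) * scalar_curv G x"
  unfolding schouten_def normsq2_shift(2)[OF spd_G[OF x]] scalar_curv_def[symmetric]
  using n by (simp add: field_simps)

lemma sigma2_schouten:
  assumes x: "x \<in> S" and n: "real CARD('n) > 2"
  defines "N \<equiv> real CARD('n)"
  shows "2 * sigma2 (G x) (schouten G x) = (N - 2)\<^sup>2 / (4 * N * (N - 1)) * (scalar_curv G x)\<^sup>2 - normsq2 (G x) (tracefree_ricci G x)"
proof -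
  define R where "R = scalar_curv G x"
  define q where "q = normsq2 (G x) (ricci G x)"
  have tr: "trace2 (G x) (ricci G x) = R" by (simp add: R_def scalar_curv_def)
  have E: "normsq2 (G x) (tracefree_ricci G x) = q - R\<^sup>2 / N"
    unfolding tracefree_ricci_def normsq2_shift(1)[OF spd_G[OF x]] tr R_def[symmetric] q_def[symmetric] N_def[symmetric]
    using n by (simp add: N_def power2_eq_square field_simps)
  define c where "c = R / (2 * (N - 1))"
  have A: "normsq2 (G x) (schouten G x) = q - 2 * c * R + c\<^sup>2 * N" "trace2 (G x) (schouten G x) = R - c * N"
    unfolding schouten_def normsq2_shift[OF spd_G[OF x]] tr R_def[symmetric] q_def[symmetric] N_def[symmetric] c_def by simp_all
  have "2 * sigma2 (G x) (schouten G x) = (R - c * N)\<^sup>2 - (q - 2 * c * R + c\<^sup>2 * N)"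
    unfolding sigma2_eq[OF spd_G[OF x] schouten_transpose[OF x]] A ..
  also have "\<dots> = R\<^sup>2 - 2 * ((N - 1) * c) * R + N * c * ((N - 1) * c) - q" by algebra
  also have "(N - 1) * c = R / 2" using n by (simp add: c_def N_def field_simps)
  also have "R\<^sup>2 - 2 * (R / 2) * R + N * c * (R / 2) - q = N / (4 * (N - 1)) * R\<^sup>2 - q"
    by (simp add: c_def power2_eq_square)
  also have "\<dots> = (N - 2)\<^sup>2 / (4 * N * (N - 1)) * R\<^sup>2 - (q - R\<^sup>2 / N)"
  proof -
    have "N / (4 * (N - 1)) = (N - 2)\<^sup>2 / (4 * N * (N - 1)) + 1 / N"
      using n by (simp add: N_def power2_eq_square field_simps)
    then show ?thesis by (simp add: distrib_right)
  qed
  finally show ?thesis by (simp add: E R_def)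
qed

text \<open>Normal coordinates adapted to an eigenframe of the Schouten tensor bring the Bochner
  inequality and the pinching estimate to the same point; the first makes the curvature sum
  nonpositive, the second makes it positive unless E vanishes there.\<close>

lemma tracefree_ricci_0_at_maximum:
  assumes x0: "x0 \<in> S" and n: "CARD('n) \<ge> 4"
    and cot: "\<And>y i j k. y \<in> S \<Longrightarrow> cotton (schouten G) y i j k = 0"
    and const: "\<And>y. y \<in> S \<Longrightarrow> sigma2 (G y) (schouten G y) = s" and s: "s > 0"
    and R: "scalar_curv G x0 > 0" and max: "\<And>y. y \<in> S \<Longrightarrow> scalar_curv G y \<le> scalar_curv G x0"
    and pinch: "normsq4 (G x0) (weyl G x0)
           + 2 * real CARD('n) ^ 2 * (real CARD('n) - 4) / (real CARD('n) - 2) ^ 3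
             * normsq2 (G x0) (tracefree_ricci G x0)
           < 16 * real CARD('n) / (real CARD('n) - 2) ^ 3 * sigma2 (G x0) (schouten G x0)"
  shows "normsq2 (G x0) (tracefree_ricci G x0) = 0"
proof -
  define N where "N = real CARD('n)"
  define R where "R = scalar_curv G x0"
  \<comment> \<open>The mean of the eigenvalues of A, so that the \<mu>_i - m are the eigenvalues of
    the trace-free Ricci tensor.\<close>
  define m where "m = R * (N - 2) / (2 * N * (N - 1))"
  have N2: "N > 2" "real CARD('n) > 2" using n by (auto simp: N_def)
  have Rpos: "R > 0" using R by (simp add: R_def)
  obtain e \<mu> where e: "orthonormal_frame (G x0) e" and ev: "\<And>a. schouten G x0 *v e a = \<mu> a *\<^sub>R (G x0 *v e a)"
    using eigenframe_exists[OF spd_G[OF x0] schouten_transpose[OF x0]] by metis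
  have form: "e a \<bullet> (schouten G x0 *v e b) = (if a = b then \<mu> a else 0)" for a b
    using e by (simp add: ev orthonormal_frame_def)
  obtain U G' F where "metric_pullback U G' S G F" and U0: "0 \<in> U" and F0: "F 0 = x0"
    and J0: "metric_pullback.J F 0 = frame_matrix e" and G0: "G' 0 = mat 1" and \<Gamma>0: "\<And>i. connection_matrix G' i 0 = 0"
    using normal_coordinates[OF x0 e] by metis
  then interpret p: metric_pullback U G' S G F by simp
  note FS = p.F_in
  have A0: "schouten G' 0 $ i $ j = (if i = j then \<mu> i else 0)" for i j
    unfolding p.schouten_transform[OF U0] J0 F0 frame_matrix_congruence form ..
  have tr': "trace2 (G' y) (schouten G' y) = (N - 2) / (2 * (N - 1)) * scalar_curv G (F y)" if "y \<in> U" for y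
    unfolding p.src.trace_schouten[OF that N2(2)] p.scalar_transform[OF that] N_def ..
  have trx: "trace2 (G x0) (schouten G x0) = N * m"
    unfolding trace_schouten[OF x0 N2(2)] using N2 by (simp add: m_def R_def N_def[symmetric])
  have tr0: "trace2 (G' 0) (schouten G' 0) = N * m"
    unfolding tr'[OF U0] F0 using N2 by (simp add: m_def R_def)
  have tr_\<mu>: "(\<Sigma> i. \<mu> i) = N * m"
    using trx unfolding trace2_frame[OF e] form by simp
  have Nm: "N * m > 0" using N2 Rpos by (simp add: m_def)
  \<comment> \<open>Each \<mu>_i^2 is at most |A|^2 = u^2 - 2s, and s > 0 while u = N m is
    positive.\<close>
  have le: "\<mu> i \<le> trace2 (G' 0) (schouten G' 0)" for i
  proof -
    have "2 * s = (trace2 (G x0) (schouten G x0))\<^sup>2 - normsq2 (G x0) (schouten G x0)"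
      using sigma2_eq[OF spd_G[OF x0] schouten_transpose[OF x0]] const[OF x0] by simp
    moreover have "normsq2 (G x0) (schouten G x0) = (\<Sigma> i. (\<mu> i)\<^sup>2)"
      by (simp add: normsq2_frame[OF e] form if_distrib[of "\<lambda>x. x\<^sup>2"] cong: if_cong)
    moreover have "(\<mu> i)\<^sup>2 \<le> (\<Sigma> i. (\<mu> i)\<^sup>2)" by (rule member_le_sum) auto
    ultimately have "(\<mu> i)\<^sup>2 \<le> (N * m)\<^sup>2" using s unfolding trx by linarith
    then show ?thesis unfolding tr0 by (rule power2_le_imp_le) (use Nm in linarith)
  qed
  have boch: "(\<Sigma> k i. ((\<mu> i)\<^sup>2 - \<mu> i * \<mu> k) * p.src.Rm i k 0 $ i $ k) \<le> 0"
  proof (rule p.src.bochner_at_maximum[OF U0 G0 \<Gamma>0 p.src.smooth_schouten p.src.schouten_transpose _ A0 _ _ le])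
    fix y i j k assume y: "y \<in> U"
    show "p.src.cotton (schouten G') y i j k = 0"
      by (rule p.cotton_transform[OF p.schouten_transform y differentiable_schouten[OF FS[OF y]] cot[OF FS[OF y]]])
  next
    fix y assume y: "y \<in> U"
    show "(trace2 (G' y) (schouten G' y))\<^sup>2 - normsq2 (G' y) (schouten G' y) = 2 * s"
      unfolding p.trace2_transform[OF y p.schouten_transform[OF y]]
        p.normsq2_transform[OF y p.schouten_transform[OF y] schouten_transpose[OF FS[OF y]]]
      using sigma2_eq[OF spd_G[OF FS[OF y]] schouten_transpose[OF FS[OF y]]] const[OF FS[OF y]] by simp
    show "trace2 (G' y) (schouten G' y) \<le> trace2 (G' 0) (schouten G' 0)"
      unfolding tr'[OF y] tr'[OF U0] F0
      by (rule mult_left_mono[OF max[OF FS[OF y]]]) (use N2 in simp)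
  qed
  define K where "K i k = p.src.Rm i k 0 $ i $ k" for i k
  define w where "w i k = weyl G' 0 i k i k" for i k
  have rie: "riemann G' 0 i j k l = p.src.Rm i j 0 $ k $ l" for i j k l
    by (simp add: p.src.riemann_eq G0)
  have kul: "p.src.kulkarni (schouten G') 0 i k i k = (if i = k then 0 else \<mu> i + \<mu> k)" for i k
    by (simp add: p.src.kulkarni_def G0 mat_def A0)
  have wK: "w i k = K i k - (if i = k then 0 else (\<mu> i + \<mu> k) / (N - 2))" for i k
    unfolding w_def p.src.weyl_eq[OF N2(2)] rie kul by (simp add: K_def N_def)
  have Rma: "p.src.Rm i j 0 $ k $ l = - p.src.Rm j i 0 $ k $ l" for i j k l
    unfolding p.src.Rm_antisym[OF U0, of i j] by simp
  have Rmb: "p.src.Rm i j 0 $ k $ l = - p.src.Rm i j 0 $ l $ k" for i j k l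
    using p.src.G_Rm_antisym_nth[OF U0, of i j k l] by (simp add: G0)
  have Ksym: "K i k = K k i" for i k
    unfolding K_def using Rma[of i k i k] Rmb[of k i i k] by simp
  have Kdiag: "K i i = 0" for i
    unfolding K_def using Rma[of i i i i] by simp
  have w_diag: "w i i = 0" for i by (simp add: wK Kdiag)
  have w_sym: "w i j = w j i" for i j by (simp add: wK Ksym[of i j] add.commute)
  \<comment> \<open>The row sum of the sectional curvatures is a diagonal entry of Ricci, and the
    row sum of the Schouten part is the same number.\<close>
  have w_sum: "(\<Sigma> j. w i j) = 0" for i
  proof -
    have "(\<Sigma> j. K i j) = (\<Sigma> j. K j i)" by (rule sum.cong[OF refl Ksym])
    also have "\<dots> = ricci G' 0 $ i $ i" unfolding p.src.ricci_eq[OF U0] K_def ..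
    also have "\<dots> = \<mu> i + R / (2 * (N - 1))"
      using A0[of i i] by (simp add: schouten_def G0 mat_def p.scalar_transform[OF U0] F0 R_def N_def)
    finally have 1: "(\<Sigma> j. K i j) = \<mu> i + R / (2 * (N - 1))" .
    have "(\<Sigma> j. if i = j then 0 else (\<mu> i + \<mu> j) / (N - 2))
       = (\<Sigma> j. (\<mu> i + \<mu> j) / (N - 2) - (if i = j then 2 * \<mu> i / (N - 2) else 0))"
      by (intro sum.cong refl) simp
    also have "\<dots> = (N * \<mu> i + N * m) / (N - 2) - 2 * \<mu> i / (N - 2)"
      by (simp add: sum_subtractf sum_divide_distrib[symmetric] sum.distrib tr_\<mu> N_def)
    also have "\<dots> = ((N - 2) * \<mu> i + N * m) / (N - 2)"
      by (simp add: diff_divide_distrib[symmetric] algebra_simps)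
    also have "\<dots> = \<mu> i + N * m / (N - 2)" using N2 by (simp add: add_divide_distrib)
    also have "N * m / (N - 2) = R / (2 * (N - 1))" using N2 by (simp add: m_def)
    finally show ?thesis using 1 by (simp add: wK sum_subtractf)
  qed
  let ?W2 = "normsq4 (G x0) (weyl G x0)"
  \<comment> \<open>Each ordered pair (i, j) contributes the squares of W_ijij and of W_ijji, which
    are equal; this accounts for the factor 2.\<close>
  have W2: "2 * (\<Sigma> i j. (w i j)\<^sup>2) \<le> ?W2"
  proof -
    have "2 * (w i j)\<^sup>2 \<le> (\<Sigma> r q. (weyl G' 0 i j r q)\<^sup>2)" for i j
    proof (cases "i = j")
      case True
      then show ?thesis by (simp add: w_diag sum_nonneg)
    next
      case False
      have "weyl G' 0 i j j i = - w i j"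
        unfolding w_def p.src.weyl_eq[OF N2(2)] rie p.src.kulkarni_def
        using Rmb[of i j j i] by (simp add: right_diff_distrib)
      then have "2 * (w i j)\<^sup>2 = (\<Sum>rq\<in>{(i,j),(j,i)}. (weyl G' 0 i j (fst rq) (snd rq))\<^sup>2)"
        using False by (simp add: w_def)
      also have "\<dots> \<le> (\<Sigma> rq. (weyl G' 0 i j (fst rq) (snd rq))\<^sup>2)"
        by (rule sum_mono2) auto
      also have "\<dots> = (\<Sigma> r q. (weyl G' 0 i j r q)\<^sup>2)"
        by (rule sum_UNIV_prod)
      finally show ?thesis .
    qed
    then have "(\<Sigma> i j. 2 * (w i j)\<^sup>2) \<le> (\<Sigma> i j r q. (weyl G' 0 i j r q)\<^sup>2)"
      by (intro sum_mono)
    then show ?thesis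
      unfolding normsq4_contract4[OF e] p.weyl_transform[OF U0 N2(2)] J0 F0 by (simp add: sum_distrib_left)
  qed
  define p2 where "p2 = (\<Sigma> i. (\<mu> i - m)\<^sup>2)"
  have E: "normsq2 (G x0) (tracefree_ricci G x0) = p2"
  proof -
    have "tracefree_ricci G x0 = schouten G x0 - m *\<^sub>R G x0"
    proof -
      have "R / N = R / (2 * D) + R * (D - 1) / (2 * N * D)" if "D > 0" "N = D + 1" for D
        using that by (simp add: divide_simps) (simp add: algebra_simps)
      from this[of "N - 1"] have "R / N = R / (2 * (N - 1)) + m" using N2 by (simp add: m_def)
      then show ?thesis
        by (simp add: tracefree_ricci_def schouten_def R_def[symmetric] N_def[symmetric] scaleR_add_left)
    qed
    moreover have "e a \<bullet> ((schouten G x0 - m *\<^sub>R G x0) *v e b) = (if a = b then \<mu> a - m else 0)" for a b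
      using e form[of a b] by (simp add: orthonormal_frame_def matrix_vector_mult_diff_rdistrib inner_diff_right scaleR_matrix_vector_assoc[symmetric])
    ultimately show ?thesis
      by (simp add: normsq2_frame[OF e] p2_def if_distrib[of "\<lambda>x. x\<^sup>2"] cong: if_cong)
  qed
  \<comment> \<open>Expressing sigma_2 by R and E moves 8N/(N-2)^3 |E|^2 to the left side, where 2
    N^2 (N-4) + 8 N = 2 N (N-2)^2 collapses the coefficient to 2N/(N-2).\<close>
  have pinch': "?W2 + 2 * N / (N - 2) * p2 < 2 * R\<^sup>2 / ((N - 1) * (N - 2))"
  proof -
    have "?W2 + 2 * N ^ 2 * (N - 4) / (N - 2) ^ 3 * p2 < 8 * N / (N - 2) ^ 3 * (2 * sigma2 (G x0) (schouten G x0))"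
      using pinch by (simp add: E N_def)
    also have "\<dots> = 8 * N / (N - 2) ^ 3 * ((N - 2)\<^sup>2 / (4 * N * (N - 1)) * R\<^sup>2 - p2)"
      unfolding sigma2_schouten[OF x0 N2(2)] E by (simp add: R_def N_def)
    also have "\<dots> = 2 * R\<^sup>2 / ((N - 1) * (N - 2)) - 8 * N / (N - 2) ^ 3 * p2"
    proof -
      have "8 * N / C ^ 3 * (C\<^sup>2 / (4 * N * D) * R\<^sup>2) = 2 * R\<^sup>2 / (D * C)" if "C > 0" "D > 0" for C D
        using that N2(1) by (simp add: power3_eq_cube power2_eq_square)
      from this[of "N - 2" "N - 1"] show ?thesis unfolding right_diff_distrib using N2 by simp
    qed
    finally have 1: "?W2 + (2 * N ^ 2 * (N - 4) / (N - 2) ^ 3 + 8 * N / (N - 2) ^ 3) * p2 < 2 * R\<^sup>2 / ((N - 1) * (N - 2))"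
      by (simp add: distrib_right)
    have "2 * N ^ 2 * (N - 4) / (N - 2) ^ 3 + 8 * N / (N - 2) ^ 3 = (2 * N ^ 2 * (N - 4) + 8 * N) / (N - 2) ^ 3"
      by (simp add: add_divide_distrib)
    also have "2 * N ^ 2 * (N - 4) + 8 * N = 2 * N * (N - 2)\<^sup>2" by algebra
    also have "2 * N * (N - 2)\<^sup>2 / (N - 2) ^ 3 = 2 * N / (N - 2)"
      using N2 by (simp add: power3_eq_cube power2_eq_square)
    finally show ?thesis using 1 by simp
  qed
  have p1: "(\<Sigma> i. \<mu> i - m) = 0" by (simp add: sum_subtractf tr_\<mu> N_def)
  have mR: "2 * N * m / (N - 2) = R / (N - 1)" using N2 by (simp add: m_def)
  have "(\<Sigma> k i. ((\<mu> i)\<^sup>2 - \<mu> i * \<mu> k) * (w i k + (if i = k then 0 else (\<mu> i + \<mu> k) / (N - 2)))) \<le> 0"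
    using boch by (simp add: wK K_def[symmetric])
  then have "- (\<Sigma> i j. w i j * ((\<mu> i - m) * (\<mu> j - m))) + N / (N - 2) * (\<Sigma> i. (\<mu> i - m) ^ 3)
      + R / (N - 1) * p2 \<le> 0"
    unfolding bochner_term_expansion[of \<mu> m w, folded N_def, OF N2(1) tr_\<mu> w_diag w_sym w_sum] mR p2_def[symmetric] .
  then have "p2 = 0"
    using weyl_ricci_pinching[of "\<lambda>i. \<mu> i - m" w, folded N_def p2_def, OF N2(1) p1 w_diag w_sym w_sum W2 Rpos pinch']
    by linarith
  then show ?thesis by (simp add: E)
qed

end

section \<open>Globalization\<close>

lemma riemannian_chart_metric_field:
  assumes "riemannian_manifold X \<A> g" "C \<in> \<A>"
  shows "metric_field (coords C) (g C)"
  using assms by unfold_locales (auto simp: riemannian_manifold_def smooth_manifold_def riemannian_metric_def)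

lemma chart_inj_on:
  assumes "riemannian_manifold X \<A> g" "C \<in> \<A>"
  shows "inj_on (snd C) (fst C)"
proof -
  have "openin X (fst C)" "homeomorphic_map (subtopology X (fst C)) (top_of_set (coords C)) (snd C)"
    using assms by (auto simp: riemannian_manifold_def smooth_manifold_def)
  then show ?thesis
    using homeomorphic_imp_injective_map[of "subtopology X (fst C)"] openin_subset[of X "fst C"]
    by (fastforce simp: topspace_subtopology inf_absorb2)
qed

lemma riemannian_transition:
  assumes X: "riemannian_manifold X \<A> g" and C: "C \<in> \<A>" and D: "D \<in> \<A>"
  shows "metric_pullback (overlap C D) (g C) (coords D) (g D) (transition C D)"
    and "p \<in> fst C \<Longrightarrow> transition C D (snd C p) = snd D p"
proof -
  note inj = chart_inj_on[OF X C]
  show tr: "transition C D (snd C p) = snd D p" if "p \<in> fst C" for p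
    using that inj by (simp add: transition_def)
  have hom: "homeomorphic_map (subtopology X (fst C)) (top_of_set (coords C)) (snd C)" and oC: "openin X (fst C)"
    and oD: "openin X (fst D)" and ocC: "open (coords C)" and sm: "smooth_on (overlap C D) (transition C D)"
    using X C D by (auto simp: riemannian_manifold_def smooth_manifold_def)
  have "openin (subtopology X (fst C)) (fst C \<inter> fst D)"
    using oD openin_subtopology_Int2 by blast
  then have "openin (top_of_set (coords C)) (overlap C D)"
    using homeomorphic_imp_open_map[OF hom] unfolding overlap_def open_map_def by blast
  then have oo: "open (overlap C D)" and sub: "overlap C D \<subseteq> coords C"
    using ocC by (auto simp: openin_open_eq)
  interpret c: metric_field "coords C" "g C" by (rule riemannian_chart_metric_field[OF X C])
  have mf: "metric_field (overlap C D) (g C)"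
    by unfold_locales (use oo sub c.smooth_G smooth_on_subset c.sym_G c.pos_G in auto)
  have im: "transition C D ` overlap C D \<subseteq> coords D"
    using tr by (auto simp: overlap_def coords_def)
  have "\<forall>x\<in>overlap C D. g C x = transpose (jacobian (transition C D) (at x)) ** g D (transition C D x) ** jacobian (transition C D) (at x)"
    using X C D by (auto simp: riemannian_manifold_def riemannian_metric_def Let_def)
  then show "metric_pullback (overlap C D) (g C) (coords D) (g D) (transition C D)"
    using mf riemannian_chart_metric_field[OF X D] sm im
    by (simp add: metric_pullback_def metric_pullback_axioms_def)
qed

text \<open>Invariance under transitions lets the chart expressions be pasted to one continuous
  function on the manifold, and compactness provides its maximum.\<close>

lemma scalar_curv_attains_max:
  assumes X: "riemannian_manifold X \<A> g" and comp: "compact_space X" and ne: "topspace X \<noteq> {}"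
  obtains C x where "C \<in> \<A>" "x \<in> coords C"
    "\<And>D y. D \<in> \<A> \<Longrightarrow> y \<in> coords D \<Longrightarrow> scalar_curv (g D) y \<le> scalar_curv (g C) x"
proof -
  let ?R = "\<lambda>C p. scalar_curv (g C) (snd C p)"
  have cover: "(\<Union>C\<in>\<A>. fst C) = topspace X" and ope: "\<And>C. C \<in> \<A> \<Longrightarrow> openin X (fst C)"
    and hom: "\<And>C. C \<in> \<A> \<Longrightarrow> homeomorphic_map (subtopology X (fst C)) (top_of_set (coords C)) (snd C)"
    using X by (auto simp: riemannian_manifold_def smooth_manifold_def)
  have cont: "continuous_map (subtopology X (fst C)) euclideanreal (?R C)" if C: "C \<in> \<A>" for C
  proof -
    interpret c: metric_field "coords C" "g C" by (rule riemannian_chart_metric_field[OF X C])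
    have "continuous_map (top_of_set (coords C)) euclideanreal (scalar_curv (g C))"
      using smooth_on_continuous[OF c.smooth_scalar_curv] by simp
    from continuous_map_compose[OF homeomorphic_imp_continuous_map[OF hom[OF C]] this] show ?thesis
      by (simp add: o_def)
  qed
  have agree: "?R C p = ?R D p" if "C \<in> \<A>" "D \<in> \<A>" "p \<in> topspace X \<inter> fst C \<inter> fst D" for C D p
  proof -
    interpret m: metric_pullback "overlap C D" "g C" "coords D" "g D" "transition C D"
      by (rule riemannian_transition(1)[OF X that(1,2)])
    have "snd C p \<in> overlap C D" using that by (auto simp: overlap_def)
    then show ?thesis
      using m.scalar_transform riemannian_transition(2)[OF X that(1,2)] that(3) by simp
  qed
  obtain f where f: "continuous_map X euclideanreal f" "\<And>p C. C \<in> \<A> \<Longrightarrow> p \<in> topspace X \<inter> fst C \<Longrightarrow> f p = ?R C p"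
    using pasting_lemma_exists[OF eq_refl[OF cover[symmetric]] ope cont agree] by blast
  have "compact (f ` topspace X)"
    using image_compactin[OF _ f(1), of "topspace X"] comp by (simp add: compact_space_def)
  then obtain p where p: "p \<in> topspace X" "\<And>q. q \<in> topspace X \<Longrightarrow> f q \<le> f p"
    using compact_attains_sup[of "f ` topspace X"] ne by auto
  obtain C where C: "C \<in> \<A>" "p \<in> fst C" using p(1) cover by blast
  show ?thesis
  proof (rule that[OF C(1)])
    show "snd C p \<in> coords C" using C by (simp add: coords_def)
    fix D y assume D: "D \<in> \<A>" "y \<in> coords D"
    then obtain q where q: "q \<in> fst D" "y = snd D q" by (auto simp: coords_def)
    then have "q \<in> topspace X" using D cover by blast
    then show "scalar_curv (g D) y \<le> scalar_curv (g C) (snd C p)"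
      using p(2)[of q] f(2)[OF D(1), of q] f(2)[OF C(1), of p] q C p(1) by simp
  qed
qed

theorem theorem1p1:
  fixes M :: "'a topology"
    and \<A> :: "('a, 'n::finite) chart set"
    and g :: "('a, 'n) metric"
    and n :: nat
  assumes "n = CARD('n)" and "n \<ge> 4"
    and "riemannian_manifold M \<A> g"
    and "compact_space M"
    and "harmonic_weyl \<A> g"
    and "\<And>C x. C \<in> \<A> \<Longrightarrow> x \<in> coords C \<Longrightarrow> scalar_curv (g C) x > 0"
    and "\<exists>s>0. \<forall>C\<in>\<A>. \<forall>x\<in>coords C. sigma2 (g C x) (schouten (g C) x) = s"
    and "\<And>C x. C \<in> \<A> \<Longrightarrow> x \<in> coords C \<Longrightarrow>
           normsq4 (g C x) (weyl (g C) x)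
           + 2 * real n ^ 2 * (real n - 4) / (real n - 2) ^ 3
             * normsq2 (g C x) (tracefree_ricci (g C) x)
           < 16 * real n / (real n - 2) ^ 3 * sigma2 (g C x) (schouten (g C) x)"
  shows "einstein \<A> g"
proof (cases "topspace M = {}")
  \<comment> \<open>Without points there is no maximum to start from, and the Einstein condition is
    vacuous.\<close>
  case True
  then have "fst C = {}" if "C \<in> \<A>" for C
    using that assms(3) by (auto simp: riemannian_manifold_def smooth_manifold_def)
  then show ?thesis by (auto simp: einstein_def coords_def)
next
  case False
  define N where "N = real CARD('n)"
  have N: "N > 2" "real CARD('n) > 2" "N > 3" using assms(1,2) by (auto simp: N_def)
  note mf = riemannian_chart_metric_field[OF assms(3)]
  obtain s where s: "s > 0" and sig: "\<And>C x. C \<in> \<A> \<Longrightarrow> x \<in> coords C \<Longrightarrow> sigma2 (g C x) (schouten (g C) x) = s"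
    using assms(7) by blast
  obtain C x where C: "C \<in> \<A>" "x \<in> coords C"
    and max: "\<And>D y. D \<in> \<A> \<Longrightarrow> y \<in> coords D \<Longrightarrow> scalar_curv (g D) y \<le> scalar_curv (g C) x"
    using scalar_curv_attains_max[OF assms(3,4) False] by blast
  define R where "R = scalar_curv (g C) x"
  define c0 where "c0 = (N - 2)\<^sup>2 / (4 * N * (N - 1))"
  have c0: "c0 > 0" using N by (simp add: c0_def)
  have rel: "2 * s = c0 * (scalar_curv (g D) y)\<^sup>2 - normsq2 (g D y) (tracefree_ricci (g D) y)"
    if "D \<in> \<A>" "y \<in> coords D" for D y
  proof -
    interpret d: metric_field "coords D" "g D" by (rule mf[OF that(1)])
    show ?thesis
      using d.sigma2_schouten[OF that(2) N(2)] sig[OF that] by (simp add: c0_def N_def)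
  qed
  have "normsq2 (g C x) (tracefree_ricci (g C) x) = 0"
  proof -
    interpret c: metric_field "coords C" "g C" by (rule mf[OF C(1)])
    \<comment> \<open>The factor (N-3)/(N-2) between div W and the Cotton tensor is nonzero because
      N > 3.\<close>
    have cot: "c.cotton (schouten (g C)) y i j k = 0" if y: "y \<in> coords C" for y i j k
    proof -
      have "div_weyl (g C) y i j k = 0" using assms(5) C(1) y by (simp add: harmonic_weyl_def)
      then show ?thesis using c.div_weyl_eq[OF y N(2)] N by (simp add: N_def)
    qed
    show ?thesis
      by (rule c.tracefree_ricci_0_at_maximum[OF C(2) _ cot sig[OF C(1)] s assms(6)[OF C] max[OF C(1)]])
        (use assms(1,2) assms(8)[OF C] in simp_all)
  qed
  then have sR: "2 * s = c0 * R\<^sup>2" using rel[OF C] by (simp add: R_def)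
  have Rpos: "R > 0" using assms(6)[OF C] by (simp add: R_def)
  have "ricci (g D) y = (R / N) *\<^sub>R g D y" if D: "D \<in> \<A>" "y \<in> coords D" for D y
  proof -
    interpret d: metric_field "coords D" "g D" by (rule mf[OF D(1)])
    let ?r = "scalar_curv (g D) y"
    have r: "?r > 0" "?r \<le> R" using assms(6)[OF D] max[OF D] by (auto simp: R_def)
    have E: "normsq2 (g D y) (tracefree_ricci (g D) y) = c0 * (?r\<^sup>2 - R\<^sup>2)"
      using rel[OF D] sR by (simp add: right_diff_distrib)
    have "?r\<^sup>2 \<le> R\<^sup>2" using r by (intro power_mono) auto
    then have "c0 * (?r\<^sup>2 - R\<^sup>2) \<le> 0" using c0 by (simp add: mult_nonneg_nonpos)
    with normsq2_nonneg[OF d.spd_G[OF D(2)], of "tracefree_ricci (g D) y"]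
    have z: "normsq2 (g D y) (tracefree_ricci (g D) y) = 0" unfolding E by linarith
    then have "?r\<^sup>2 = R\<^sup>2" using E c0 by simp
    \<comment> \<open>Positivity of R selects the root. The scalar curvature therefore takes its
      global maximum everywhere, which gives the same Einstein constant R/N in all charts.\<close>
    then have "?r = R" using r Rpos by (simp add: power2_eq_iff)
    moreover have "tracefree_ricci (g D) y = 0" by (rule normsq2_eq_0[OF d.spd_G[OF D(2)] z])
    ultimately show ?thesis by (simp add: tracefree_ricci_def N_def)
  qed
  then show ?thesis unfolding einstein_def by blast
qed

end
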